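(* Let $w\ge 4$, $u=w-2$, $v=w-1$, let $\sum$ denote the sum over positive integers $a,b,c$ with $a+b+c=w$, and write $\tilde b=b-1$. Then, as identities of polynomials in $T$, \begin{align*} \sum 2\cdot 2^{\tilde b}\zeta_\sqcup(a,b,c)&=2\zeta_*(1,1,u)+w\zeta_*(1,v)-2\zeta(u,2)-\zeta(w),\\ \sum 2\cdot 2^{\tilde b}\zeta_\sqcup(a,\bar b,c)&=4\zeta(u,\bar1,\bar1)-4\zeta(u,\bar1,1)-2\zeta(\bar1,\bar1,u)+2\zeta(\bar1,1,u)+2\zeta_*(1,\bar1,u)+2\zeta(\bar v,\bar1)-2\zeta(\bar v,1)\\ &\quad+u\zeta_*(1,v)+2\zeta_*(1,\bar v)+4\zeta(\bar2,u)+2\zeta(u,2)+\zeta(w)+2\zeta(\bar w),\\ \sum 2\cdot 2^{\tilde b}\zeta(\bar a,b,c)&=2\zeta(\bar1,\bar1,\bar u)+w\zeta(\bar1,\bar v)+2\zeta(\bar v,\bar1)-2\zeta(\bar v,1)+\zeta(\bar2,\bar u)+\zeta(2,\bar u)+2\zeta(w)-\zeta(\bar w)+\zeta(2)\zeta(\bar u),\\ \sum 2\cdot 2^{\tilde b}\zeta(\bar a,\bar b,c)&=2\zeta(\bar1,\bar1,\bar u)+u\zeta(\bar1,\bar v)+2\zeta(\bar1,v)+\zeta(\bar2,\bar u)+\zeta(2,\bar u)+\zeta(\bar w),\\ \sum 2^{\tilde b}\big(\zeta_\sqcup(\bar a,\bar b,\bar c)+\zeta_\sqcup(\bar a,b,\bar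 c)\big)&=2\zeta(u,\bar1,1)+2\zeta(\bar1,\bar1,u)-2\zeta(u,\bar1,\bar1)+v\zeta(\bar1,v)+\zeta(\bar v,1)+\zeta(\bar1,\bar v)\\ &\quad-\zeta(\bar v,\bar1)+\zeta(2,u)-\zeta(u,2),\\ \sum 2^{\tilde b}\big(\zeta_\sqcup(a,b,\bar c)+\zeta_\sqcup(a,\bar b,\bar c)\big)&=\zeta_*(1,\bar1,\bar u)+\zeta(\bar1,1,\bar u)-\zeta(\bar1,\bar1,\bar u)+\zeta_*(1,1,\bar u)-\zeta(\bar v,\bar1)+\zeta(\bar v,1)\\ &\quad+\zeta_*(1,v)+v\zeta_*(1,\bar v)+\zeta(\bar2,\bar u)+\zeta(2,\bar u)+\zeta(\bar w)+3\zeta(\bar2)\zeta(\bar u). \end{align*}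
   Context: Euler sums: for positive integers $s_j$ and $z_j\in\{\pm1\}$, $\zeta(s_1,\dots,s_d;z_1,\dots,z_d)=\sum_{n_1>\dots>n_d>0}\frac{z_1^{n_1}\cdots z_d^{n_d}}{n_1^{s_1}\cdots n_d^{s_d}}$, convergent iff $(s_1,z_1)\ne(1,1)$; a bar over the $j$-th argument means $z_j=-1$, no bar means $z_j=1$. Regularized values: the truncated sum $\zeta^{(M)}$ (restricted to $M\ge n_1$) has, as $M\to\infty$, an expansion $P(\log M+\gamma)+o(1)$ with $P$ a polynomial ($\gamma$ Euler's constant); $\zeta_*:=P(T)\in\mathbb{R}[T]$. With $a_k=\prod_{j\le k}z_j$, $\int_0^{1-\varepsilon}\left(\frac{dt}{t}\right)^{s_1-1}\frac{dt}{a_1-t}\cdots\left(\frac{dt}{t}\right)^{s_d-1}\frac{dt}{a_d-t}$ (iterated integral over $1-\varepsilon>t_1>t_2>\dots>0$, forms read left to right) has, as $\varepsilon\to0^+$, an expansion $Q(-\log\varepsilon)+o(1)$; $\zeta_\sqcup:=Q(T)$. Both equal the Euler sum for convergent indices. *)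

theory Defs
  imports "HOL-Analysis.Analysis" "HOL-Computational_Algebra.Polynomial"
begin

text \<open>An index is a list of pairs (s_j, barred_j); barred means z_j = -1.\<close>
type_synonym eindex = "(nat \<times> bool) list"

abbreviation nb :: "nat \<Rightarrow> nat \<times> bool" where "nb s \<equiv> (s, False)"
abbreviation br :: "nat \<Rightarrow> nat \<times> bool" where "br s \<equiv> (s, True)"

definition zsgn :: "bool \<Rightarrow> real" where "zsgn b = (if b then -1 else 1)"

fun zeta_trunc :: "eindex \<Rightarrow> nat \<Rightarrow> real" where
  "zeta_trunc [] M = 1"
| "zeta_trunc ((s, b) # rest) M =
     (\<Sum>n=1..M. zsgn b ^ n / real n ^ s * zeta_trunc rest (n - 1))"

definition zeta :: "eindex \<Rightarrow> real" where
  "zeta idx = lim (\<lambda>M. zeta_trunc idx M)"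

definition zeta_star :: "eindex \<Rightarrow> real poly" where
  "zeta_star idx = (THE P. ((\<lambda>M::nat. zeta_trunc idx M - poly P (ln (real M) + euler_mascheroni))
                        \<longlongrightarrow> 0) sequentially)"

fun form :: "real option \<Rightarrow> real \<Rightarrow> real" where
  "form None t = 1 / t"
| "form (Some a) t = 1 / (a - t)"

fun word_aux :: "real \<Rightarrow> eindex \<Rightarrow> real option list" where
  "word_aux c [] = []"
| "word_aux c ((s, b) # rest) =
     replicate (s - 1) None @ [Some (c * zsgn b)] @ word_aux (c * zsgn b) rest"

definition word :: "eindex \<Rightarrow> real option list" where
  "word idx = word_aux 1 idx"

fun iter_int :: "real option list \<Rightarrow> real \<Rightarrow> real" where
  "iter_int [] x = 1"
| "iter_int (l # ls) x = (LBINT t:{0<..<x}. form l t * iter_int ls t)"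

definition zeta_sh :: "eindex \<Rightarrow> real poly" where
  "zeta_sh idx = (THE Q. ((\<lambda>\<epsilon>. iter_int (word idx) (1 - \<epsilon>) - poly Q (- ln \<epsilon>))
                        \<longlongrightarrow> 0) (at_right 0))"

definition comp3 :: "nat \<Rightarrow> (nat \<times> nat \<times> nat) set" where
  "comp3 w = {(a, b, c). 0 < a \<and> 0 < b \<and> 0 < c \<and> a + b + c = w}"

end

theory Submission
  imports Defs "HOL-Real_Asymp.Real_Asymp"
begin

text \<open>
  With \<open>n\<^sub>3 = p\<close>, \<open>n\<^sub>2 = p + q\<close>, \<open>n\<^sub>1 = n\<close>, the weights \<open>2\<^bsup>b-1\<^esup>\<close> are exactly those for which
  symmetrizing in \<open>p\<close> and \<open>q\<close> turns the sum over \<open>(a,b,c)\<close> into the sum over \<open>p + q < n\<close> of signs times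
  \<open>\<Sum> 1 / (n\<^sup>a p\<^sup>b q\<^sup>c)\<close>. Partial fractions split this into contributions \<open>\<plusminus>L\<^sub>q(M) / q\<^sup>u\<close> of the single poles
  \<open>q\<close>, where \<open>L\<^sub>q(M)\<close> is a combination of signed harmonic sums of depth at most two, up to an error that
  tends to \<open>0\<close> as \<open>M\<close> grows and is bounded by a multiple of \<open>H\<^sub>q\<^sup>2\<close>. The truncated right-hand sides have
  the same shape, and the identities hold for each \<open>q\<close> separately, up to multiples of
  \<open>\<zeta>(2)\<close>; Tannery's theorem then sums over \<open>q\<close>.

  Both regularizations are read off one expansion: if the truncated sum is \<open>P(H\<^sub>M) + o(1)\<close> with \<open>P\<close> of
  degree at most two, then \<open>\<zeta>\<^sub>* = P\<close>, whereas by Abel's theorem \<open>\<zeta>\<^sub>\<squnion> = P + \<zeta>(2) [T\<^sup>2]P\<close>, because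
  \<open>log\<^sup>2(1 - t)\<close> has the partial sums \<open>H\<^sub>M\<^sup>2 - H\<^sub>M\<^sup>(\<^sup>2\<^sup>)\<close> of its coefficients.
\<close>

text \<open>The substitution attaches the sign z2 z3 to \<open>p\<close> and z2 to \<open>q\<close>.
  If the third argument has no bar, the two signs agree and symmetrizing merely doubles the sum:
  hence the factor 2 in the first four identities. If it has a bar, exchanging \<open>p\<close> and
  \<open>q\<close> toggles the bar on the second argument: hence the paired sums in the last two.
  The main obstacle is that the finite sums depend on the pole. Writing \<open>n = q + s\<close>
  gives \<open>s\<close> the cutoff \<open>M - q\<close>, and the other index enters through
  \<open>1 / (j - q)\<close>, which produces harmonic sums with arguments shifted by
  \<open>q\<close>. Both shifts must be undone uniformly in \<open>q\<close>. For an unbarred first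
  argument the coefficients diverge with \<open>M\<close>. The two sides are therefore subtracted at
  finite \<open>M\<close>, pole by pole, and only the difference has a limit. Its coefficient is a
  constant K independent of \<open>q\<close>: zeta(2) in the first identity, zeta(2)/2 in the sixth
  and 0 in the others. So the sides differ by K times zeta(u) or zeta(bar u), which is exactly the
  discrepancy between the two regularizations.\<close>

section \<open>Truncated sums and their regularized values\<close>

text \<open>Any power rate would do: it only has to survive division by \<open>n\<close> and summation against logarithms.\<close>

definition fast_limit :: "(nat \<Rightarrow> real) \<Rightarrow> real \<Rightarrow> bool" where
  "fast_limit X L \<longleftrightarrow> (\<lambda>n. X n - L) \<in> O(\<lambda>n. real n powr (-1/2))"

lemma fast_limit_imp_tendsto: "fast_limit X L \<Longrightarrow> X \<longlonglongrightarrow> L"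
proof -
  assume "fast_limit X L"
  moreover have "(\<lambda>n. real n powr (-1/2)) \<in> o(\<lambda>_. 1)" by real_asymp
  ultimately have "(\<lambda>n. X n - L) \<in> o(\<lambda>_. 1)"
    unfolding fast_limit_def by (rule landau_o.big_small_trans)
  then have "(\<lambda>n. X n - L) \<longlonglongrightarrow> 0" by (auto dest: smalloD_tendsto)
  then show ?thesis by (simp add: LIM_zero_iff)
qed

text \<open>Increments of order n^(-3/2) are dominated by differences of a multiple of n^(-1/2).
  Telescoping gives the Cauchy property; letting the larger index tend to infinity in the same
  estimate gives the rate.\<close>

lemma fast_limit_of_diff:
  assumes "(\<lambda>n. X (Suc n) - X n) \<in> O(\<lambda>n. real n powr (-3/2))"
  shows "\<exists>L. fast_limit X L"
proof -
  define g where "g = (\<lambda>n::nat. real n powr (-1/2))"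
  \<comment> \<open>The differences of \<open>g\<close> are asymptotic to n^(-3/2) / 2, so any
    factor above 2 is enough.\<close>
  have "eventually (\<lambda>n. real n powr (-3/2) \<le> 4 * (g n - g (Suc n))) at_top"
    unfolding g_def by real_asymp
  moreover obtain C where C: "C > 0" and
    "eventually (\<lambda>n. norm (X (Suc n) - X n) \<le> C * norm (real n powr (-3/2))) at_top"
    using assms by (elim landau_o.bigE)
  from calculation this(2) have "eventually (\<lambda>n. \<bar>X (Suc n) - X n\<bar> \<le> 4 * C * (g n - g (Suc n))) at_top"
  proof (rule eventually_elim2)
    fix n assume elim: "real n powr (-3/2) \<le> 4 * (g n - g (Suc n))"
      "norm (X (Suc n) - X n) \<le> C * norm (real n powr (-3/2))"
    have "C * (real n powr (-3/2)) \<le> C * (4 * (g n - g (Suc n)))"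
      using elim(1) C(1) by (intro mult_left_mono) auto
    then show "\<bar>X (Suc n) - X n\<bar> \<le> 4 * C * (g n - g (Suc n))"
      using elim(2) by (simp add: mult.assoc mult.left_commute[of 4 C])
  qed
  then obtain N where N: "\<And>n. n \<ge> N \<Longrightarrow> \<bar>X (Suc n) - X n\<bar> \<le> 4 * C * (g n - g (Suc n))"
    by (auto simp: eventually_at_top_linorder)
  have tel: "\<bar>X m - X n\<bar> \<le> 4 * C * (g n - g m)" if "N \<le> n" "n \<le> m" for m n
    using that(2)
  proof (induction m rule: dec_induct)
    case (step m)
    then show ?case using N[of m] that(1) by (simp add: algebra_simps)
  qed auto
  have gpos: "g n \<ge> 0" for n by (simp add: g_def)
  have tel': "\<bar>X m - X n\<bar> \<le> 4 * C * g n" if "N \<le> n" "n \<le> m" for m n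
  proof -
    have "4 * C * (g n - g m) \<le> 4 * C * g n"
      using C(1) gpos[of m] by (intro mult_left_mono) auto
    then show ?thesis using tel[OF that] by linarith
  qed
  have g0: "(\<lambda>n. 4 * C * g n) \<longlonglongrightarrow> 0" unfolding g_def by real_asymp
  have "Cauchy X"
  proof (rule metric_CauchyI)
    fix e :: real assume "e > 0"
    then have "eventually (\<lambda>n. 4 * C * g n < e / 2) at_top"
      using g0 by (intro order_tendstoD) auto
    then obtain M where M: "\<And>n. n \<ge> M \<Longrightarrow> 4 * C * g n < e / 2"
      by (auto simp: eventually_at_top_linorder)
    have "dist (X m) (X n) < e" if "m \<ge> max M N" "n \<ge> max M N" for m n
      using tel'[of "max M N" m] tel'[of "max M N" n] M[of "max M N"] that
      by (auto simp: dist_real_def)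
    then show "\<exists>K. \<forall>m\<ge>K. \<forall>n\<ge>K. dist (X m) (X n) < e" by blast
  qed
  then obtain L where L: "X \<longlonglongrightarrow> L" using Cauchy_convergent convergent_def by blast
  have "\<bar>X n - L\<bar> \<le> 4 * C * g n" if "n \<ge> N" for n
  proof -
    have "(\<lambda>m. \<bar>X m - X n\<bar>) \<longlonglongrightarrow> \<bar>L - X n\<bar>" by (intro tendsto_intros L)
    moreover have "eventually (\<lambda>m. \<bar>X m - X n\<bar> \<le> 4 * C * g n) at_top"
      using tel'[OF that] by (intro eventually_mono[OF eventually_ge_at_top[of n]])
    ultimately have "\<bar>L - X n\<bar> \<le> 4 * C * g n"
      using tendsto_upperbound trivial_limit_sequentially by blast
    then show ?thesis by linarith
  qed
  then have "(\<lambda>n. X n - L) \<in> O(g)"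
    using gpos by (intro bigoI[of _ "4 * C"]) (auto simp: eventually_at_top_linorder)
  then show ?thesis unfolding fast_limit_def g_def by blast
qed

section \<open>Growth and convergence of truncated Euler sums\<close>

lemma zeta_trunc_Suc:
  "zeta_trunc ((s, b) # rest) (Suc M) = zeta_trunc ((s, b) # rest) M
     + zsgn b ^ Suc M / real (Suc M) ^ s * zeta_trunc rest M"
  by simp

lemma zeta_trunc_0 [simp]: "zeta_trunc (p # rest) 0 = 0"
  by (cases p) simp

lemma abs_zsgn_power [simp]: "\<bar>zsgn b ^ n\<bar> = 1" "\<bar>zsgn b\<bar> = 1"
  by (simp_all add: zsgn_def power_abs)

abbreviation pos_index :: "eindex \<Rightarrow> bool" where
  "pos_index idx \<equiv> \<forall>p\<in>set idx. 1 \<le> fst p"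

lemma zeta_trunc_le_harm:
  "pos_index idx \<Longrightarrow> \<bar>zeta_trunc idx n\<bar> \<le> harm n ^ length idx"
proof (induction idx arbitrary: n)
  case (Cons p rest)
  obtain s b where p: "p = (s, b)" by force
  have s: "s \<ge> 1" using Cons.prems by (simp add: p)
  have "\<bar>zeta_trunc (p # rest) n\<bar>
      \<le> (\<Sum>k=1..n. \<bar>zsgn b ^ k / real k ^ s * zeta_trunc rest (k - 1)\<bar>)"
    unfolding p zeta_trunc.simps by (rule sum_abs)
  also have "\<dots> \<le> (\<Sum>k=1..n. inverse (real k) * harm n ^ length rest)"
  proof (rule sum_mono)
    fix k assume k: "k \<in> {1..n}"
    have 1: "1 / real k ^ s \<le> inverse (real k)"
      using k s power_increasing[of 1 s "real k"] by (auto simp: field_simps)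
    have "\<bar>zeta_trunc rest (k - 1)\<bar> \<le> harm (k - 1) ^ length rest"
      using Cons by simp
    also have "\<dots> \<le> harm n ^ length rest"
      using k by (intro power_mono harm_mono harm_nonneg) auto
    finally show "\<bar>zsgn b ^ k / real k ^ s * zeta_trunc rest (k - 1)\<bar>
        \<le> inverse (real k) * harm n ^ length rest"
      using 1 unfolding abs_mult abs_divide abs_zsgn_power
      by (intro mult_mono) auto
  qed
  also have "\<dots> = harm n ^ length (p # rest)"
    by (simp add: harm_def sum_distrib_right)
  finally show ?case .
qed simp

lemma harm_power_bigo:
  assumes "d > 0"
  shows "(\<lambda>n. harm n ^ k :: real) \<in> O(\<lambda>n. real n powr d)"
proof -
  have "(\<lambda>n. harm n - ln (real n) :: real) \<in> O(\<lambda>_. 1)"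
    using euler_mascheroni_LIMSEQ
    by (intro bigoI_tendsto[where c = euler_mascheroni]) auto
  also have "(\<lambda>_. 1) \<in> O(\<lambda>n. ln (real n))" by real_asymp
  finally have "(\<lambda>n. (harm n - ln (real n)) + ln (real n) :: real) \<in> O(\<lambda>n. ln (real n))"
    by (rule sum_in_bigo) simp
  then have "(\<lambda>n. harm n ^ k :: real) \<in> O(\<lambda>n. ln (real n) ^ k)"
    by (intro landau_o.big_power) simp
  also have "(\<lambda>n. ln (real n) ^ k) \<in> O(\<lambda>n. real n powr d)"
  proof -
    have "(\<lambda>n. ln (real n) powr real k) \<in> O(\<lambda>n. real n powr d)"
      using assms by real_asymp
    moreover have "eventually (\<lambda>n. ln (real n) powr real k = ln (real n) ^ k) at_top"
      using eventually_gt_at_top[of 1] by eventually_elim (simp add: powr_realpow)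
    ultimately show ?thesis by (simp add: landau_o.big.in_cong)
  qed
  finally show ?thesis .
qed

lemma zeta_trunc_bigo:
  assumes "pos_index idx" "d > 0"
  shows "zeta_trunc idx \<in> O(\<lambda>n. real n powr d)"
proof -
  have "zeta_trunc idx \<in> O(\<lambda>n. harm n ^ length idx)"
    using zeta_trunc_le_harm[OF assms(1)] by (intro bigoI[of _ 1]) (auto simp: harm_nonneg)
  also have "\<dots> \<subseteq> O(\<lambda>n. real n powr d)"
    using harm_power_bigo[OF assms(2)] by (simp add: landau_o.big.subsetI)
  finally show ?thesis .
qed

text \<open>Removing half of the last term, i.e. averaging consecutive partial sums, turns the
  alternating increment into half a difference of \<open>D\<close>, to which the absolute criterion
  applies. The removed half term has the required rate itself.\<close>

lemma fast_limit_alternating: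
  assumes "D \<in> O(\<lambda>n. real n powr (-1/2))"
    and "(\<lambda>n. D (Suc n) - D n) \<in> O(\<lambda>n. real n powr (-3/2))"
  shows "\<exists>L. fast_limit (\<lambda>M. \<Sum>n=1..M. (-1) ^ n * D n) L"
proof -
  define X where "X = (\<lambda>M. \<Sum>n=1..M. (-1) ^ n * D n)"
  define Y where "Y = (\<lambda>M. X M - (-1) ^ M * D M / 2)"
  have "Y (Suc M) - Y M = (-1) ^ Suc M * ((D (Suc M) - D M) / 2)" for M
    by (simp add: Y_def X_def field_simps)
  then have "\<bar>Y (Suc M) - Y M\<bar> = \<bar>D (Suc M) - D M\<bar> / 2" for M
    by (simp add: abs_mult)
  then have "norm (Y (Suc n) - Y n) \<le> 1 * norm (D (Suc n) - D n)" for n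
    by (simp only: real_norm_def) simp
  then have "(\<lambda>n. Y (Suc n) - Y n) \<in> O(\<lambda>n. D (Suc n) - D n)"
    by (intro bigoI[of _ 1] always_eventually allI)
  from fast_limit_of_diff[OF landau_o.big_trans[OF this assms(2)]]
  obtain L where L: "(\<lambda>n. Y n - L) \<in> O(\<lambda>n. real n powr (-1/2))"
    unfolding fast_limit_def by blast
  have "(\<lambda>M. (-1) ^ M * D M / 2) \<in> O(D)"
    by (intro bigoI[of _ 1]) (auto simp: abs_mult)
  then have "(\<lambda>M. (-1) ^ M * D M / 2) \<in> O(\<lambda>n. real n powr (-1/2))"
    using assms(1) landau_o.big_trans by blast
  from sum_in_bigo(1)[OF L this] have "fast_limit X L"
    by (simp add: fast_limit_def Y_def algebra_simps)
  then show ?thesis unfolding X_def by blast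
qed

lemma zeta_trunc_pred_bigo:
  assumes "pos_index idx" "d > 0"
  shows "(\<lambda>n. zeta_trunc idx (n - 1)) \<in> O(\<lambda>n. real n powr d)"
proof -
  have "\<bar>zeta_trunc idx (n - 1)\<bar> \<le> harm n ^ length idx" for n
    using zeta_trunc_le_harm[OF assms(1), of "n - 1"]
      power_mono[OF harm_mono[of "n - 1" n, where 'a = real] harm_nonneg, of "length idx"] by simp
  then have "(\<lambda>n. zeta_trunc idx (n - 1)) \<in> O(\<lambda>n. harm n ^ length idx)"
    by (intro bigoI[of _ 1]) (auto simp: harm_nonneg)
  also have "\<dots> \<subseteq> O(\<lambda>n. real n powr d)"
    using harm_power_bigo[OF assms(2)] by (simp add: landau_o.big.subsetI)
  finally show ?thesis .
qed

text \<open>The increment is of order 1/n times a power of a logarithm. The exponent 1/4 given away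
  absorbs the logarithms and still leaves better than n^(-3/2) after one more division by n.\<close>

lemma zeta_trunc_diff_bigo:
  assumes "pos_index idx"
  shows "(\<lambda>n. zeta_trunc idx n - zeta_trunc idx (n - 1)) \<in> O(\<lambda>n. real n powr (-3/4))"
proof (cases idx)
  case (Cons p rest)
  obtain s b where p: "p = (s, b)" by force
  have s: "s \<ge> 1" using assms Cons p by simp
  have "(\<lambda>n. zeta_trunc rest (n - 1)) \<in> O(\<lambda>n. real n powr (1/4))"
    using assms by (intro zeta_trunc_pred_bigo) (auto simp: Cons)
  moreover have "(\<lambda>n. zsgn b ^ n / real n ^ s) \<in> O(\<lambda>n. real n powr (-1))"
  proof (intro bigoI[of _ 1] eventually_mono[OF eventually_gt_at_top[of 0]])
    fix n :: nat assume "n > 0"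
    then show "norm (zsgn b ^ n / real n ^ s) \<le> 1 * norm (real n powr (-1))"
      using power_increasing[of 1 s "real n"] s by (auto simp: powr_minus field_simps)
  qed
  ultimately have "(\<lambda>n. zsgn b ^ n / real n ^ s * zeta_trunc rest (n - 1))
      \<in> O(\<lambda>n. real n powr (-1) * real n powr (1/4))"
    using landau_o.big.mult by blast
  also have "(\<lambda>n::nat. real n powr (-1) * real n powr (1/4)) \<in> O(\<lambda>n. real n powr (-3/4))"
    by real_asymp
  finally have "(\<lambda>n. zsgn b ^ n / real n ^ s * zeta_trunc rest (n - 1))
      \<in> O(\<lambda>n. real n powr (-3/4))" .
  moreover have "zeta_trunc idx n - zeta_trunc idx (n - 1)
      = zsgn b ^ n / real n ^ s * zeta_trunc rest (n - 1)" if "n > 0" for n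
    using that zeta_trunc_Suc[of s b rest "n - 1"] by (simp add: Cons p)
  ultimately show ?thesis
    by (subst landau_o.big.in_cong) (auto intro: eventually_mono[OF eventually_gt_at_top[of 0]])
qed simp

fun conv_index :: "eindex \<Rightarrow> bool" where
  "conv_index [] = False"
| "conv_index (p # rest) = (p \<noteq> nb 1 \<and> pos_index (p # rest))"

text \<open>A leading exponent of at least 2 makes the increments small enough in absolute value. A
  leading barred 1 only gives order 1/n up to logarithms, and there the alternation has to be
  exploited.\<close>

lemma zeta_trunc_fast_limit:
  assumes "conv_index idx"
  shows "\<exists>L. fast_limit (zeta_trunc idx) L"
proof -
  obtain s b rest where idx: "idx = (s, b) # rest"
    using assms by (cases idx) auto
  have pos: "pos_index rest" "s \<ge> 1" using assms by (auto simp: idx)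
  consider "s \<ge> 2" | "s = 1" "b" using assms pos(2) by (cases "s = 1") (auto simp: idx)
  then show ?thesis
  proof cases
    case 1
    have "(\<lambda>n. zsgn b ^ Suc n / real (Suc n) ^ s) \<in> O(\<lambda>n. real n powr (-2))"
    proof (intro bigoI[of _ 1] eventually_mono[OF eventually_gt_at_top[of 0]])
      fix n :: nat assume n: "n > 0"
      have "real n ^ 2 \<le> real (Suc n) ^ 2" by (intro power_mono) auto
      also have "\<dots> \<le> real (Suc n) ^ s" using 1 by (intro power_increasing) auto
      finally show "norm (zsgn b ^ Suc n / real (Suc n) ^ s) \<le> 1 * norm (real n powr (-2))"
        using n by (simp add: powr_minus field_simps del: power_Suc of_nat_Suc)
    qed
    from landau_o.big.mult[OF this zeta_trunc_bigo[OF pos(1), of "1/4"]]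
    have "(\<lambda>n. zeta_trunc idx (Suc n) - zeta_trunc idx n)
        \<in> O(\<lambda>n. real n powr (-2) * real n powr (1/4))"
      unfolding idx zeta_trunc_Suc by simp
    also have "(\<lambda>n. real n powr (-2) * real n powr (1/4)) \<in> O(\<lambda>n. real n powr (-3/2))"
      by real_asymp
    finally show ?thesis by (rule fast_limit_of_diff)
  next
    case 2
    define D where "D = (\<lambda>n. zeta_trunc rest (n - 1) / real n)"
    have D1: "D \<in> O(\<lambda>n. real n powr (-1/2))"
    proof -
      have "D \<in> O(\<lambda>n. real n powr (1/4) / real n)"
        unfolding D_def
        by (intro landau_o.big.divide_right zeta_trunc_pred_bigo pos
              eventually_mono[OF eventually_gt_at_top[of 0]]) auto
      also have "(\<lambda>n. real n powr (1/4) / real n) \<in> O(\<lambda>n. real n powr (-1/2))" by real_asymp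
      finally show ?thesis .
    qed
    \<comment> \<open>Discrete product rule for \<open>D\<close>: the change of the inner sum and
      the change of the factor 1/n are estimated separately.\<close>
    have "(\<lambda>n. (zeta_trunc rest n - zeta_trunc rest (n - 1)) * (1 / real (Suc n))
             - zeta_trunc rest (n - 1) * (1 / (real n * real (Suc n))))
          \<in> O(\<lambda>n. real n powr (-3/2))"
    proof (rule sum_in_bigo)
      have "(\<lambda>n. (zeta_trunc rest n - zeta_trunc rest (n - 1)) * (1 / real (Suc n)))
          \<in> O(\<lambda>n. real n powr (-3/4) * (1 / real (Suc n)))"
        by (intro landau_o.big.mult zeta_trunc_diff_bigo pos) auto
      also have "(\<lambda>n. real n powr (-3/4) * (1 / real (Suc n))) \<in> O(\<lambda>n. real n powr (-3/2))"
        by real_asymp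
      finally show "(\<lambda>n. (zeta_trunc rest n - zeta_trunc rest (n - 1)) * (1 / real (Suc n)))
          \<in> O(\<lambda>n. real n powr (-3/2))" .
      have "(\<lambda>n. zeta_trunc rest (n - 1) * (1 / (real n * real (Suc n))))
          \<in> O(\<lambda>n. real n powr (1/4) * (1 / (real n * real (Suc n))))"
        by (intro landau_o.big.mult zeta_trunc_pred_bigo pos) auto
      also have "(\<lambda>n. real n powr (1/4) * (1 / (real n * real (Suc n))))
          \<in> O(\<lambda>n. real n powr (-3/2))"
        by real_asymp
      finally show "(\<lambda>n. zeta_trunc rest (n - 1) * (1 / (real n * real (Suc n))))
          \<in> O(\<lambda>n. real n powr (-3/2))" .
    qed
    moreover have "D (Suc n) - D n = (zeta_trunc rest n - zeta_trunc rest (n - 1)) * (1 / real (Suc n))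
             - zeta_trunc rest (n - 1) * (1 / (real n * real (Suc n)))" if "n > 0" for n
    proof -
      have "D (Suc n) - D n = zeta_trunc rest n / (real n + 1) - zeta_trunc rest (n - 1) / real n"
        by (simp add: D_def add.commute)
      also have "\<dots> = (zeta_trunc rest n - zeta_trunc rest (n - 1)) * (1 / (real n + 1))
             - zeta_trunc rest (n - 1) * (1 / (real n * (real n + 1)))"
        using that by (simp add: divide_simps) (simp add: algebra_simps)
      finally show ?thesis by (simp add: add.commute)
    qed
    ultimately have D2: "(\<lambda>n. D (Suc n) - D n) \<in> O(\<lambda>n. real n powr (-3/2))"
      by (subst landau_o.big.in_cong) (auto intro: eventually_mono[OF eventually_gt_at_top[of 0]])
    have "zeta_trunc idx = (\<lambda>M. \<Sum>n=1..M. (-1) ^ n * D n)"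
      using 2 by (simp add: fun_eq_iff idx D_def zsgn_def)
    then show ?thesis using fast_limit_alternating[OF D1 D2] by (simp only:)
  qed
qed

text \<open>After subtraction of \<open>L * harm M\<close> the increments are (X n - L) / (n + 1).
  Mere convergence of \<open>X\<close> would not make them summable. The power rate does, and the
  result inherits it, so that the step can be repeated.\<close>

lemma fast_limit_sum_div:
  assumes "fast_limit X L"
  shows "\<exists>K. fast_limit (\<lambda>M. (\<Sum>n=1..M. X (n - 1) / real n) - L * harm M) K"
proof (rule fast_limit_of_diff)
  have "(\<lambda>n. (X n - L) * (1 / real (Suc n))) \<in> O(\<lambda>n. real n powr (-1/2) * (1 / real (Suc n)))"
    using assms unfolding fast_limit_def by (intro landau_o.big.mult) auto
  also have "(\<lambda>n. real n powr (-1/2) * (1 / real (Suc n))) \<in> O(\<lambda>n. real n powr (-3/2))"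
    by real_asymp
  also have "(\<lambda>n. (X n - L) * (1 / real (Suc n)))
     = (\<lambda>n. ((\<Sum>n=1..Suc n. X (n - 1) / real n) - L * harm (Suc n))
            - ((\<Sum>n=1..n. X (n - 1) / real n) - L * harm n))"
    by (rule ext) (simp add: harm_Suc algebra_simps divide_inverse)
  finally show "(\<lambda>n. ((\<Sum>n=1..Suc n. X (n - 1) / real n) - L * harm (Suc n))
     - ((\<Sum>n=1..n. X (n - 1) / real n) - L * harm n)) \<in> O(\<lambda>n. real n powr (-3/2))" .
qed

lemma zeta_limit: "conv_index idx \<Longrightarrow> zeta_trunc idx \<longlonglongrightarrow> zeta idx"
proof -
  assume "conv_index idx"
  then obtain L where "fast_limit (zeta_trunc idx) L" using zeta_trunc_fast_limit by blast
  then have "zeta_trunc idx \<longlonglongrightarrow> L" by (rule fast_limit_imp_tendsto)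
  then show ?thesis unfolding zeta_def by (simp add: limI)
qed

lemma zeta_fast_limit: "conv_index idx \<Longrightarrow> fast_limit (zeta_trunc idx) (zeta idx)"
proof -
  assume *: "conv_index idx"
  then obtain L where L: "fast_limit (zeta_trunc idx) L" using zeta_trunc_fast_limit by blast
  from LIMSEQ_unique[OF fast_limit_imp_tendsto[OF this] zeta_limit[OF *]] L show ?thesis by simp
qed

section \<open>Expansions in the harmonic number and the values \<open>zeta_star\<close>\<close>

text \<open>Harmonic numbers stand in for log M + gamma because their sums against 1/n have exact
  closed forms. The change to the variable of \<open>zeta_star\<close> is made once, in
  \<open>zeta_star_eqI\<close>.\<close>

definition harm_expansion :: "(nat \<Rightarrow> real) \<Rightarrow> real poly \<Rightarrow> bool" where
  "harm_expansion A P \<longleftrightarrow> (\<lambda>M. A M - poly P (harm M)) \<longlonglongrightarrow> 0"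

lemma harm_expansion_add:
  "harm_expansion A P \<Longrightarrow> harm_expansion B Q \<Longrightarrow> harm_expansion (\<lambda>M. A M + B M) (P + Q)"
  unfolding harm_expansion_def by (drule (1) tendsto_add) (simp add: algebra_simps)

lemma harm_expansion_cmult:
  "harm_expansion A P \<Longrightarrow> harm_expansion (\<lambda>M. c * A M) (smult c P)"
  unfolding harm_expansion_def
  by (drule tendsto_mult_left[of _ _ _ c]) (simp add: algebra_simps)

lemma harm_expansion_diff:
  "harm_expansion A P \<Longrightarrow> harm_expansion B Q \<Longrightarrow> harm_expansion (\<lambda>M. A M - B M) (P - Q)"
  unfolding harm_expansion_def by (drule (1) tendsto_diff) (simp add: algebra_simps)

lemma harm_expansion_const_iff: "harm_expansion A [:c:] \<longleftrightarrow> A \<longlonglongrightarrow> c"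
  by (simp add: harm_expansion_def LIM_zero_iff)

lemma harm_expansion_0: "harm_expansion (\<lambda>_. 0) 0"
  by (simp add: harm_expansion_def)

text \<open>A nonconstant polynomial is unbounded along a variable tending to infinity. This gives
  uniqueness of expansions in the harmonic number, in log M + gamma and in \<open>- ln e\<close>
  alike.\<close>

lemma poly_tendsto_0_imp_0:
  fixes P :: "real poly"
  assumes x: "filterlim x at_top F" and P: "((\<lambda>n. poly P (x n)) \<longlongrightarrow> 0) F" and "F \<noteq> bot"
  shows "P = 0"
proof (cases "degree P > 0")
  case True
  have "filterlim (\<lambda>n. poly P (x n)) at_infinity F"
    using filterlim_compose[OF filterlim_poly_at_infinity[OF True]]
      filterlim_mono[OF x at_top_le_at_infinity order_refl] by blast
  then show ?thesis using P assms(3) not_tendsto_and_filterlim_at_infinity by blast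
next
  case False
  then obtain c where c: "P = [:c:]" using degree_eq_zeroE by blast
  then have "((\<lambda>_. c) \<longlongrightarrow> 0) F" using P by simp
  then show ?thesis using assms(3) tendsto_const_iff[of F c 0] c by simp
qed

lemma harm_expansion_unique:
  assumes "harm_expansion A P" "harm_expansion A Q"
  shows "P = Q"
proof -
  have "(\<lambda>M. poly (P - Q) (harm M)) \<longlonglongrightarrow> 0"
    using tendsto_diff[OF assms(2,1)[unfolded harm_expansion_def]] by simp
  then show ?thesis using poly_tendsto_0_imp_0[OF harm_at_top] by fastforce
qed

lemma poly_degree_le_2:
  fixes P :: "real poly"
  assumes "degree P \<le> 2"
  shows "P = [:coeff P 0, coeff P 1, coeff P 2:]"
proof (rule poly_eqI)
  fix n
  consider "n = 0" | "n = 1" | "n = 2" | m where "n = Suc (Suc (Suc m))"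
    by (metis One_nat_def numeral_2_eq_2 old.nat.exhaust)
  then show "coeff P n = coeff [:coeff P 0, coeff P 1, coeff P 2:] n"
    using assms by cases (simp_all add: numeral_2_eq_2 coeff_eq_0)
qed

text \<open>Replacing H = \<open>harm M\<close> by y = log M + gamma changes a quadratic term by a
  multiple of (H - y)(H + y). As H + y grows like a logarithm, H - y -> 0 alone is not enough; the
  needed rate comes from \<open>fast_limit_of_diff\<close>.\<close>

lemma zeta_star_eqI:
  assumes "harm_expansion (zeta_trunc idx) P" "degree P \<le> 2"
  shows "zeta_star idx = P"
proof -
  define y where "y = (\<lambda>M::nat. ln (real M) + euler_mascheroni :: real)"
  have y: "filterlim y at_top at_top" unfolding y_def by real_asymp
  have d: "(\<lambda>M. harm M - y M) \<longlonglongrightarrow> 0"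
    using euler_mascheroni_LIMSEQ unfolding y_def
    by (simp add: LIM_zero_iff flip: diff_diff_eq)
  have *: "(\<lambda>n. 1 / real (Suc n) - (ln (real (Suc n)) - ln (real n))) \<in> O(\<lambda>n. real n powr (-3/2))"
    by real_asymp
  then have "\<exists>L. fast_limit (\<lambda>n. harm n - ln (real n)) L"
  proof -
    have "harm (Suc n) - ln (real (Suc n)) - (harm n - ln (real n))
        = 1 / real (Suc n) - (ln (real (Suc n)) - ln (real n))" for n
      by (simp only: harm_Suc inverse_eq_divide)
    then show ?thesis using * by (intro fast_limit_of_diff) (simp only:)
  qed
  then obtain L where L: "fast_limit (\<lambda>n. harm n - ln (real n)) L" ..
  moreover have "L = euler_mascheroni"
    using LIMSEQ_unique[OF fast_limit_imp_tendsto[OF L] euler_mascheroni_LIMSEQ] .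
  ultimately have "(\<lambda>M. harm M - y M) \<in> O(\<lambda>n. real n powr (-1/2))"
    by (simp add: fast_limit_def y_def algebra_simps)
  moreover have "(\<lambda>M. harm M + y M) \<in> O(\<lambda>n. real n powr (1/4))"
  proof (rule sum_in_bigo)
    show "harm \<in> O(\<lambda>n. real n powr (1/4))" using harm_power_bigo[of "1/4" 1] by simp
    show "y \<in> O(\<lambda>n. real n powr (1/4))" unfolding y_def by real_asymp
  qed
  ultimately have "(\<lambda>M. (harm M - y M) * (harm M + y M))
      \<in> O(\<lambda>n. real n powr (-1/2) * real n powr (1/4))"
    by (rule landau_o.big.mult)
  also have "(\<lambda>n. real n powr (-1/2) * real n powr (1/4)) \<in> o(\<lambda>_. 1)" by real_asymp
  finally have d2: "(\<lambda>M. (harm M - y M) * (harm M + y M)) \<longlonglongrightarrow> 0"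
    by (auto dest: smalloD_tendsto)
  obtain a b c where P: "P = [:a, b, c:]"
    using poly_degree_le_2[OF assms(2)] by blast
  have "(\<lambda>M. b * (harm M - y M) + c * ((harm M - y M) * (harm M + y M))) \<longlonglongrightarrow> 0"
    using tendsto_add[OF tendsto_mult_left[OF d, of b] tendsto_mult_left[OF d2, of c]] by simp
  moreover have "poly P (harm M) - poly P (y M)
      = b * (harm M - y M) + c * ((harm M - y M) * (harm M + y M))" for M
    by (simp add: P algebra_simps)
  ultimately have "(\<lambda>M. poly P (harm M) - poly P (y M)) \<longlonglongrightarrow> 0" by simp
  from tendsto_add[OF assms(1)[unfolded harm_expansion_def] this]
  have P: "(\<lambda>M. zeta_trunc idx M - poly P (y M)) \<longlonglongrightarrow> 0" by simp
  show ?thesis unfolding zeta_star_def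
  proof (rule the_equality)
    show "(\<lambda>M. zeta_trunc idx M - poly P (ln (real M) + euler_mascheroni)) \<longlonglongrightarrow> 0"
      using P by (simp add: y_def)
    fix Q assume Q: "(\<lambda>M. zeta_trunc idx M - poly Q (ln (real M) + euler_mascheroni)) \<longlonglongrightarrow> 0"
    have "(\<lambda>M. poly (Q - P) (y M)) \<longlonglongrightarrow> 0"
      using tendsto_diff[OF P Q[folded y_def]] by (simp add: y_def)
    then show "Q = P" using poly_tendsto_0_imp_0[OF y] by fastforce
  qed
qed

text \<open>Squaring the harmonic number counts each pair of distinct indices twice and the diagonal
  once.\<close>

lemma sum_harm_pred:
  "(\<Sum>n=1..M. harm (n - 1) / real n) = (harm M ^ 2 - (\<Sum>n=1..M. 1 / real n ^ 2)) / (2 :: real)"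
proof (induction M)
  case (Suc M)
  have "harm (Suc M) ^ 2 = harm M ^ 2 + 2 * (harm M / real (Suc M)) + 1 / real (Suc M) ^ 2"
    by (simp only: harm_Suc power2_eq_square) (simp add: divide_simps, simp add: algebra_simps)
  moreover have "(\<Sum>n=1..Suc M. 1 / real n ^ 2) = (\<Sum>n=1..M. 1 / real n ^ 2) + 1 / real (Suc M) ^ 2"
    "(\<Sum>n=1..Suc M. harm (n - 1) / real n) = (\<Sum>n=1..M. harm (n - 1) / real n) + harm M / real (Suc M)"
    by simp_all
  moreover have "T = (A - S) / 2"
    if "A = a + 2 * d + e" "S = s + e" "T = t + d" "t = (a - s) / 2" for A S T a d e s t :: real
    using that by simp
  ultimately show ?case using Suc by blast
qed (simp add: harm_expand)

lemma zeta_trunc_nb1: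
  "zeta_trunc (nb 1 # idx) M = (\<Sum>n=1..M. zeta_trunc idx (n - 1) / real n)"
  by (simp add: zsgn_def)

lemma zeta_two_limit: "(\<lambda>M. \<Sum>n=1..M. 1 / real n ^ 2) \<longlonglongrightarrow> zeta [nb 2]"
proof -
  have "zeta_trunc [nb 2] = (\<lambda>M. \<Sum>n=1..M. 1 / real n ^ 2)" by (simp add: fun_eq_iff zsgn_def)
  then show ?thesis using zeta_limit[of "[nb 2]"] by simp
qed

lemma harm_expansion_conv: "conv_index idx \<Longrightarrow> harm_expansion (zeta_trunc idx) [:zeta idx:]"
  by (simp add: harm_expansion_const_iff zeta_limit)

text \<open>The value of the remaining index becomes the coefficient of T. The first conclusion
  keeps the rate, which a second leading 1 consumes.\<close>

lemma harm_expansion_nb1: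
  assumes "conv_index idx"
  shows "\<exists>c. fast_limit (\<lambda>M. zeta_trunc (nb 1 # idx) M - zeta idx * harm M) c
    \<and> harm_expansion (zeta_trunc (nb 1 # idx)) [:c, zeta idx:]"
proof -
  obtain c where c: "fast_limit (\<lambda>M. zeta_trunc (nb 1 # idx) M - zeta idx * harm M) c"
    using fast_limit_sum_div[OF zeta_fast_limit[OF assms]] unfolding zeta_trunc_nb1 by blast
  have "(\<lambda>M. (zeta_trunc (nb 1 # idx) M - zeta idx * harm M) - c) \<longlonglongrightarrow> 0"
    using fast_limit_imp_tendsto[OF c] by (simp add: LIM_zero_iff)
  then show ?thesis using c
    by (intro exI[of _ c]) (simp add: harm_expansion_def algebra_simps)
qed

lemma harm_expansion_nb1_nb1:
  assumes "conv_index idx"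
  shows "\<exists>c c'. harm_expansion (zeta_trunc (nb 1 # nb 1 # idx)) [:c, c', zeta idx / 2:]"
proof -
  define L where "L = zeta idx"
  obtain c' where "fast_limit (\<lambda>M. zeta_trunc (nb 1 # idx) M - L * harm M) c'"
    using harm_expansion_nb1[OF assms] unfolding L_def by blast
  from fast_limit_sum_div[OF this]
  obtain d where d: "fast_limit (\<lambda>M. (\<Sum>n=1..M. (zeta_trunc (nb 1 # idx) (n - 1) - L * harm (n - 1)) / real n)
      - c' * harm M) d"
    by blast
  \<comment> \<open>Summing L H_(n-1) / n produces L H_M^2 / 2 up to a convergent sum; this is the
    origin of the leading coefficient L / 2.\<close>
  have eq: "(\<Sum>n=1..M. (zeta_trunc (nb 1 # idx) (n - 1) - L * harm (n - 1)) / real n)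
      = zeta_trunc (nb 1 # nb 1 # idx) M - L * (harm M ^ 2 - (\<Sum>n=1..M. 1 / real n ^ 2)) / 2" for M
    unfolding zeta_trunc_nb1[of "nb 1 # idx"] diff_divide_distrib sum_subtractf
    using sum_harm_pred[of M]
    by (simp add: sum_distrib_left[symmetric] times_divide_eq_right[symmetric] del: times_divide_eq_right)
  have "(\<lambda>M. zeta_trunc (nb 1 # nb 1 # idx) M - L * (harm M ^ 2 - (\<Sum>n=1..M. 1 / real n ^ 2)) / 2
      - c' * harm M - L * (\<Sum>n=1..M. 1 / real n ^ 2) / 2) \<longlonglongrightarrow> d - L * zeta [nb 2] / 2"
    using fast_limit_imp_tendsto[OF d] unfolding eq by (intro tendsto_intros zeta_two_limit) auto
  then have "(\<lambda>M. zeta_trunc (nb 1 # nb 1 # idx) M - poly [:d - L * zeta [nb 2] / 2, c', L / 2:] (harm M))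
      \<longlonglongrightarrow> 0"
    by (subst (asm) LIM_zero_iff[symmetric]) (simp add: algebra_simps power2_eq_square add_divide_distrib diff_divide_distrib)
  then show ?thesis unfolding harm_expansion_def L_def by blast
qed

lemma zeta_star_conv: "conv_index idx \<Longrightarrow> zeta_star idx = [:zeta idx:]"
  using harm_expansion_conv by (intro zeta_star_eqI) auto

lemma zeta_star_nb1:
  assumes "conv_index idx"
  shows "harm_expansion (zeta_trunc (nb 1 # idx)) (zeta_star (nb 1 # idx))"
    "coeff (zeta_star (nb 1 # idx)) 2 = 0" "degree (zeta_star (nb 1 # idx)) \<le> 2"
proof -
  obtain c where c: "harm_expansion (zeta_trunc (nb 1 # idx)) [:c, zeta idx:]"
    using harm_expansion_nb1[OF assms] by blast
  then have "zeta_star (nb 1 # idx) = [:c, zeta idx:]" by (intro zeta_star_eqI) auto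
  then show "harm_expansion (zeta_trunc (nb 1 # idx)) (zeta_star (nb 1 # idx))"
    "coeff (zeta_star (nb 1 # idx)) 2 = 0" "degree (zeta_star (nb 1 # idx)) \<le> 2"
    using c by (auto simp: numeral_2_eq_2)
qed

lemma zeta_star_nb1_nb1:
  assumes "conv_index idx"
  shows "harm_expansion (zeta_trunc (nb 1 # nb 1 # idx)) (zeta_star (nb 1 # nb 1 # idx))"
    "coeff (zeta_star (nb 1 # nb 1 # idx)) 2 = zeta idx / 2"
    "degree (zeta_star (nb 1 # nb 1 # idx)) \<le> 2"
proof -
  obtain c c' where c: "harm_expansion (zeta_trunc (nb 1 # nb 1 # idx)) [:c, c', zeta idx / 2:]"
    using harm_expansion_nb1_nb1[OF assms] by blast
  then have "zeta_star (nb 1 # nb 1 # idx) = [:c, c', zeta idx / 2:]" by (intro zeta_star_eqI) auto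
  then show "harm_expansion (zeta_trunc (nb 1 # nb 1 # idx)) (zeta_star (nb 1 # nb 1 # idx))"
    "coeff (zeta_star (nb 1 # nb 1 # idx)) 2 = zeta idx / 2"
    "degree (zeta_star (nb 1 # nb 1 # idx)) \<le> 2"
    using c by (auto simp: numeral_2_eq_2)
qed

text \<open>At most two leading unbarred ones before a convergent index: this keeps the degree at 2
  and covers depth three in weight at least 4.\<close>

fun reg_index :: "eindex \<Rightarrow> bool" where
  "reg_index (p # q # idx) \<longleftrightarrow> conv_index (p # q # idx)
     \<or> p = nb 1 \<and> (conv_index (q # idx) \<or> q = nb 1 \<and> conv_index idx)"
| "reg_index idx \<longleftrightarrow> conv_index idx"

lemma zeta_star_reg:
  assumes "reg_index idx"
  shows "harm_expansion (zeta_trunc idx) (zeta_star idx)" "degree (zeta_star idx) \<le> 2"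
proof -
  consider "conv_index idx" | r where "idx = nb 1 # r" "conv_index r"
    | r where "idx = nb 1 # nb 1 # r" "conv_index r"
    using assms by (cases idx rule: reg_index.cases) (auto simp del: conv_index.simps)
  then have "harm_expansion (zeta_trunc idx) (zeta_star idx) \<and> degree (zeta_star idx) \<le> 2"
  proof cases
    case 1
    then show ?thesis using harm_expansion_conv zeta_star_conv by simp
  next
    case 2
    then show ?thesis using zeta_star_nb1 by blast
  next
    case 3
    then show ?thesis using zeta_star_nb1_nb1 by blast
  qed
  then show "harm_expansion (zeta_trunc idx) (zeta_star idx)" "degree (zeta_star idx) \<le> 2" by auto
qed

text \<open>The alternating sum is twice the even terms minus all terms, and the even terms of the
  sum of 1/n^2 carry a quarter of it.\<close>

lemma zeta_bar_two: "zeta [br 2] = - zeta [nb 2] / 2"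
proof -
  have "(\<Sum>n=1..2*M. (-1) ^ n / real n ^ 2)
      = (\<Sum>n=1..M. 1 / real n ^ 2) / 2 - (\<Sum>n=1..2*M. 1 / real n ^ 2)" for M
  proof (induction M)
    case (Suc M)
    have "1 / (2 + 2 * real M) ^ 2 = 1 / (1 + real M) ^ 2 / 4"
      using power_mult_distrib[of 2 "1 + real M" 2] by (simp add: algebra_simps)
    then show ?case using Suc by simp
  qed simp
  moreover have sub: "strict_mono (\<lambda>M::nat. 2 * M)" by (auto simp: strict_mono_def)
  have "(\<lambda>M. (\<Sum>n=1..M. 1 / real n ^ 2) / 2 - (\<Sum>n=1..2*M. 1 / real n ^ 2))
      \<longlonglongrightarrow> zeta [nb 2] / 2 - zeta [nb 2]"
    using LIMSEQ_subseq_LIMSEQ[OF zeta_two_limit sub]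
    by (intro tendsto_intros zeta_two_limit) (auto simp: o_def)
  ultimately have "(\<lambda>M. \<Sum>n=1..2*M. (-1) ^ n / real n ^ 2) \<longlonglongrightarrow> zeta [nb 2] / 2 - zeta [nb 2]"
    by simp
  moreover have "(\<lambda>M. \<Sum>n=1..2*M. (-1) ^ n / real n ^ 2) \<longlonglongrightarrow> zeta [br 2]"
    using LIMSEQ_subseq_LIMSEQ[OF zeta_limit[of "[br 2]"] sub] by (simp add: o_def zsgn_def)
  ultimately show ?thesis using LIMSEQ_unique by fastforce
qed

section \<open>Iterated integrals\<close>

text \<open>Linear growth of the coefficients is the invariant: it forces convergence on the unit
  interval and is stable under the integrations below, each of which divides the n-th coefficient by
  n.\<close>

definition powser_on_unit :: "(real \<Rightarrow> real) \<Rightarrow> (nat \<Rightarrow> real) \<Rightarrow> bool" where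
  "powser_on_unit f a \<longleftrightarrow> a \<in> O(real) \<and> (\<forall>t. 0 \<le> t \<and> t < 1 \<longrightarrow> f t = (\<Sum>n. a n * t ^ n))"

lemma powser_on_unitD:
  assumes "powser_on_unit f a"
  shows "a \<in> O(real)" "0 \<le> t \<Longrightarrow> t < 1 \<Longrightarrow> f t = (\<Sum>n. a n * t ^ n)"
  using assms unfolding powser_on_unit_def by blast+

lemma summable_linear_powser:
  assumes "a \<in> O(real)" "norm t < 1"
  shows "summable (\<lambda>n. norm (a n * t ^ n :: real))"
proof -
  have "summable (\<lambda>n. diffs (\<lambda>_. 1) n * \<bar>t\<bar> ^ n)"
    using assms(2) by (intro termdiff_converges[of _ 1]) (auto intro!: summable_geometric)
  then have s: "summable (\<lambda>n. norm (real (Suc n) * \<bar>t\<bar> ^ n))" by (simp add: diffs_def abs_mult)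
  have "real \<in> O(\<lambda>n. real (Suc n))" by real_asymp
  from landau_o.big_trans[OF assms(1) this]
  have O1: "(\<lambda>n. a n * \<bar>t\<bar> ^ n) \<in> O(\<lambda>n. real (Suc n) * \<bar>t\<bar> ^ n)"
    by (rule landau_o.big.mult) (rule landau_o.big_refl)
  have "(\<lambda>n. norm (a n * t ^ n)) \<in> O(\<lambda>n. a n * \<bar>t\<bar> ^ n)"
    by (intro bigoI[of _ 1] always_eventually) (simp add: abs_mult power_abs)
  from summable_comparison_test_bigo[OF s landau_o.big_trans[OF this O1]] show ?thesis .
qed

text \<open>Termwise integration by way of the fundamental theorem: the series on the right has the
  integrand as its derivative inside the unit disc.\<close>

lemma LBINT_powser:
  assumes a: "a \<in> O(real)" and x: "0 \<le> x" "x < 1"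
    and g: "\<And>t. 0 < t \<Longrightarrow> t < x \<Longrightarrow> g t = (\<Sum>n. a n * t ^ n)"
  shows "(LBINT t:{0<..<x}. g t) = (\<Sum>n. a (n - 1) / real n * x ^ n)"
proof -
  \<comment> \<open>At \<open>n = 0\<close> natural subtraction and division by zero give the
    coefficient 0, the correct constant of integration.\<close>
  define b where "b = (\<lambda>n. a (n - 1) / real n)"
  have b: "b \<in> O(real)"
  proof -
    have "filterlim (\<lambda>n::nat. n - 1) at_top at_top" by (rule filterlim_minus_const_nat_at_top)
    from landau_o.big.compose[OF a this] have "(\<lambda>n. a (n - 1)) \<in> O(\<lambda>n. real (n - 1))" .
    also have "(\<lambda>n. real (n - 1)) \<in> O(real)"
      by (intro bigoI[of _ 1]) (auto intro: always_eventually)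
    finally have "(\<lambda>n. a (n - 1) * inverse (real n)) \<in> O(\<lambda>n. real n * inverse (real n))"
      by (intro landau_o.big.mult) auto
    also have "(\<lambda>n. real n * inverse (real n)) \<in> O(real)" by real_asymp
    finally show ?thesis by (simp add: b_def divide_inverse)
  qed
  define f F where "f = (\<lambda>t. \<Sum>n. a n * t ^ n)" and "F = (\<lambda>t. \<Sum>n. b n * t ^ n)"
  have "diffs b n = a n" for n by (simp add: diffs_def b_def)
  then have db: "diffs b = a" by blast
  have F: "(F has_field_derivative f t) (at t)" if "norm t < 1" for t
    using termdiffs_strong'[of 1 b t, unfolded db] summable_norm_cancel[OF summable_linear_powser[OF b]] that
    unfolding F_def f_def by blast
  have f: "isCont f t" if t: "norm t < 1" for t
  proof -
    define K where "K = (norm t + 1) / 2"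
    have "norm K < 1" "norm t < norm K" using t by (auto simp: K_def)
    then show ?thesis unfolding f_def
      using isCont_powser summable_norm_cancel[OF summable_linear_powser[OF a]] by blast
  qed
  have "(LBINT t:{0<..<x}. g t) = (LBINT t:{0<..<x}. f t)"
    by (intro set_lebesgue_integral_cong) (auto simp: g f_def)
  also have "\<dots> = (LBINT t=0..x. f t)"
    using x by (simp add: interval_lebesgue_integral_def zero_ereal_def)
  also have "\<dots> = F x - F 0"
    unfolding zero_ereal_def
  proof (rule interval_integral_FTC_finite)
    show "continuous_on {min 0 x..max 0 x} f"
      using x f by (intro continuous_at_imp_continuous_on) auto
    show "(F has_vector_derivative f t) (at t within {min 0 x..max 0 x})"
      if "min 0 x \<le> t" "t \<le> max 0 x" for t
      using that x F[of t]
      by (auto simp flip: has_real_derivative_iff_has_vector_derivative intro: DERIV_subset)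
  qed
  also have "F 0 = 0" unfolding F_def powser_zero by (simp add: b_def)
  finally show ?thesis by (simp add: F_def b_def)
qed

text \<open>The vanishing constant term cancels the pole of dt/t. Lowering the index and integrating
  then combine to a division of the n-th coefficient by n.\<close>

lemma powser_None:
  assumes "powser_on_unit (iter_int ls) a" "a 0 = 0"
  shows "powser_on_unit (iter_int (None # ls)) (\<lambda>n. a n / real n)"
proof -
  have a: "a \<in> O(real)" using powser_on_unitD(1)[OF assms(1)] .
  have "filterlim Suc at_top at_top" by (rule filterlim_Suc)
  from landau_o.big.compose[OF a this] have "(\<lambda>n. a (Suc n)) \<in> O(\<lambda>n. real (Suc n))" .
  also have "(\<lambda>n. real (Suc n)) \<in> O(real)" by real_asymp
  finally have a': "(\<lambda>n. a (Suc n)) \<in> O(real)" .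
  have eq: "a (Suc (n - 1)) / real n = a n / real n" for n by (cases n) auto
  have "iter_int (None # ls) x = (\<Sum>n. a n / real n * x ^ n)" if x: "0 \<le> x" "x < 1" for x
    unfolding iter_int.simps
  proof (subst LBINT_powser[OF a' x])
    fix t assume t: "0 < t" "t < x"
    have s: "summable (\<lambda>n. a n * t ^ n)"
      using summable_norm_cancel[OF summable_linear_powser[OF a]] t x by simp
    have "iter_int ls t = (\<Sum>n. a n * t ^ n)"
      using powser_on_unitD(2)[OF assms(1)] t x by simp
    also have "\<dots> = (\<Sum>n. a (Suc n) * t ^ Suc n)"
      using suminf_split_head[OF s] assms(2) by simp
    also have "\<dots> = t * (\<Sum>n. a (Suc n) * t ^ n)"
      using summable_norm_cancel[OF summable_linear_powser[OF a', of t]] t x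
      by (subst suminf_mult[symmetric]) (auto simp: mult_ac)
    finally show "form None t * iter_int ls t = (\<Sum>n. a (Suc n) * t ^ n)"
      using t by simp
  qed (simp only: eq)
  moreover have "(\<lambda>n. a n / real n) \<in> O(real)"
  proof -
    have "(\<lambda>n. a n * inverse (real n)) \<in> O(\<lambda>n. real n * inverse (real n))"
      using a by (intro landau_o.big.mult) auto
    also have "(\<lambda>n. real n * inverse (real n)) \<in> O(real)" by real_asymp
    finally show ?thesis by (simp add: divide_inverse)
  qed
  ultimately show ?thesis unfolding powser_on_unit_def by blast
qed

text \<open>Since \<open>c\<close> is its own inverse, 1 / (c - t) has the coefficients c^(n+1).
  Relative to the powers c^n, the Cauchy product with it merely forms partial sums of
  \<open>e\<close>.\<close>

lemma powser_Some:
  fixes c :: real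
  assumes "powser_on_unit (iter_int ls) (\<lambda>n. c ^ n * e n)" and c: "c = 1 \<or> c = -1"
    and E: "(\<lambda>n. \<Sum>i\<le>n. e i) \<in> O(real)"
  shows "powser_on_unit (iter_int (Some c # ls)) (\<lambda>n. c ^ n * (\<Sum>i\<le>n - 1. e i) / real n)"
proof -
  define a where "a = (\<lambda>n. c ^ Suc n * (\<Sum>i\<le>n. e i))"
  have cabs: "\<bar>c ^ n\<bar> = 1" for n using c by (auto simp: power_abs)
  have norm_a: "norm (a n) = norm (\<Sum>i\<le>n. e i)" for n
    unfolding a_def real_norm_def abs_mult cabs by simp
  have a: "a \<in> O(real)"
  proof -
    have "a \<in> O(\<lambda>n. \<Sum>i\<le>n. e i)" by (intro bigoI[of _ 1] always_eventually) (simp only: norm_a, simp)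
    then show ?thesis using E landau_o.big_trans by blast
  qed
  have ls: "(\<lambda>n. c ^ n * e n) \<in> O(real)" using powser_on_unitD(1)[OF assms(1)] .
  have eq: "a (n - 1) / real n = c ^ n * (\<Sum>i\<le>n - 1. e i) / real n" for n
    by (cases n) (auto simp: a_def)
  have 1: "iter_int (Some c # ls) x = (\<Sum>n. c ^ n * (\<Sum>i\<le>n - 1. e i) / real n * x ^ n)"
    if x: "0 \<le> x" "x < 1" for x
    unfolding iter_int.simps
  proof (subst LBINT_powser[OF a x])
    fix t assume t: "0 < t" "t < x"
    have ct: "norm (c * t) < 1" using c t x by auto
    have c2: "c * c = 1" using c by auto
    have cp: "c ^ i * c ^ Suc (n - i) = c ^ Suc n" if "i \<le> n" for i n
      using that by (simp flip: power_add)
    have "form (Some c) t = (\<Sum>n. c ^ Suc n * t ^ n)"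
    proof -
      have "(\<Sum>n. c ^ Suc n * t ^ n) = c * (\<Sum>n. (c * t) ^ n)"
        by (subst suminf_mult[symmetric]) (use ct in \<open>auto simp: power_mult_distrib mult_ac intro!: summable_geometric\<close>)
      also have "\<dots> = c * (1 / (1 - c * t))" using suminf_geometric[OF ct] by simp
      also have "\<dots> = 1 / (c - t)" using c t x by (auto simp: field_simps)
      finally show ?thesis by simp
    qed
    moreover have "iter_int ls t = (\<Sum>n. c ^ n * e n * t ^ n)"
      using powser_on_unitD(2)[OF assms(1)] t x by simp
    moreover have "(\<Sum>n. c ^ n * e n * t ^ n) * (\<Sum>n. c ^ Suc n * t ^ n)
        = (\<Sum>n. \<Sum>i\<le>n. (c ^ i * e i * t ^ i) * (c ^ Suc (n - i) * t ^ (n - i)))"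
    proof (rule Cauchy_product)
      show "summable (\<lambda>n. norm (c ^ n * e n * t ^ n))"
        using summable_linear_powser[OF ls] t x by simp
      have "norm (c ^ Suc n * t ^ n) = t ^ n" for n
        using t unfolding real_norm_def abs_mult cabs by simp
      then show "summable (\<lambda>n. norm (c ^ Suc n * t ^ n))"
        using t x by (simp only:) (auto intro!: summable_geometric)
    qed
    moreover have "(\<Sum>i\<le>n. (c ^ i * e i * t ^ i) * (c ^ Suc (n - i) * t ^ (n - i))) = a n * t ^ n" for n
    proof -
      have "(c ^ i * e i * t ^ i) * (c ^ Suc (n - i) * t ^ (n - i)) = c ^ Suc n * t ^ n * e i" if "i \<le> n" for i
      proof -
        have "(c ^ i * e i * t ^ i) * (c ^ Suc (n - i) * t ^ (n - i))
            = (c ^ i * c ^ Suc (n - i)) * (t ^ i * t ^ (n - i)) * e i" by (simp only: mult_ac)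
        also have "\<dots> = c ^ Suc n * t ^ n * e i"
          using that by (simp only: cp flip: power_add) simp
        finally show ?thesis .
      qed
      then have "(\<Sum>i\<le>n. (c ^ i * e i * t ^ i) * (c ^ Suc (n - i) * t ^ (n - i)))
          = (\<Sum>i\<le>n. c ^ Suc n * t ^ n * e i)"
        by (intro sum.cong) auto
      also have "\<dots> = c ^ Suc n * t ^ n * (\<Sum>i\<le>n. e i)" by (simp only: sum_distrib_left)
      also have "\<dots> = a n * t ^ n" by (simp add: a_def)
      finally show ?thesis .
    qed
    ultimately show "form (Some c) t * iter_int ls t = (\<Sum>n. a n * t ^ n)"
      by (simp add: mult.commute)
  qed (simp only: eq)
  have "(\<lambda>n. c ^ n * (\<Sum>i\<le>n - 1. e i) / real n) \<in> O(real)"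
  proof -
    have "filterlim (\<lambda>n::nat. n - 1) at_top at_top" by (rule filterlim_minus_const_nat_at_top)
    from landau_o.big.compose[OF a this] have "(\<lambda>n. a (n - 1)) \<in> O(\<lambda>n. real (n - 1))" .
    also have "(\<lambda>n. real (n - 1)) \<in> O(real)"
      by (intro bigoI[of _ 1]) (auto intro: always_eventually)
    finally have "(\<lambda>n. a (n - 1) * inverse (real n)) \<in> O(\<lambda>n. real n * inverse (real n))"
      by (intro landau_o.big.mult) auto
    also have "(\<lambda>n. real n * inverse (real n)) \<in> O(real)" by real_asymp
    finally show ?thesis unfolding divide_inverse[symmetric] eq .
  qed
  with 1 show ?thesis unfolding powser_on_unit_def by blast
qed

text \<open>The Taylor coefficients of the multiple polylogarithm whose value at 1 is the Euler
  sum.\<close>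

fun zeta_coeff :: "eindex \<Rightarrow> nat \<Rightarrow> real" where
  "zeta_coeff [] n = (if n = 0 then 1 else 0)"
| "zeta_coeff ((s, b) # rest) n = zsgn b ^ n / real n ^ s * zeta_trunc rest (n - 1)"

lemma sum_zeta_coeff: "pos_index idx \<Longrightarrow> (\<Sum>i\<le>n. zeta_coeff idx i) = zeta_trunc idx n"
proof (induction idx n rule: zeta_coeff.induct)
  case (2 s b rest n)
  then have "zeta_coeff ((s, b) # rest) 0 = 0" by simp
  then have "(\<Sum>i\<le>n. zeta_coeff ((s, b) # rest) i) = (\<Sum>i=1..n. zeta_coeff ((s, b) # rest) i)"
    by (simp only: atMost_atLeast0 sum.atLeast_Suc_atMost[of 0 n] One_nat_def)
  then show ?case by simp
qed simp

lemma zeta_trunc_bigo_real: "pos_index idx \<Longrightarrow> zeta_trunc idx \<in> O(real)"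
proof -
  assume "pos_index idx"
  then have "zeta_trunc idx \<in> O(\<lambda>n. real n powr (1/2))" by (intro zeta_trunc_bigo) auto
  also have "(\<lambda>n. real n powr (1/2)) \<in> O(real)" by real_asymp
  finally show ?thesis .
qed

text \<open>The forms carry cumulative products of signs, Euler sums the individual signs. With
  \<open>c\<close> the product of the signs already read, the factor c^n makes up the difference:
  the next form has its pole at d = c z, and d^n = c^n z^n.\<close>

lemma powser_word_aux:
  "pos_index idx \<Longrightarrow> c = 1 \<or> c = -1 \<Longrightarrow>
    powser_on_unit (iter_int (word_aux c idx)) (\<lambda>n. c ^ n * zeta_coeff idx n)"
proof (induction idx arbitrary: c)
  case Nil
  have "(\<Sum>n. c ^ n * (if n = 0 then 1 else 0) * t ^ n) = 1" for t :: real
    by (subst suminf_finite[of "{0}"]) auto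
  moreover have "(\<lambda>n. c ^ n * zeta_coeff [] n) \<in> O(real)"
    by (intro bigoI[of _ 1] eventually_mono[OF eventually_gt_at_top[of 0]]) auto
  ultimately show ?case unfolding powser_on_unit_def by (auto simp only: word_aux.simps iter_int.simps zeta_coeff.simps)
next
  case (Cons p rest)
  obtain s b where p: "p = (s, b)" by force
  define d where "d = c * zsgn b"
  have d: "d = 1 \<or> d = -1" using Cons.prems by (auto simp: d_def zsgn_def)
  have pos: "pos_index rest" "s \<ge> 1" using Cons.prems by (auto simp: p)
  have 1: "powser_on_unit (iter_int (Some d # word_aux d rest))
      (\<lambda>n. d ^ n * (\<Sum>i\<le>n - 1. zeta_coeff rest i) / real n)"
    using Cons.IH[OF pos(1) d] d
  proof (rule powser_Some)
    show "(\<lambda>n. \<Sum>i\<le>n. zeta_coeff rest i) \<in> O(real)"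
      using zeta_trunc_bigo_real[OF pos(1)] by (simp only: sum_zeta_coeff[OF pos(1)])
  qed
  have "powser_on_unit (iter_int (replicate k None @ Some d # word_aux d rest))
      (\<lambda>n. d ^ n * zeta_trunc rest (n - 1) / real n ^ Suc k)" for k
  proof (induction k)
    case 0
    then show ?case using 1 by (simp add: sum_zeta_coeff[OF pos(1)] del: iter_int.simps)
  next
    case (Suc k)
    have "(\<lambda>n. d ^ n * zeta_trunc rest (n - 1) / real n ^ Suc k / real n)
        = (\<lambda>n. d ^ n * zeta_trunc rest (n - 1) / real n ^ Suc (Suc k))"
      by (simp add: mult_ac)
    with powser_None[OF Suc] show ?case by (simp del: iter_int.simps power_Suc)
  qed
  from this[of "s - 1"] have "powser_on_unit (iter_int (word_aux c (p # rest)))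
      (\<lambda>n. d ^ n * zeta_trunc rest (n - 1) / real n ^ s)"
    using pos(2) by (simp add: p flip: d_def del: iter_int.simps)
  moreover have "(\<lambda>n. d ^ n * zeta_trunc rest (n - 1) / real n ^ s) = (\<lambda>n. c ^ n * zeta_coeff (p # rest) n)"
    by (simp add: fun_eq_iff p d_def power_mult_distrib)
  ultimately show ?case by (simp only:)
qed


section \<open>Abel's theorem and the comparison of the two regularizations\<close>

text \<open>Summation by parts: with \<open>R\<close> the error of the partial sums, the series is c
  + (1 - t) times the series of \<open>R\<close>. Its first \<open>N\<close> terms contribute at
  most N B (1 - t), the others at most e/2.\<close>

lemma abel_limit:
  fixes d :: "nat \<Rightarrow> real"
  assumes lim: "(\<lambda>n. \<Sum>k\<le>n. d k) \<longlonglongrightarrow> c"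
  shows "((\<lambda>t. \<Sum>n. d n * t ^ n) \<longlongrightarrow> c) (at_left 1)"
proof -
  define R where "R = (\<lambda>n. (\<Sum>k\<le>n. d k) - c)"
  have R0: "R \<longlonglongrightarrow> 0" using lim by (simp add: R_def LIM_zero_iff)
  obtain B where B: "\<And>n. \<bar>R n\<bar> \<le> B"
    using convergent_imp_bounded[OF R0] by (auto simp: bounded_iff)
  have B0: "B \<ge> 0" using B[of 0] by linarith
  have sR: "summable (\<lambda>n. \<bar>R n * t ^ n\<bar>)" if t: "0 \<le> t" "t < 1" for t
  proof (rule summable_comparison_test[of _ "\<lambda>n. B * t ^ n"])
    have "norm \<bar>R n * t ^ n\<bar> \<le> B * t ^ n" for n
      using mult_right_mono[OF B[of n], of "t ^ n"] t by (simp add: abs_mult)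
    then show "\<exists>N. \<forall>n\<ge>N. norm \<bar>R n * t ^ n\<bar> \<le> B * t ^ n" by blast
    show "summable (\<lambda>n. B * t ^ n)"
      by (rule summable_mult, rule summable_geometric) (use t in auto)
  qed
  have eq: "(\<Sum>n. d n * t ^ n) = c + (1 - t) * (\<Sum>n. R n * t ^ n)" if t: "0 \<le> t" "t < 1" for t
  proof -
    have s: "(\<lambda>n. R n * t ^ n) sums (\<Sum>n. R n * t ^ n)"
      by (rule summable_sums[OF summable_rabs_cancel[OF sR[OF t]]])
    have "(\<lambda>n. t * (R n * t ^ n)) sums (t * (\<Sum>n. R n * t ^ n))"
      by (intro sums_mult s)
    then have "(\<lambda>n. case n of 0 \<Rightarrow> 0 | Suc m \<Rightarrow> t * (R m * t ^ m)) sums (t * (\<Sum>n. R n * t ^ n))"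
      using sums_Suc[of "\<lambda>n. case n of 0 \<Rightarrow> 0 | Suc m \<Rightarrow> t * (R m * t ^ m)"] by simp
    from sums_diff[OF s this]
    have 1: "(\<lambda>n. R n * t ^ n - (case n of 0 \<Rightarrow> 0 | Suc m \<Rightarrow> t * (R m * t ^ m)))
      sums ((1 - t) * (\<Sum>n. R n * t ^ n))" by (simp add: algebra_simps)
    have "(\<lambda>n. if n = 0 then c else 0) sums c" using sums_single[of 0 "\<lambda>_. c"] by simp
    from sums_add[OF this 1]
    have "(\<lambda>n. (if n = 0 then c else 0) + (R n * t ^ n - (case n of 0 \<Rightarrow> 0 | Suc m \<Rightarrow> t * (R m * t ^ m))))
      sums (c + (1 - t) * (\<Sum>n. R n * t ^ n))" .
    moreover have "(if n = 0 then c else 0) + (R n * t ^ n - (case n of 0 \<Rightarrow> 0 | Suc m \<Rightarrow> t * (R m * t ^ m)))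
       = d n * t ^ n" for n
      by (cases n) (auto simp: R_def algebra_simps)
    ultimately show ?thesis by (simp add: sums_iff)
  qed
  have "((\<lambda>t. (1 - t) * (\<Sum>n. R n * t ^ n)) \<longlongrightarrow> 0) (at_left 1)"
  proof (rule tendstoI)
    fix e :: real assume e: "e > 0"
    then obtain N where N: "\<And>n. n \<ge> N \<Longrightarrow> \<bar>R n\<bar> < e / 2"
      using LIMSEQ_D[OF R0, of "e / 2"] by auto
    have "((\<lambda>t. (1 - t) * (real N * B)) \<longlongrightarrow> (1 - 1) * (real N * B)) (at_left 1)"
      by (intro tendsto_intros)
    then have "eventually (\<lambda>t. (1 - t) * (real N * B) < e / 2) (at_left 1)"
      using e by (intro order_tendstoD(2)) auto
    moreover have "eventually (\<lambda>t::real. t \<in> {0<..<1}) (at_left 1)"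
      by (intro eventually_at_leftI[of 0]) auto
    ultimately show "eventually (\<lambda>t. dist ((1 - t) * (\<Sum>n. R n * t ^ n)) 0 < e) (at_left 1)"
    proof eventually_elim
      case (elim t)
      then have t: "0 \<le> t" "t < 1" by auto
      have st: "summable (\<lambda>n. t ^ n)" using t by (intro summable_geometric) auto
      have sN: "summable (\<lambda>n. if n < N then B else (0::real))"
        by (rule summable_finite[of "{..<N}"]) auto
      have "\<bar>\<Sum>n. R n * t ^ n\<bar> \<le> (\<Sum>n. \<bar>R n * t ^ n\<bar>)"
        by (rule summable_rabs[OF sR[OF t]])
      also have "\<dots> \<le> (\<Sum>n. (if n < N then B else 0) + e / 2 * t ^ n)"
      proof (rule suminf_le[OF _ sR[OF t]])
        show "summable (\<lambda>n. (if n < N then B else 0) + e / 2 * t ^ n)"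
          by (intro summable_add sN summable_mult st)
        fix n
        have tn: "0 \<le> t ^ n" "t ^ n \<le> 1" using t by (auto intro: power_le_one)
        show "\<bar>R n * t ^ n\<bar> \<le> (if n < N then B else 0) + e / 2 * t ^ n"
        proof (cases "n < N")
          case True
          have "\<bar>R n * t ^ n\<bar> \<le> B * 1"
            unfolding abs_mult using B tn B0 by (intro mult_mono) auto
          moreover have "0 \<le> e / 2 * t ^ n" using e tn by simp
          ultimately show ?thesis using True by simp
        next
          case False
          then have "\<bar>R n * t ^ n\<bar> \<le> e / 2 * t ^ n"
            unfolding abs_mult using N[of n] tn by (intro mult_mono) auto
          then show ?thesis using False by simp
        qed
      qed
      also have "\<dots> = (\<Sum>n. if n < N then B else 0) + e / 2 * (\<Sum>n. t ^ n)"
        using suminf_add[OF sN summable_mult[OF st, of "e / 2"]] suminf_mult[OF st, of "e / 2"] by simp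
      also have "(\<Sum>n. if n < N then B else 0) = real N * B"
        by (subst suminf_finite[of "{..<N}"]) auto
      also have "(\<Sum>n. t ^ n) = 1 / (1 - t)" using t by (intro suminf_geometric) auto
      finally have "(1 - t) * \<bar>\<Sum>n. R n * t ^ n\<bar> \<le> (1 - t) * (real N * B + e / 2 * (1 / (1 - t)))"
        using t by (intro mult_left_mono) auto
      also have "\<dots> = (1 - t) * (real N * B) + e / 2" using t by (simp add: field_simps)
      also have "\<dots> < e" using elim by simp
      finally show ?case using t by (simp add: dist_real_def abs_mult)
    qed
  qed
  then have lim': "((\<lambda>t. c + (1 - t) * (\<Sum>n. R n * t ^ n)) \<longlongrightarrow> c + 0) (at_left 1)"
    by (intro tendsto_add tendsto_const)
  have "eventually (\<lambda>t. c + (1 - t) * (\<Sum>n. R n * t ^ n) = (\<Sum>n. d n * t ^ n)) (at_left 1)"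
    using eventually_at_leftI[of 0 1 "\<lambda>t. c + (1 - t) * (\<Sum>n. R n * t ^ n) = (\<Sum>n. d n * t ^ n)"] eq by auto
  from Lim_transform_eventually[OF lim' this] show ?thesis by simp
qed

lemma iter_int_single:
  fixes c :: real
  assumes c: "c = 1 \<or> c = -1" and x: "0 \<le> x" "x < 1"
  shows "iter_int [Some c] x = - ln (1 - c * x)"
proof -
  have "iter_int [Some c] x = (LBINT t=0..x. 1 / (c - t))"
    using x by (simp add: interval_lebesgue_integral_def zero_ereal_def)
  also have "\<dots> = - ln (1 - c * x) - (- ln (1 - c * 0))"
    unfolding zero_ereal_def
  proof (rule interval_integral_FTC_finite)
    show "continuous_on {min 0 x..max 0 x} (\<lambda>t. 1 / (c - t))"
      using x c by (intro continuous_intros) auto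
    show "((\<lambda>t. - ln (1 - c * t)) has_vector_derivative 1 / (c - t)) (at t within {min 0 x..max 0 x})"
      if "min 0 x \<le> t" "t \<le> max 0 x" for t
    proof -
      have pos: "1 - c * t > 0" and eq: "1 / (c - t) = c / (1 - c * t)"
        using that x c by (auto simp: divide_simps)
      show ?thesis
        unfolding has_real_derivative_iff_has_vector_derivative[symmetric]
        using pos by (auto intro!: derivative_eq_intros simp: eq)
    qed
  qed
  finally show ?thesis by simp
qed

text \<open>Integrating a form against its own primitive gives half the square of the primitive. The
  case c = 1 is the model for the T^2 term; c = -1 evaluates a convergent double sum.\<close>

lemma iter_int_double:
  fixes c :: real
  assumes c: "c = 1 \<or> c = -1" and x: "0 \<le> x" "x < 1"
  shows "iter_int [Some c, Some c] x = ln (1 - c * x) ^ 2 / 2"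
proof -
  have "iter_int [Some c, Some c] x = (LBINT t:{0<..<x}. form (Some c) t * iter_int [Some c] t)"
    by (simp only: iter_int.simps)
  also have "\<dots> = (LBINT t:{0<..<x}. - ln (1 - c * t) / (c - t))"
    using x iter_int_single[OF c] by (intro set_lebesgue_integral_cong) auto
  also have "\<dots> = (LBINT t=0..x. - ln (1 - c * t) / (c - t))"
    using x by (simp add: interval_lebesgue_integral_def zero_ereal_def)
  also have "\<dots> = ln (1 - c * x) ^ 2 / 2 - ln (1 - c * 0) ^ 2 / 2"
    unfolding zero_ereal_def
  proof (rule interval_integral_FTC_finite)
    show "continuous_on {min 0 x..max 0 x} (\<lambda>t. - ln (1 - c * t) / (c - t))"
      using x c by (intro continuous_intros) auto
    show "((\<lambda>t. ln (1 - c * t) ^ 2 / 2) has_vector_derivative - ln (1 - c * t) / (c - t))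
        (at t within {min 0 x..max 0 x})"
      if "min 0 x \<le> t" "t \<le> max 0 x" for t
    proof -
      have pos: "1 - c * t > 0" and eq: "- ln (1 - c * t) / (c - t) = - ln (1 - c * t) * c / (1 - c * t)"
        using that x c by (auto simp: divide_simps)
      show ?thesis
        unfolding has_real_derivative_iff_has_vector_derivative[symmetric] eq
        by (rule derivative_eq_intros refl pos | simp)+ (use pos in \<open>simp add: field_simps\<close>)
    qed
  qed
  finally show ?thesis by simp
qed

lemma iter_int_word:
  assumes "pos_index idx" "0 \<le> t" "t < 1"
  shows "iter_int (word idx) t = (\<Sum>n. zeta_coeff idx n * t ^ n)"
  using powser_on_unitD(2)[OF powser_word_aux[OF assms(1), of 1] assms(2,3)] by (simp add: word_def)

lemma summable_zeta_coeff:
  assumes "pos_index idx" "0 \<le> t" "t < 1"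
  shows "summable (\<lambda>n. zeta_coeff idx n * t ^ n)"
  using summable_norm_cancel[OF summable_linear_powser[OF
      powser_on_unitD(1)[OF powser_word_aux[OF assms(1), of 1]], of t]] assms(2,3) by simp

lemma iter_int_asymptotics:
  assumes pos: "pos_index idx" and A: "harm_expansion (zeta_trunc idx) P" and deg: "degree P \<le> 2"
  shows "((\<lambda>e. iter_int (word idx) (1 - e) - poly (P + [:zeta [nb 2] * coeff P 2:]) (- ln e))
    \<longlongrightarrow> 0) (at_right 0)"
proof -
  obtain a b c where P: "P = [:a, b, c:]" using poly_degree_le_2[OF deg] by blast
  \<comment> \<open>Subtracting \<open>b\<close> and \<open>2 * c\<close> times the two model series
    removes b H and c (H^2 - S) from the partial sums, where S is the sum of 1/n^2. The remainder
    tends to a + c zeta(2), because S does not belong to the term c H^2; this is the entire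
    correction.\<close>
  define d where "d = (\<lambda>n. zeta_coeff idx n - b * zeta_coeff [nb 1] n - 2 * c * zeta_coeff [nb 1, nb 1] n)"
  have z1: "zeta_trunc [nb 1] M = harm M" for M
    by (simp add: zsgn_def harm_def inverse_eq_divide)
  have z11: "2 * zeta_trunc [nb 1, nb 1] M = harm M ^ 2 - (\<Sum>n=1..M. 1 / real n ^ 2)" for M
    using sum_harm_pred[of M] unfolding zeta_trunc_nb1[of "[nb 1]"] z1 by simp
  have "(\<Sum>k\<le>n. d k) = zeta_trunc idx n - b * harm n - c * (harm n ^ 2 - (\<Sum>n=1..n. 1 / real n ^ 2))" for n
  proof -
    have "(\<Sum>k\<le>n. d k) = (\<Sum>k\<le>n. zeta_coeff idx k) - b * (\<Sum>k\<le>n. zeta_coeff [nb 1] k)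
        - 2 * c * (\<Sum>k\<le>n. zeta_coeff [nb 1, nb 1] k)"
      unfolding d_def sum_subtractf sum_distrib_left by simp
    also have "\<dots> = zeta_trunc idx n - b * zeta_trunc [nb 1] n - c * (2 * zeta_trunc [nb 1, nb 1] n)"
      using pos by (simp add: sum_zeta_coeff del: zeta_trunc.simps zeta_coeff.simps)
    finally show ?thesis by (simp only: z1 z11)
  qed
  then have "(\<lambda>n. \<Sum>k\<le>n. d k) = (\<lambda>n. (zeta_trunc idx n - poly P (harm n)) + a + c * (\<Sum>n=1..n. 1 / real n ^ 2))"
    by (simp add: fun_eq_iff P algebra_simps power2_eq_square)
  moreover have "\<dots> \<longlonglongrightarrow> 0 + a + c * zeta [nb 2]"
    using A unfolding harm_expansion_def by (intro tendsto_intros zeta_two_limit)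
  ultimately have "((\<lambda>t. \<Sum>n. d n * t ^ n) \<longlongrightarrow> a + c * zeta [nb 2]) (at_left 1)"
    using abel_limit by simp
  moreover have "filterlim (\<lambda>e::real. 1 - e) (at_left 1) (at_right 0)" by real_asymp
  ultimately have "((\<lambda>e. \<Sum>n. d n * (1 - e) ^ n) \<longlongrightarrow> a + c * zeta [nb 2]) (at_right 0)"
    by (rule filterlim_compose)
  then have lim: "((\<lambda>e. (\<Sum>n. d n * (1 - e) ^ n) - (a + c * zeta [nb 2])) \<longlongrightarrow> 0) (at_right 0)"
    by (simp only: LIM_zero_iff)
  have *: "(\<Sum>n. d n * (1 - e) ^ n) - (a + c * zeta [nb 2])
      = iter_int (word idx) (1 - e) - poly (P + [:zeta [nb 2] * coeff P 2:]) (- ln e)"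
    if e: "0 < e" "e < 1" for e
  proof -
    define t where "t = 1 - e"
    have t: "0 \<le> t" "t < 1" using e by (auto simp: t_def)
    have w: "word [nb 1] = [Some 1]" "word [nb 1, nb 1] = [Some 1, Some 1]"
      by (simp_all add: word_def zsgn_def)
    have s: "(\<lambda>n. zeta_coeff i n * t ^ n) sums iter_int (word i) t" if "pos_index i" for i
      using summable_sums[OF summable_zeta_coeff[OF that t]] iter_int_word[OF that t] by simp
    have "(\<lambda>n. zeta_coeff idx n * t ^ n - b * (zeta_coeff [nb 1] n * t ^ n)
        - 2 * c * (zeta_coeff [nb 1, nb 1] n * t ^ n))
      sums (iter_int (word idx) t - b * iter_int (word [nb 1]) t - 2 * c * iter_int (word [nb 1, nb 1]) t)"
      using pos by (intro sums_diff sums_mult s) auto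
    then have "(\<Sum>n. d n * t ^ n)
        = iter_int (word idx) t - b * iter_int (word [nb 1]) t - 2 * c * iter_int (word [nb 1, nb 1]) t"
      by (simp add: d_def sums_iff algebra_simps del: zeta_coeff.simps)
    also have "\<dots> = iter_int (word idx) t + b * ln e - c * ln e ^ 2"
      using iter_int_single[of 1 t] iter_int_double[of 1 t] t unfolding w by (simp add: t_def del: iter_int.simps)
    finally show ?thesis
      by (simp add: P t_def power2_eq_square algebra_simps numeral_2_eq_2)
  qed
  have "eventually (\<lambda>e. (\<Sum>n. d n * (1 - e) ^ n) - (a + c * zeta [nb 2])
      = iter_int (word idx) (1 - e) - poly (P + [:zeta [nb 2] * coeff P 2:]) (- ln e)) (at_right 0)"
    by (rule eventually_at_rightI[of 0 1]) (rule *, simp_all)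
  from Lim_transform_eventually[OF lim this] show ?thesis .
qed

lemma zeta_sh_eq:
  assumes "reg_index idx"
  shows "zeta_sh idx = zeta_star idx + [:zeta [nb 2] * coeff (zeta_star idx) 2:]"
proof -
  have "pos_index i" if "conv_index i" for i using that by (cases i) auto
  then have pos: "pos_index idx"
    using assms by (cases idx rule: reg_index.cases) (fastforce simp del: conv_index.simps)+
  note P = iter_int_asymptotics[OF pos zeta_star_reg[OF assms]]
  have "filterlim (\<lambda>e::real. - ln e) at_top (at_right 0)" by real_asymp
  note uniq = poly_tendsto_0_imp_0[OF this]
  show ?thesis unfolding zeta_sh_def
  proof (rule the_equality)
    show "((\<lambda>e. iter_int (word idx) (1 - e)
        - poly (zeta_star idx + [:zeta [nb 2] * coeff (zeta_star idx) 2:]) (- ln e)) \<longlongrightarrow> 0) (at_right 0)"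
      by (rule P)
    fix Q assume Q: "((\<lambda>e. iter_int (word idx) (1 - e) - poly Q (- ln e)) \<longlongrightarrow> 0) (at_right 0)"
    have "Q - (zeta_star idx + [:zeta [nb 2] * coeff (zeta_star idx) 2:]) = 0"
      by (rule uniq) (use tendsto_diff[OF P Q] in \<open>simp_all add: algebra_simps\<close>)
    then show "Q = zeta_star idx + [:zeta [nb 2] * coeff (zeta_star idx) 2:]" by simp
  qed
qed

lemma iter_int_tendsto_zeta:
  assumes "conv_index idx"
  shows "((\<lambda>e. iter_int (word idx) (1 - e)) \<longlongrightarrow> zeta idx) (at_right 0)"
proof -
  have "pos_index idx" using assms by (cases idx) auto
  from iter_int_asymptotics[OF this harm_expansion_conv[OF assms]] show ?thesis
    by (simp add: LIM_zero_iff numeral_2_eq_2)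
qed

text \<open>In cumulative signs the index (bar 1, 1) repeats one form, so its integral is half a
  square already before the limit. The stuffle product does not give this value directly, since its
  factor with sign 1 diverges.\<close>

lemma zeta_bar_one_one: "zeta [br 1, nb 1] = zeta [br 1] ^ 2 / 2"
proof -
  have w: "word [br 1] = [Some (-1)]" "word [br 1, nb 1] = [Some (-1), Some (-1)]"
    by (simp_all add: word_def zsgn_def)
  have ev: "eventually (\<lambda>e::real. 0 < e \<and> e < 1) (at_right 0)"
    by (intro eventually_at_rightI[of 0 1]) auto
  have 1: "((\<lambda>e. iter_int (word [br 1]) (1 - e)) \<longlongrightarrow> zeta [br 1]) (at_right 0)"
    by (rule iter_int_tendsto_zeta) auto
  have 2: "((\<lambda>e. iter_int (word [br 1, nb 1]) (1 - e)) \<longlongrightarrow> zeta [br 1, nb 1]) (at_right 0)"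
    by (rule iter_int_tendsto_zeta) auto
  have "((\<lambda>e. iter_int (word [br 1]) (1 - e) ^ 2 / 2) \<longlongrightarrow> zeta [br 1] ^ 2 / 2) (at_right 0)"
    by (intro tendsto_intros 1) auto
  moreover have "eventually (\<lambda>e. iter_int (word [br 1]) (1 - e) ^ 2 / 2 = iter_int (word [br 1, nb 1]) (1 - e)) (at_right 0)"
    using ev
  proof eventually_elim
    case (elim e)
    then show ?case using iter_int_single[of "-1" "1 - e"] iter_int_double[of "-1" "1 - e"]
      unfolding w by (simp del: iter_int.simps)
  qed
  ultimately have "((\<lambda>e. iter_int (word [br 1, nb 1]) (1 - e)) \<longlongrightarrow> zeta [br 1] ^ 2 / 2) (at_right 0)"
    by (rule Lim_transform_eventually)
  from tendsto_unique[OF _ 2 this] show ?thesis by simp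
qed

section \<open>Symmetrization and partial fractions\<close>

text \<open>The complete homogeneous symmetric polynomial of degree \<open>e\<close> in two
  variables.\<close>

definition hom :: "nat \<Rightarrow> real \<Rightarrow> real \<Rightarrow> real" where
  "hom e y z = (\<Sum>j\<le>e. y ^ j * z ^ (e - j))"

lemma hom_0 [simp]: "hom 0 y z = 1"
  by (simp add: hom_def)

lemma hom_Suc: "hom (Suc e) y z = y * hom e y z + z ^ Suc e"
  unfolding hom_def by (subst sum.atMost_Suc_shift) (simp add: sum_distrib_left mult_ac)

lemma hom_commute: "hom e y z = hom e z y"
  unfolding hom_def by (rule sum.reindex_bij_witness[of _ "\<lambda>j. e - j" "\<lambda>j. e - j"]) auto

lemma hom_Suc': "hom (Suc e) y z = z * hom e y z + y ^ Suc e"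
  by (metis hom_Suc hom_commute)

lemma hom_diff: "(y - z) * hom e y z = y ^ Suc e - z ^ Suc e"
proof -
  have "y * hom e y z + z ^ Suc e = z * hom e y z + y ^ Suc e"
    using hom_Suc[of e y z] hom_Suc'[of e y z] by linarith
  then show ?thesis by (simp add: algebra_simps)
qed

lemma hom_same: "hom e y y = real (Suc e) * y ^ e"
  by (simp add: hom_def flip: power_add)

text \<open>The source of the weights. For U = 1/p, V = 1/q, Y = 1/(p + q) the hypothesis is the
  partial fraction of 1/(p q). Raising the degree produces 2 Y U V h_e; thanks to the 2 this splits
  into two equal parts, which complete Y U h_(e+1) and Y V h_(e+1).\<close>

lemma hom_shuffle:
  assumes "U * V = Y * (U + V)"
  shows "Y * U * hom e (2 * Y) U + Y * V * hom e (2 * Y) V = U * V * hom e U V"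
proof (induction e)
  case 0
  then show ?case using assms by (simp add: algebra_simps)
next
  case (Suc e)
  have "Y * U * hom (Suc e) (2 * Y) U + Y * V * hom (Suc e) (2 * Y) V
      = 2 * Y * (Y * U * hom e (2 * Y) U + Y * V * hom e (2 * Y) V) + Y * (U ^ Suc (Suc e) + V ^ Suc (Suc e))"
    by (simp add: hom_Suc algebra_simps)
  also have "\<dots> = Y * (2 * (U * V) * hom e U V + U ^ Suc (Suc e) + V ^ Suc (Suc e))"
    unfolding Suc by (simp add: algebra_simps)
  also have "2 * (U * V) * hom e U V + U ^ Suc (Suc e) + V ^ Suc (Suc e)
      = U * (V * hom e U V + U ^ Suc e) + V * (U * hom e U V + V ^ Suc e)"
    by (simp add: algebra_simps)
  also have "\<dots> = (U + V) * hom (Suc e) U V"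
    using hom_Suc[of e U V] hom_Suc'[of e U V] by (simp add: algebra_simps)
  also have "Y * \<dots> = U * V * hom (Suc e) U V"
    using assms by (simp add: mult_ac)
  finally show ?case .
qed

text \<open>The complete homogeneous polynomial in three variables, organised by the power of the
  one that belongs to the outer index.\<close>

definition hom3 :: "nat \<Rightarrow> real \<Rightarrow> real \<Rightarrow> real \<Rightarrow> real" where
  "hom3 d x y z = (\<Sum>i\<le>d. x ^ i * hom (d - i) y z)"

lemma hom3_Suc: "hom3 (Suc d) x y z = x * hom3 d x y z + hom (Suc d) y z"
  unfolding hom3_def by (subst sum.atMost_Suc_shift) (simp add: sum_distrib_left mult_ac)

text \<open>Lagrange's formula for the complete homogeneous polynomial, the sum of x^(d+2) / ((x -
  y)(x - z)) over the three choices of x, evaluated at reciprocals and divided by n p q.\<close>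

lemma partial_fractions_distinct:
  assumes nz: "n \<noteq> 0" "p \<noteq> 0" "q \<noteq> 0" and ne: "n \<noteq> p" "n \<noteq> q" "p \<noteq> (q :: real)"
  shows "hom3 d (1/n) (1/p) (1/q) / (n * p * q)
    = (1/n) ^ Suc d * (1 / ((n - p) * (n - q))) + (1/p) ^ Suc d * (1 / ((n - p) * (q - p)))
      + (1/q) ^ Suc d * (1 / ((n - q) * (p - q)))"
proof (induction d)
  case 0
  have "((n - p) * (n - q) * (p - q)) * (n * p * q) \<noteq> 0" using assms by simp
  have "1 / (n * p * q) = 1 / n * (1 / ((n - p) * (n - q))) + 1 / p * (1 / ((n - p) * (q - p)))
      + 1 / q * (1 / ((n - q) * (p - q)))"
    using assms by (simp add: divide_simps) (simp add: algebra_simps)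
  then show ?case by (simp add: hom3_def)
next
  case (Suc d)
  define A B C where "A = 1 / ((n - p) * (n - q))" and "B = 1 / ((n - p) * (q - p))"
    and "C = 1 / ((n - q) * (p - q))"
  have hB: "(1/p - 1/n) * B = 1 / (n * p * (q - p))" "(1/q - 1/n) * C = - 1 / (n * q * (q - p))"
    unfolding B_def C_def using assms by (simp_all add: divide_simps)
  have "(1/p - 1/q) * hom (Suc d) (1/p) (1/q) = (1/p) ^ Suc (Suc d) - (1/q) ^ Suc (Suc d)"
    by (rule hom_diff)
  moreover have "1/p - 1/q = (q - p) / (p * q)" using nz by (simp add: field_simps)
  ultimately have "(q - p) * (hom (Suc d) (1/p) (1/q) / (p * q)) = (1/p) ^ Suc (Suc d) - (1/q) ^ Suc (Suc d)"
    by simp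
  then have hom: "hom (Suc d) (1/p) (1/q) / (p * q) = ((1/p) ^ Suc (Suc d) - (1/q) ^ Suc (Suc d)) / (q - p)"
    using ne by (metis eq_iff_diff_eq_0 nonzero_mult_div_cancel_left)
  have "hom3 (Suc d) (1/n) (1/p) (1/q) / (n * p * q)
      = 1/n * (hom3 d (1/n) (1/p) (1/q) / (n * p * q)) + 1/n * (hom (Suc d) (1/p) (1/q) / (p * q))"
    by (simp add: hom3_Suc add_divide_distrib)
  also have "\<dots> = 1/n * ((1/n) ^ Suc d * A + (1/p) ^ Suc d * B + (1/q) ^ Suc d * C)
      + ((1/p) ^ Suc d * (1 / (n * p * (q - p))) + (1/q) ^ Suc d * (- 1 / (n * q * (q - p))))"
  proof -
    have "1/n * ((1/p * P - 1/q * Q) / (q - p)) = P * (1 / (n * p * (q - p))) + Q * (- 1 / (n * q * (q - p)))" for P Q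
      by (simp add: diff_divide_distrib right_diff_distrib mult_ac)
    from this[of "(1/p) ^ Suc d" "(1/q) ^ Suc d"] show ?thesis
      unfolding Suc A_def B_def C_def hom by (simp only: power_Suc[of _ "Suc d"])
  qed
  also have "\<dots> = (1/n) ^ Suc (Suc d) * A + (1/p) ^ Suc (Suc d) * B + (1/q) ^ Suc (Suc d) * C"
  proof -
    have "a * (P * A + Q * B + R * C) + (Q * ((b - a) * B) + R * ((c - a) * C))
        = (a * P) * A + (b * Q) * B + (c * R) * C" for a b c P Q R
      by (simp add: algebra_simps)
    then show ?thesis unfolding hB[symmetric] power_Suc[of _ "Suc d"] .
  qed
  finally show ?case unfolding A_def B_def C_def .
qed

text \<open>The confluent case: as q tends to p two poles merge into a derivative, the origin of the
  factor \<open>Suc d\<close> and of the square.\<close>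

lemma partial_fractions_equal:
  assumes nz: "n \<noteq> 0" "p \<noteq> 0" and ne: "n \<noteq> (p :: real)"
  shows "hom3 d (1/n) (1/p) (1/p) / (n * p * p)
    = (1/n) ^ Suc d * (1 / ((n - p) * (n - p)))
      + (1/p) ^ Suc d * (real (Suc d) / (p * (n - p)) - 1 / (n - p) ^ 2)"
proof (induction d)
  case 0
  have "1 / (n * p * p) = 1 / n * (1 / ((n - p) * (n - p))) + 1 / p * (1 / (p * (n - p)) - 1 / (n - p) ^ 2)"
    using assms by (simp add: divide_simps power2_eq_square) (simp add: algebra_simps)
  then show ?case by (simp add: hom3_def)
next
  case (Suc d)
  define A E F where "A = 1 / ((n - p) * (n - p))"
    and "E = real (Suc d) / (p * (n - p)) - 1 / (n - p) ^ 2" and "F = real (Suc (Suc d)) / (n * p * p)"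
  have alg: "1 / n * (real (Suc d) / (p * (n - p)) - 1 / (n - p) ^ 2) + real (Suc (Suc d)) / (n * p * p)
      = 1 / p * (real (Suc (Suc d)) / (p * (n - p)) - 1 / (n - p) ^ 2)"
    using assms by (simp add: divide_simps power2_eq_square) (simp add: algebra_simps)
  have "hom3 (Suc d) (1/n) (1/p) (1/p) / (n * p * p)
      = 1/n * (hom3 d (1/n) (1/p) (1/p) / (n * p * p)) + (1/p) ^ Suc d * (real (Suc (Suc d)) / (n * p * p))"
    by (simp add: hom3_Suc add_divide_distrib hom_same del: of_nat_Suc power_Suc)
  also have "\<dots> = (1/n) ^ Suc (Suc d) * A
      + (1/p) ^ Suc d * (1 / n * (real (Suc d) / (p * (n - p)) - 1 / (n - p) ^ 2) + real (Suc (Suc d)) / (n * p * p))"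
  proof -
    have "a * (P * A + Q * E) + Q * F = (a * P) * A + Q * (a * E + F)" for a P Q
      by (simp add: algebra_simps)
    then show ?thesis
      unfolding Suc A_def[symmetric] E_def[symmetric] F_def[symmetric] power_Suc[of _ "Suc d"] .
  qed
  also have "\<dots> = (1/n) ^ Suc (Suc d) * A
      + (1/p) ^ Suc (Suc d) * (real (Suc (Suc d)) / (p * (n - p)) - 1 / (n - p) ^ 2)"
    unfolding alg by simp
  finally show ?case unfolding A_def .
qed

section \<open>Sums over triples and their decomposition into poles\<close>

definition tri :: "nat \<Rightarrow> (nat \<times> nat \<times> nat) set" where
  "tri M = {(n, p, q). 1 \<le> p \<and> 1 \<le> q \<and> p + q < n \<and> n \<le> M}"

lemma sum_comp3:
  assumes "3 \<le> w"
  shows "(\<Sum>(a,b,c)\<in>comp3 w. f a b c) = (\<Sum>i\<le>w - 3. \<Sum>j\<le>w - 3 - i. f (Suc i) (Suc j) (Suc (w - 3 - i - j)))"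
proof -
  have "(\<Sum>i\<le>w - 3. \<Sum>j\<le>w - 3 - i. f (Suc i) (Suc j) (Suc (w - 3 - i - j)))
      = (\<Sum>(i,j)\<in>(SIGMA i:{..w - 3}. {..w - 3 - i}). f (Suc i) (Suc j) (Suc (w - 3 - i - j)))"
    by (rule sum.Sigma) auto
  also have "\<dots> = (\<Sum>(a,b,c)\<in>comp3 w. f a b c)"
    by (rule sum.reindex_bij_witness[of _ "\<lambda>(a,b,c). (a - 1, b - 1)" "\<lambda>(i,j). (Suc i, Suc j, Suc (w - 3 - i - j))"])
       (use assms in \<open>auto simp: comp3_def\<close>)
  finally show ?thesis ..
qed

lemma sum_comp3_hom3:
  assumes "3 \<le> w"
  shows "(\<Sum>(a,b,c)\<in>comp3 w. k ^ (b - 1) / (n ^ a * m ^ b * p ^ c))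
    = hom3 (w - 3) (1/n) (k/m) (1/p) / (n * m * (p::real))"
  unfolding sum_comp3[OF assms] hom3_def hom_def sum_distrib_left sum_divide_distrib
  by (intro sum.cong refl) (simp add: power_divide)

lemma zeta_trunc_depth3:
  "zeta_trunc [(a, x), (b, y), (c, z)] M
    = (\<Sum>(n,p,q)\<in>tri M. zsgn x ^ n * (zsgn y * zsgn z) ^ p * zsgn y ^ q
        * (1 / (real n ^ a * real (p + q) ^ b * real p ^ c)))"
proof -
  define F where "F = (\<lambda>(n,m,p). (zsgn x ^ n / real n ^ a) * ((zsgn y ^ m / real m ^ b) * (zsgn z ^ p / real p ^ c)))"
  have "zeta_trunc [(a, x), (b, y), (c, z)] M = (\<Sum>n=1..M. \<Sum>m=1..n-1. \<Sum>p=1..m-1. F (n, m, p))"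
    by (simp add: F_def sum_distrib_left)
  also have "\<dots> = (\<Sum>n=1..M. \<Sum>mp\<in>(SIGMA m:{1..n-1}. {1..m-1}). F (n, mp))"
    by (subst sum.Sigma) (auto simp: case_prod_beta)
  also have "\<dots> = (\<Sum>t\<in>(SIGMA n:{1..M}. SIGMA m:{1..n-1}. {1..m-1}). F t)"
    by (subst sum.Sigma) (auto simp: case_prod_beta)
  also have "\<dots> = (\<Sum>(n,p,q)\<in>tri M. F (n, p + q, p))"
    by (rule sum.reindex_bij_witness[of _ "\<lambda>(n,p,q). (n, p + q, p)" "\<lambda>(n,m,p). (n, p, m - p)"])
       (auto simp: tri_def)
  also have "\<dots> = (\<Sum>(n,p,q)\<in>tri M. zsgn x ^ n * (zsgn y * zsgn z) ^ p * zsgn y ^ q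
        * (1 / (real n ^ a * real (p + q) ^ b * real p ^ c)))"
    by (intro sum.cong refl) (auto simp: F_def power_add power_mult_distrib mult_ac)
  finally show ?thesis .
qed

text \<open>\<open>b\<close> and \<open>b'\<close> are the signs carried by \<open>p\<close> and
  \<open>q\<close>: z2 z3 and z2 for an index with signs z1, z2, z3.\<close>

definition wsum :: "nat \<Rightarrow> real \<Rightarrow> real \<Rightarrow> real \<Rightarrow> nat \<Rightarrow> real" where
  "wsum d a b b' M = (\<Sum>(n,p,q)\<in>tri M. a ^ n * b ^ p * b' ^ q
     * (hom3 d (1 / real n) (2 / real (p + q)) (1 / real p) / (real n * real (p + q) * real p)))"

lemma wsum_eq:
  assumes "3 \<le> w"
  shows "(\<Sum>(a,b,c)\<in>comp3 w. 2 ^ (b - 1) * zeta_trunc [(a, x), (b, y), (c, z)] M)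
    = wsum (w - 3) (zsgn x) (zsgn y * zsgn z) (zsgn y) M"
proof -
  have "(\<Sum>(a,b,c)\<in>comp3 w. 2 ^ (b - 1) * zeta_trunc [(a, x), (b, y), (c, z)] M)
      = (\<Sum>t\<in>comp3 w. \<Sum>(n,p,q)\<in>tri M. zsgn x ^ n * (zsgn y * zsgn z) ^ p * zsgn y ^ q
        * (case t of (a,b,c) \<Rightarrow> 2 ^ (b - 1) / (real n ^ a * real (p + q) ^ b * real p ^ c)))"
    by (intro sum.cong refl) (auto simp: zeta_trunc_depth3 sum_distrib_left simp del: zeta_trunc.simps intro!: sum.cong)
  also have "\<dots> = (\<Sum>(n,p,q)\<in>tri M. \<Sum>t\<in>comp3 w. zsgn x ^ n * (zsgn y * zsgn z) ^ p * zsgn y ^ q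
        * (case t of (a,b,c) \<Rightarrow> 2 ^ (b - 1) / (real n ^ a * real (p + q) ^ b * real p ^ c)))"
    by (subst sum.swap) (auto simp: case_prod_beta)
  also have "\<dots> = wsum (w - 3) (zsgn x) (zsgn y * zsgn z) (zsgn y) M"
    unfolding wsum_def
    by (intro sum.cong refl, clarify) (simp only: sum_comp3_hom3[OF assms] sum_distrib_left[symmetric])
  finally show ?thesis .
qed

lemma sum_tri_swap: "(\<Sum>(n,p,q)\<in>tri M. f n p q) = (\<Sum>(n,p,q)\<in>tri M. f n q p)"
  by (rule sum.reindex_bij_witness[of _ "\<lambda>(n,p,q). (n,q,p)" "\<lambda>(n,p,q). (n,q,p)"]) (auto simp: tri_def)

lemma wsum_symmetrized:
  "wsum d a b b' M + wsum d a b' b M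
    = (\<Sum>(n,p,q)\<in>tri M. a ^ n * b ^ p * b' ^ q
        * (hom3 d (1 / real n) (1 / real p) (1 / real q) / (real n * real p * real q)))"
proof -
  have "wsum d a b' b M = (\<Sum>(n,p,q)\<in>tri M. a ^ n * b' ^ q * b ^ p
     * (hom3 d (1 / real n) (2 / real (q + p)) (1 / real q) / (real n * real (q + p) * real q)))"
    unfolding wsum_def by (rule sum_tri_swap)
  then have "wsum d a b b' M + wsum d a b' b M
    = wsum d a b b' M + (\<Sum>(n,p,q)\<in>tri M. a ^ n * b' ^ q * b ^ p
     * (hom3 d (1 / real n) (2 / real (q + p)) (1 / real q) / (real n * real (q + p) * real q)))"
    by simp
  also have "\<dots> = (\<Sum>(n,p,q)\<in>tri M. a ^ n * b ^ p * b' ^ q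
     * (hom3 d (1 / real n) (2 / real (p + q)) (1 / real p) / (real n * real (p + q) * real p)
      + hom3 d (1 / real n) (2 / real (p + q)) (1 / real q) / (real n * real (p + q) * real q)))"
    unfolding wsum_def sum.distrib[symmetric]
    by (intro sum.cong refl) (auto simp: distrib_left add.commute mult_ac)
  also have "\<dots> = (\<Sum>(n,p,q)\<in>tri M. a ^ n * b ^ p * b' ^ q
        * (hom3 d (1 / real n) (1 / real p) (1 / real q) / (real n * real p * real q)))"
  proof (intro sum.cong refl, clarify)
    fix n p q assume "(n, p, q) \<in> tri M"
    then have pos: "p > 0" "q > 0" by (auto simp: tri_def)
    define Y U V where "Y = 1 / real (p + q)" and "U = 1 / real p" and "V = 1 / real q"
    have YUV: "U * V = Y * (U + V)" using pos by (simp add: Y_def U_def V_def field_simps)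
    have "hom3 d (1 / real n) (2 * Y) U * (Y * U) + hom3 d (1 / real n) (2 * Y) V * (Y * V)
        = (\<Sum>i\<le>d. (1 / real n) ^ i * (Y * U * hom (d - i) (2 * Y) U + Y * V * hom (d - i) (2 * Y) V))"
      unfolding hom3_def sum_distrib_right sum.distrib[symmetric]
      by (intro sum.cong refl) (simp add: algebra_simps)
    also have "\<dots> = hom3 d (1 / real n) U V * (U * V)"
      unfolding hom_shuffle[OF YUV] hom3_def sum_distrib_right by (intro sum.cong refl) simp
    finally have shsum: "hom3 d (1 / real n) (2 * Y) U * (Y * U) + hom3 d (1 / real n) (2 * Y) V * (Y * V)
        = hom3 d (1 / real n) U V * (U * V)" .
    have e: "X / (real n * real (p + q) * real p) = X * (Y * U) / real n"
      "X / (real n * real (p + q) * real q) = X * (Y * V) / real n"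
      "X / (real n * real p * real q) = X * (U * V) / real n" for X
      by (simp_all add: Y_def U_def V_def mult_ac)
    have Y2: "2 / real (p + q) = 2 * Y" by (simp add: Y_def)
    show "a ^ n * b ^ p * b' ^ q
     * (hom3 d (1 / real n) (2 / real (p + q)) (1 / real p) / (real n * real (p + q) * real p)
      + hom3 d (1 / real n) (2 / real (p + q)) (1 / real q) / (real n * real (p + q) * real q))
      = a ^ n * b ^ p * b' ^ q
        * (hom3 d (1 / real n) (1 / real p) (1 / real q) / (real n * real p * real q))"
      unfolding e Y2 U_def[symmetric] V_def[symmetric] add_divide_distrib[symmetric] shsum ..
  qed
  finally show ?thesis .
qed

text \<open>Coefficient of the pole at the outer index n, with m = n - p and k = n - q, so that p +
  q < n becomes n < m + k. The pole is called \<open>q\<close> here so that all poles can be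
  collected in one sum.\<close>

definition head_sum :: "real \<Rightarrow> real \<Rightarrow> nat \<Rightarrow> real" where
  "head_sum b b' q = (\<Sum>(m,k)\<in>{(m,k). 1 \<le> m \<and> m < q \<and> 1 \<le> k \<and> k < q \<and> q < m + k}.
     b ^ m * b' ^ k / (real m * real k))"

text \<open>Coefficient of a simple pole at an inner index \<open>q\<close>: s = n - q is the rest
  of the outer index, \<open>j\<close> the other inner index, and \<open>j < s\<close> encodes q + j
  < n.\<close>

definition pole_sum :: "real \<Rightarrow> real \<Rightarrow> nat \<Rightarrow> nat \<Rightarrow> real" where
  "pole_sum a b q S = (\<Sum>s=1..S. \<Sum>j\<in>{1..<s} - {q}. a ^ s * b ^ (q + j) / (real s * (real j - real q)))"

text \<open>The case j = q left out of \<open>pole_sum\<close>, which occurs only for s > q;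
  \<open>u\<close> will be the exponent \<open>Suc d\<close> of the pole.\<close>

definition double_pole_sum :: "real \<Rightarrow> real \<Rightarrow> nat \<Rightarrow> nat \<Rightarrow> real" where
  "double_pole_sum a u q S = (\<Sum>s\<in>{q<..S}. a ^ s * (u / (real q * real s) - 1 / real s ^ 2))"

lemma finite_tri [simp]: "finite (tri M)"
  by (rule finite_subset[of _ "{..M} \<times> {..M} \<times> {..M}"]) (auto simp: tri_def)

lemma sign_power:
  fixes c :: real
  assumes "c = 1 \<or> c = -1"
  shows "c ^ n * c ^ n = 1" "c ^ (n + m) * c ^ n = c ^ m" "m \<le> n \<Longrightarrow> c ^ n * c ^ m = c ^ (n - m)"
proof -
  show 1: "c ^ n * c ^ n = 1" for n using assms by (auto simp flip: power_mult_distrib)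
  show "c ^ (n + m) * c ^ n = c ^ m" using 1[of n] by (simp add: power_add mult_ac)
  assume "m \<le> n"
  then have "c ^ n = c ^ (n - m) * c ^ m" by (simp flip: power_add)
  then show "c ^ n * c ^ m = c ^ (n - m)" using 1[of m] by (simp add: mult_ac)
qed

lemma tri_head:
  assumes "b = 1 \<or> b = -1" "b' = 1 \<or> b' = -1"
  shows "(\<Sum>(n,p,q)\<in>tri M. a ^ n * b ^ p * b' ^ q
      * ((1 / real n) ^ u * (1 / ((real n - real p) * (real n - real q)))))
    = (\<Sum>q=1..M. (a * b * b') ^ q / real q ^ u * head_sum b b' q)"
proof -
  define D where "D = (\<lambda>q. {(m,k). 1 \<le> m \<and> m < q \<and> 1 \<le> k \<and> k < q \<and> q < m + (k::nat)})"
  have fin: "finite (D q)" for q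
    by (rule finite_subset[of _ "{..q} \<times> {..q}"]) (auto simp: D_def)
  have "(\<Sum>q=1..M. (a * b * b') ^ q / real q ^ u * head_sum b b' q)
      = (\<Sum>q=1..M. \<Sum>(m,k)\<in>D q. (a * b * b') ^ q / real q ^ u * (b ^ m * b' ^ k / (real m * real k)))"
  proof -
    have "head_sum b b' q = (\<Sum>(m,k)\<in>D q. b ^ m * b' ^ k / (real m * real k))" for q
      by (simp only: head_sum_def D_def)
    then show ?thesis
      by (intro sum.cong refl) (simp only: sum_distrib_left case_prod_unfold)
  qed
  also have "\<dots> = (\<Sum>(q,m,k)\<in>(SIGMA q:{1..M}. D q).
      (a * b * b') ^ q / real q ^ u * (b ^ m * b' ^ k / (real m * real k)))"
    by (subst sum.Sigma) (auto simp: fin case_prod_beta)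
  also have "\<dots> = (\<Sum>(n,p,q)\<in>tri M. a ^ n * b ^ p * b' ^ q
      * ((1 / real n) ^ u * (1 / ((real n - real p) * (real n - real q)))))"
  proof (rule sum.reindex_bij_witness[of _ "\<lambda>(n,p,q). (n, n - p, n - q)" "\<lambda>(n,m,k). (n, n - m, n - k)"])
    fix t assume "t \<in> (SIGMA q:{1..M}. D q)"
    then obtain n m k where t: "t = (n, m, k)" and "m < n" "k < n" by (auto simp: D_def)
    then have "b ^ n * b ^ m = b ^ (n - m)" "b' ^ n * b' ^ k = b' ^ (n - k)"
      using sign_power(3) assms by auto
    then have "a ^ n * b ^ (n - m) * b' ^ (n - k) = (a * b * b') ^ n * (b ^ m * b' ^ k)"
      by (simp only: power_mult_distrib flip: \<open>b ^ n * b ^ m = b ^ (n - m)\<close>) (simp only: mult_ac)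
    then show "(case case t of (n, m, k) \<Rightarrow> (n, n - m, n - k) of
          (n, p, q) \<Rightarrow> a ^ n * b ^ p * b' ^ q * ((1 / real n) ^ u * (1 / ((real n - real p) * (real n - real q)))))
       = (case t of (q, m, k) \<Rightarrow> (a * b * b') ^ q / real q ^ u * (b ^ m * b' ^ k / (real m * real k)))"
      using \<open>m < n\<close> \<open>k < n\<close> by (simp add: t power_one_over of_nat_diff)
  qed (auto simp: D_def tri_def)
  finally show ?thesis ..
qed

text \<open>For \<open>p = q\<close> the double pole is shared equally between the two terms exchanged by the symmetry.\<close>

definition pole_coeff :: "real \<Rightarrow> real \<Rightarrow> real \<Rightarrow> real \<Rightarrow> real" where
  "pole_coeff u n p q = (if p = q then (u / (p * (n - p)) - 1 / (n - p) ^ 2) / 2 else 1 / ((n - p) * (q - p)))"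

lemma tri_pole:
  assumes b: "b = 1 \<or> b = -1" "b' = 1 \<or> b' = -1"
  shows "(\<Sum>(n,p,q)\<in>tri M. a ^ n * b ^ p * b' ^ q * ((1 / real p) ^ u * pole_coeff v (real n) (real p) (real q)))
    = (\<Sum>q=1..M. (a * b * b') ^ q / real q ^ u
         * (pole_sum a b' q (M - q) + double_pole_sum a v q (M - q) / 2))"
proof -
  define f where "f = (\<lambda>q s j. a ^ s * b' ^ (q + j) * pole_coeff v (real (q + s)) (real q) (real j))"
  have eq: "(\<Sum>s=1..S. \<Sum>j\<in>{1..<s}. f q s j) = pole_sum a b' q S + double_pole_sum a v q S / 2" if "q \<ge> 1" for q S
  proof -
    have "(\<Sum>j\<in>{1..<s}. f q s j) = (\<Sum>j\<in>{1..<s} - {q}. a ^ s * b' ^ (q + j) / (real s * (real j - real q)))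
        + (if q < s then a ^ s * (v / (real q * real s) - 1 / real s ^ 2) / 2 else 0)" for s
    proof -
      have 1: "(\<Sum>j\<in>{1..<s} - {q}. f q s j) = (\<Sum>j\<in>{1..<s} - {q}. a ^ s * b' ^ (q + j) / (real s * (real j - real q)))"
        by (intro sum.cong refl) (auto simp: f_def pole_coeff_def)
      have 2: "f q s q = a ^ s * (v / (real q * real s) - 1 / real s ^ 2) / 2"
        using sign_power(1)[OF b(2), of q] by (simp add: f_def pole_coeff_def power_add)
      show ?thesis
      proof (cases "q < s")
        case True
        then have "q \<in> {1..<s}" using that by simp
        then have "sum (f q s) {1..<s} = f q s q + sum (f q s) ({1..<s} - {q})"
          by (intro sum.remove) auto
        then show ?thesis using True 1 2 by (simp only: if_True add.commute)
      qed (use 1 in simp)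
    qed
    then have "(\<Sum>s=1..S. \<Sum>j\<in>{1..<s}. f q s j) = pole_sum a b' q S
        + (\<Sum>s=1..S. if q < s then a ^ s * (v / (real q * real s) - 1 / real s ^ 2) / 2 else 0)"
      by (simp add: pole_sum_def sum.distrib)
    also have "(\<Sum>s=1..S. if q < s then a ^ s * (v / (real q * real s) - 1 / real s ^ 2) / 2 else 0)
        = double_pole_sum a v q S / 2"
      unfolding double_pole_sum_def sum_divide_distrib
      by (rule sum.mono_neutral_cong_right) auto
    finally show ?thesis .
  qed
  have "(\<Sum>q=1..M. (a * b * b') ^ q / real q ^ u
         * (pole_sum a b' q (M - q) + double_pole_sum a v q (M - q) / 2))
     = (\<Sum>q=1..M. \<Sum>s=1..M-q. \<Sum>j\<in>{1..<s}. (a * b * b') ^ q / real q ^ u * f q s j)"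
  proof (intro sum.cong refl)
    fix q assume "q \<in> {1..M}"
    then have "q \<ge> 1" by simp
    from eq[OF this, of "M - q", symmetric]
    show "(a * b * b') ^ q / real q ^ u
         * (pole_sum a b' q (M - q) + double_pole_sum a v q (M - q) / 2)
      = (\<Sum>s=1..M-q. \<Sum>j\<in>{1..<s}. (a * b * b') ^ q / real q ^ u * f q s j)"
      by (simp only: sum_distrib_left)
  qed
  also have "\<dots> = (\<Sum>q=1..M. \<Sum>(s,j)\<in>(SIGMA s:{1..M-q}. {1..<s}). (a * b * b') ^ q / real q ^ u * f q s j)"
    by (subst sum.Sigma) auto
  also have "\<dots> = (\<Sum>(q,s,j)\<in>(SIGMA q:{1..M}. SIGMA s:{1..M-q}. {1..<s}). (a * b * b') ^ q / real q ^ u * f q s j)"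
    by (subst sum.Sigma) (auto simp: case_prod_beta)
  also have "\<dots> = (\<Sum>(n,p,q)\<in>tri M. a ^ n * b ^ p * b' ^ q * ((1 / real p) ^ u * pole_coeff v (real n) (real p) (real q)))"
  proof (rule sum.reindex_bij_witness[of _ "\<lambda>(n,p,q). (p, n - p, q)" "\<lambda>(p,s,j). (p + s, p, j)"])
    fix t assume "t \<in> (SIGMA q:{1..M}. SIGMA s:{1..M-q}. {1..<s})"
    obtain p s j where t: "t = (p, s, j)" by (cases t)
    have "a ^ (p + s) * b ^ p * b' ^ j = (a * b * b') ^ p * (a ^ s * b' ^ (p + j))"
    proof -
      have "(a * b * b') ^ p * (a ^ s * b' ^ (p + j)) = a ^ (p + s) * b ^ p * (b' ^ (p + j) * b' ^ p)"
        by (simp add: power_mult_distrib power_add mult_ac)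
      then show ?thesis using sign_power(2)[OF b(2), of p j] by simp
    qed
    then show "(case case t of (p, s, j) \<Rightarrow> (p + s, p, j) of
          (n, p, q) \<Rightarrow> a ^ n * b ^ p * b' ^ q * ((1 / real p) ^ u * pole_coeff v (real n) (real p) (real q)))
       = (case t of (q, s, j) \<Rightarrow> (a * b * b') ^ q / real q ^ u * f q s j)"
      by (simp add: t f_def power_one_over)
  qed (auto simp: tri_def)
  finally show ?thesis ..
qed

definition lhs_term :: "real \<Rightarrow> real \<Rightarrow> real \<Rightarrow> real \<Rightarrow> nat \<Rightarrow> nat \<Rightarrow> real" where
  "lhs_term a b b' u q M = head_sum b b' q + pole_sum a b q (M - q) + pole_sum a b' q (M - q)
     + double_pole_sum a u q (M - q)"

text \<open>After renaming, every pole carries the same sign (a b b')^q and the same power of 1/q,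
  which is why the three kinds can be collected. The pole at the second inner index is that at the
  first with \<open>b\<close> and \<open>b'\<close> exchanged.\<close>

lemma wsum_decomposition:
  assumes b: "b = 1 \<or> b = -1" "b' = 1 \<or> b' = -1"
  shows "wsum d a b b' M + wsum d a b' b M
    = (\<Sum>q=1..M. (a * b * b') ^ q / real q ^ Suc d * lhs_term a b b' (real (Suc d)) q M)"
proof -
  define s where "s = (\<lambda>n p q. a ^ n * b ^ p * b' ^ q)"
  define u where "u = Suc d"
  have pf: "hom3 d (1 / real n) (1 / real p) (1 / real q) / (real n * real p * real q)
      = (1 / real n) ^ u * (1 / ((real n - real p) * (real n - real q)))
        + (1 / real p) ^ u * pole_coeff u n p q + (1 / real q) ^ u * pole_coeff u n q p"
    if "(n, p, q) \<in> tri M" for n p q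
  proof -
    have nz: "real n \<noteq> 0" "real p \<noteq> 0" "real q \<noteq> 0" "real n \<noteq> real p" "real n \<noteq> real q"
      using that by (auto simp: tri_def)
    show ?thesis
    proof (cases "p = q")
      case True
      then show ?thesis using partial_fractions_equal[OF nz(1,2,4), of d] nz
        by (simp add: pole_coeff_def u_def del: power_Suc of_nat_Suc)
    next
      case False
      then show ?thesis using partial_fractions_distinct[OF nz, of d] 
        by (simp add: pole_coeff_def u_def del: power_Suc of_nat_Suc)
    qed
  qed
  have "wsum d a b b' M + wsum d a b' b M
      = (\<Sum>(n,p,q)\<in>tri M. s n p q * ((1 / real n) ^ u * (1 / ((real n - real p) * (real n - real q)))))
      + (\<Sum>(n,p,q)\<in>tri M. s n p q * ((1 / real p) ^ u * pole_coeff u n p q))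
      + (\<Sum>(n,p,q)\<in>tri M. s n p q * ((1 / real q) ^ u * pole_coeff u n q p))"
    unfolding wsum_symmetrized sum.distrib[symmetric]
    by (intro sum.cong refl, clarify) (simp only: pf s_def distrib_left prod.case)
  also have "(\<Sum>(n,p,q)\<in>tri M. s n p q * ((1 / real q) ^ u * pole_coeff u n q p))
      = (\<Sum>(n,p,q)\<in>tri M. a ^ n * b' ^ p * b ^ q * ((1 / real p) ^ u * pole_coeff u n p q))"
    by (subst sum_tri_swap) (simp add: s_def mult_ac)
  finally have "wsum d a b b' M + wsum d a b' b M
      = (\<Sum>q=1..M. (a * b * b') ^ q / real q ^ u * head_sum b b' q)
      + (\<Sum>q=1..M. (a * b * b') ^ q / real q ^ u
           * (pole_sum a b' q (M - q) + double_pole_sum a u q (M - q) / 2))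
      + (\<Sum>q=1..M. (a * b' * b) ^ q / real q ^ u
           * (pole_sum a b q (M - q) + double_pole_sum a u q (M - q) / 2))"
    unfolding s_def tri_head[OF b] tri_pole[OF b] tri_pole[OF b(2,1)] .
  also have "a * b' * b = a * b * b'" by simp
  finally show ?thesis
    unfolding sum.distrib[symmetric] u_def[symmetric] lhs_term_def
  proof (rule trans)
    have "c * h + c * (a' + e / 2) + c * (a + e / 2) = c * (h + a + a' + e)" for a a' c e h :: real
      by (simp add: algebra_simps)
    then show "(\<Sum>q=1..M. (a * b * b') ^ q / real q ^ u * head_sum b b' q
        + (a * b * b') ^ q / real q ^ u
           * (pole_sum a b' q (M - q) + double_pole_sum a u q (M - q) / 2)
        + (a * b * b') ^ q / real q ^ u
           * (pole_sum a b q (M - q) + double_pole_sum a u q (M - q) / 2))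
      = (\<Sum>q=1..M. (a * b * b') ^ q / real q ^ u
           * (head_sum b b' q + pole_sum a b q (M - q) + pole_sum a b' q (M - q)
              + double_pole_sum a u q (M - q)))"
      by (simp only:)
  qed
qed

section \<open>Negligible families of sums\<close>

lemma sum_tail:
  assumes "\<And>n. x n = (\<Sum>k=1..n. d k :: real)" "q \<le> (M :: nat)"
  shows "(\<Sum>k\<in>{q<..M}. d k) = x M - x q"
proof -
  have un: "{1..M} = {1..q} \<union> {q<..M}" using assms(2) by auto
  have "x M = x q + (\<Sum>k\<in>{q<..M}. d k)"
    unfolding assms(1) un by (rule sum.union_disjoint) auto
  then show ?thesis by simp
qed

section \<open>Signed harmonic sums and their two products\<close>

definition sharm :: "real \<Rightarrow> nat \<Rightarrow> real" where
  "sharm a n = (\<Sum>k=1..n. a ^ k / real k)"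

definition sharm2 :: "real \<Rightarrow> nat \<Rightarrow> real" where
  "sharm2 a n = (\<Sum>k=1..n. a ^ k / real k ^ 2)"

definition dharm :: "real \<Rightarrow> real \<Rightarrow> nat \<Rightarrow> real" where
  "dharm a b n = (\<Sum>k=1..n. a ^ k / real k * sharm b (k - 1))"

text \<open>The product of two harmonic sums cut down to the triangle j + k <= n: a truncated
  shuffle product.\<close>

definition shsum :: "real \<Rightarrow> real \<Rightarrow> nat \<Rightarrow> real" where
  "shsum a b n = (\<Sum>j=1..n. a ^ j / real j * sharm b (n - j))"

lemma sharm_0 [simp]: "sharm a 0 = 0" by (simp add: sharm_def)
lemma sharm2_0 [simp]: "sharm2 a 0 = 0" by (simp add: sharm2_def)
lemma dharm_0 [simp]: "dharm a b 0 = 0" by (simp add: dharm_def)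

lemma sharm_Suc: "sharm a (Suc n) = sharm a n + a ^ Suc n / real (Suc n)"
  by (simp add: sharm_def)

lemma sharm2_Suc: "sharm2 a (Suc n) = sharm2 a n + a ^ Suc n / real (Suc n) ^ 2"
  by (simp add: sharm2_def)

lemma dharm_Suc: "dharm a b (Suc n) = dharm a b n + a ^ Suc n / real (Suc n) * sharm b n"
  by (simp add: dharm_def)

lemma sharm_pred: "q \<ge> 1 \<Longrightarrow> sharm a (q - 1) = sharm a q - a ^ q / real q"
  using sharm_Suc[of a "q - 1"] by simp

lemma sharm2_pred: "q \<ge> 1 \<Longrightarrow> sharm2 a (q - 1) = sharm2 a q - a ^ q / real q ^ 2"
  using sharm2_Suc[of a "q - 1"] by simp

lemma dharm_pred: "q \<ge> 1 \<Longrightarrow> dharm a b (q - 1) = dharm a b q - a ^ q / real q * sharm b (q - 1)"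
  using dharm_Suc[of a b "q - 1"] by simp

text \<open>Pairs of indices are split into k > l, k < l and k = l.\<close>

lemma stuffle: "sharm a n * sharm b n = dharm a b n + dharm b a n + sharm2 (a * b) n"
proof (induction n)
  case (Suc n)
  have "(x + s) * (y + t) = (x * y) + s * y + t * x + s * t" for x y s t :: real
    by (simp add: algebra_simps)
  then have "sharm a (Suc n) * sharm b (Suc n) = sharm a n * sharm b n + a ^ Suc n / real (Suc n) * sharm b n
      + b ^ Suc n / real (Suc n) * sharm a n + a ^ Suc n / real (Suc n) * (b ^ Suc n / real (Suc n))"
    unfolding sharm_Suc .
  also have "a ^ Suc n / real (Suc n) * (b ^ Suc n / real (Suc n)) = (a * b) ^ Suc n / real (Suc n) ^ 2"
    by (simp only: times_divide_times_eq power_mult_distrib power2_eq_square)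
  finally show ?case unfolding dharm_Suc sharm2_Suc Suc by (simp only: add_ac)
qed simp

text \<open>Passing from n to N = n + 1 adds the diagonal j + k = N, where 1/(j k) = (1/j + 1/k) /
  N. Since signs are their own inverses, each half is a multiple of a harmonic sum with sign a
  b.\<close>

lemma shsum_eq:
  assumes a: "a = 1 \<or> a = -1" and b: "b = 1 \<or> b = -1"
  shows "shsum a b n = dharm b (a * b) n + dharm a (a * b) n"
proof (induction n)
  case (Suc n)
  define N where "N = Suc n"
  have "shsum a b N = (\<Sum>j=1..n. a ^ j / real j * sharm b (N - j))"
    by (simp add: shsum_def N_def)
  also have "\<dots> = (\<Sum>j=1..n. a ^ j / real j * sharm b (n - j) + a ^ j / real j * (b ^ (N - j) / real (N - j)))"
    by (intro sum.cong refl) (auto simp: N_def Suc_diff_le sharm_Suc distrib_left)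
  also have "\<dots> = shsum a b n + (\<Sum>j=1..n. a ^ j / real j * (b ^ (N - j) / real (N - j)))"
    by (simp add: sum.distrib shsum_def)
  also have "(\<Sum>j=1..n. a ^ j / real j * (b ^ (N - j) / real (N - j)))
      = (\<Sum>j=1..n. a ^ j * b ^ (N - j) / real N * (1 / real j) + a ^ j * b ^ (N - j) / real N * (1 / real (N - j)))"
  proof (intro sum.cong refl)
    fix j assume "j \<in> {1..n}"
    then have "real j \<noteq> 0" "real N - real j \<noteq> 0" "real N \<noteq> 0" "real (N - j) = real N - real j"
      by (auto simp: N_def of_nat_diff)
    then show "a ^ j / real j * (b ^ (N - j) / real (N - j))
      = a ^ j * b ^ (N - j) / real N * (1 / real j) + a ^ j * b ^ (N - j) / real N * (1 / real (N - j))"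
      by (simp add: divide_simps) (simp add: algebra_simps)
  qed
  also have "\<dots> = (\<Sum>j=1..n. a ^ j * b ^ (N - j) / real N * (1 / real j))
      + (\<Sum>j=1..n. a ^ j * b ^ (N - j) / real N * (1 / real (N - j)))"
    by (rule sum.distrib)
  also have "(\<Sum>j=1..n. a ^ j * b ^ (N - j) / real N * (1 / real (N - j)))
      = (\<Sum>j=1..n. a ^ (N - j) * b ^ j / real N * (1 / real j))"
    by (rule sum.reindex_bij_witness[of _ "\<lambda>j. N - j" "\<lambda>j. N - j"]) (auto simp: N_def)
  also have "(\<Sum>j=1..n. a ^ j * b ^ (N - j) / real N * (1 / real j)) = b ^ N / real N * sharm (a * b) n"
    unfolding sharm_def sum_distrib_left
  proof (intro sum.cong refl)
    fix j assume "j \<in> {1..n}"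
    then have "b ^ (N - j) = b ^ N * b ^ j" using sign_power(3)[OF b, of j N] by (simp add: N_def)
    then show "a ^ j * b ^ (N - j) / real N * (1 / real j) = b ^ N / real N * ((a * b) ^ j / real j)"
      by (simp add: power_mult_distrib)
  qed
  also have "(\<Sum>j=1..n. a ^ (N - j) * b ^ j / real N * (1 / real j)) = a ^ N / real N * sharm (a * b) n"
    unfolding sharm_def sum_distrib_left
  proof (intro sum.cong refl)
    fix j assume "j \<in> {1..n}"
    then have "a ^ (N - j) = a ^ N * a ^ j" using sign_power(3)[OF a, of j N] by (simp add: N_def)
    then show "a ^ (N - j) * b ^ j / real N * (1 / real j) = a ^ N / real N * ((a * b) ^ j / real j)"
      by (simp add: power_mult_distrib)
  qed
  finally show ?case unfolding N_def dharm_Suc Suc by simp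
qed (simp add: shsum_def)

text \<open>The square of pairs below q falls into the region m + k > q and the triangle m + k <=
  q.\<close>

lemma head_sum_eq:
  "head_sum b b' q = sharm b (q - 1) * sharm b' (q - 1) - shsum b b' q"
proof -
  define f where "f = (\<lambda>(m,k). b ^ m * b' ^ k / (real m * real k))"
  define A B where "A = {1..q-1} \<times> {1..q-1}" and "B = (SIGMA m:{1..q}. {1..q-m})"
  have BA: "B \<subseteq> A" by (auto simp: A_def B_def)
  have "sharm b (q - 1) * sharm b' (q - 1) = (\<Sum>m=1..q-1. \<Sum>k=1..q-1. b ^ m / real m * (b' ^ k / real k))"
    unfolding sharm_def by (rule sum_product)
  also have "\<dots> = sum f A"
    unfolding A_def sum.cartesian_product f_def by (simp add: case_prod_beta)
  also have "\<dots> = sum f (A - B) + sum f B"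
    by (rule sum.subset_diff[OF BA]) (simp add: A_def)
  also have "A - B = {(m,k). 1 \<le> m \<and> m < q \<and> 1 \<le> k \<and> k < q \<and> q < m + k}"
    by (auto simp: A_def B_def)
  also have "sum f \<dots> = head_sum b b' q"
    unfolding head_sum_def f_def ..
  also have "sum f B = (\<Sum>m=1..q. \<Sum>k=1..q-m. f (m, k))"
    unfolding B_def by (subst sum.Sigma) auto
  also have "\<dots> = shsum b b' q"
    unfolding shsum_def sharm_def sum_distrib_left f_def by (intro sum.cong refl) simp
  finally show ?thesis by simp
qed

section \<open>Bounds by harmonic numbers and dominated families\<close>

lemma abs_sign_power: "a = 1 \<or> a = (-1::real) \<Longrightarrow> \<bar>a ^ n\<bar> = 1"
  by (auto simp: power_abs)

lemma sharm_1: "sharm 1 n = harm n"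
  by (simp add: sharm_def harm_def inverse_eq_divide)

lemma abs_sharm_le:
  assumes "a = 1 \<or> a = -1"
  shows "\<bar>sharm a n\<bar> \<le> harm n"
proof -
  have "\<bar>sharm a n\<bar> \<le> (\<Sum>k=1..n. \<bar>a ^ k / real k\<bar>)" unfolding sharm_def by (rule sum_abs)
  then show ?thesis by (simp add: abs_sign_power[OF assms] harm_def inverse_eq_divide)
qed

lemma harm_ge_1: "n \<ge> 1 \<Longrightarrow> 1 \<le> (harm n :: real)"
  using harm_mono[of 1 n, where 'a = real] by (simp add: harm_def)

lemma abs_sharm_le': "a = 1 \<or> a = -1 \<Longrightarrow> m \<le> n \<Longrightarrow> \<bar>sharm a m\<bar> \<le> harm n"
  using abs_sharm_le harm_mono order_trans by blast

lemma harm_le_sq: "n \<ge> 1 \<Longrightarrow> harm n \<le> (harm n :: real) ^ 2"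
  using harm_ge_1[of n] by (simp add: power2_eq_square)

text \<open>Allows every term of a window to be estimated at the left end of the window.\<close>

lemma harm_div_mono:
  assumes "1 \<le> m" "m \<le> n"
  shows "harm n / real n \<le> harm m / real m"
  using assms(2)
proof (induction n rule: dec_induct)
  case (step n)
  note step = step assms(1)
  have "harm (Suc n) * real n \<le> harm n * real (Suc n)"
  proof -
    have "harm (Suc n) * real n = harm n * real n + real n / real (Suc n)"
      unfolding harm_Suc by (simp add: distrib_right divide_inverse)
    also have "real n / real (Suc n) \<le> 1" by simp
    also have "(1::real) \<le> harm n" by (rule harm_ge_1[OF order_trans[OF assms(1) step(1)]])
    finally show ?thesis by (simp add: algebra_simps)
  qed
  then have "harm (Suc n) / real (Suc n) \<le> harm n / real n"
    using step by (simp add: divide_simps mult.commute)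
  then show ?case using step by simp
qed simp

lemma harm_div_tendsto: "(\<lambda>n. harm n / real n :: real) \<longlonglongrightarrow> 0"
proof -
  have "(\<lambda>n. harm n ^ 1 / real n :: real) \<in> O(\<lambda>n. real n powr (1/2) / real n)"
    by (intro landau_o.big.divide_right harm_power_bigo eventually_mono[OF eventually_gt_at_top[of 0]]) auto
  also have "(\<lambda>n. real n powr (1/2) / real n) \<in> o(\<lambda>_. 1)" by real_asymp
  finally show ?thesis by (auto dest: smalloD_tendsto)
qed

text \<open>Domination is demanded only for M >= q, the range that occurs in sums over q <= M. The
  square of H_q is harmless against 1/q^u for u >= 2.\<close>

definition negl :: "(nat \<Rightarrow> nat \<Rightarrow> real) \<Rightarrow> bool" where
  "negl f \<longleftrightarrow> (\<forall>q\<ge>1. (\<lambda>M. f q M) \<longlonglongrightarrow> 0) \<and> (\<exists>C. \<forall>q\<ge>1. \<forall>M\<ge>q. \<bar>f q M\<bar> \<le> C * harm q ^ 2)"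

lemma neglI:
  assumes "\<And>q. q \<ge> 1 \<Longrightarrow> (\<lambda>M. f q M) \<longlonglongrightarrow> 0"
    and "\<And>q M. q \<ge> 1 \<Longrightarrow> q \<le> M \<Longrightarrow> \<bar>f q M\<bar> \<le> C * harm q ^ 2"
  shows "negl f"
  using assms unfolding negl_def by blast

lemma negl_bound:
  assumes "negl f"
  shows "\<exists>C. \<forall>q M. q \<ge> 1 \<longrightarrow> q \<le> M \<longrightarrow> \<bar>f q M\<bar> \<le> C * harm q ^ 2"
  using conjunct2[OF assms[unfolded negl_def]] by simp

lemma negl_tendsto: "negl f \<Longrightarrow> q \<ge> 1 \<Longrightarrow> f q \<longlonglongrightarrow> 0"
  unfolding negl_def by simp

lemma negl_add:
  assumes "negl f" "negl g"
  shows "negl (\<lambda>q M. f q M + g q M)"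
proof -
  obtain C where C: "\<And>q M. q \<ge> 1 \<Longrightarrow> q \<le> M \<Longrightarrow> \<bar>f q M\<bar> \<le> C * harm q ^ 2"
    using negl_bound[OF assms(1)] by blast
  obtain D where D: "\<And>q M. q \<ge> 1 \<Longrightarrow> q \<le> M \<Longrightarrow> \<bar>g q M\<bar> \<le> D * harm q ^ 2"
    using negl_bound[OF assms(2)] by blast
  show ?thesis
  proof (rule neglI[of _ "C + D"])
    show "(\<lambda>M. f q M + g q M) \<longlonglongrightarrow> 0" if "q \<ge> 1" for q
      using tendsto_add[OF negl_tendsto[OF assms(1) that] negl_tendsto[OF assms(2) that]] by simp
    show "\<bar>f q M + g q M\<bar> \<le> (C + D) * harm q ^ 2" if "q \<ge> 1" "q \<le> M" for q M
      using C[OF that] D[OF that] by (simp add: distrib_right)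
  qed
qed

lemma negl_uminus:
  assumes "negl f"
  shows "negl (\<lambda>q M. - f q M)"
proof -
  obtain C where C: "\<And>q M. q \<ge> 1 \<Longrightarrow> q \<le> M \<Longrightarrow> \<bar>f q M\<bar> \<le> C * harm q ^ 2"
    using negl_bound[OF assms] by blast
  show ?thesis
  proof (rule neglI[of _ C])
    show "(\<lambda>M. - f q M) \<longlonglongrightarrow> 0" if "q \<ge> 1" for q
      using tendsto_minus[OF negl_tendsto[OF assms that]] by simp
  qed (use C in simp)
qed

lemma negl_diff: "negl f \<Longrightarrow> negl g \<Longrightarrow> negl (\<lambda>q M. f q M - g q M)"
  using negl_add[of f "\<lambda>q M. - g q M"] negl_uminus[of g] by simp

lemma negl_cong:
  assumes "negl f" "\<And>q M. q \<ge> 1 \<Longrightarrow> q \<le> M \<Longrightarrow> g q M = f q M"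
  shows "negl g"
proof -
  obtain C where C: "\<And>q M. q \<ge> 1 \<Longrightarrow> q \<le> M \<Longrightarrow> \<bar>f q M\<bar> \<le> C * harm q ^ 2"
    using negl_bound[OF assms(1)] by blast
  show ?thesis
  proof (rule neglI[of _ C])
    fix q :: nat assume q: "q \<ge> 1"
    have "f q \<longlonglongrightarrow> 0" using negl_tendsto[OF assms(1) q] .
    moreover have "eventually (\<lambda>M. f q M = g q M) at_top"
      using assms(2)[OF q] by (auto intro: eventually_mono[OF eventually_ge_at_top[of q]])
    ultimately show "(\<lambda>M. g q M) \<longlonglongrightarrow> 0" by (rule Lim_transform_eventually)
  qed (use C assms(2) in auto)
qed

lemma negl_limit:
  assumes x: "x \<longlonglongrightarrow> L" and c: "\<And>q. q \<ge> 1 \<Longrightarrow> \<bar>c q\<bar> \<le> K * harm q ^ 2"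
  shows "negl (\<lambda>q M. c q * (x M - L))"
proof -
  have x0: "(\<lambda>M. x M - L) \<longlonglongrightarrow> 0" using x by (simp add: LIM_zero_iff)
  then obtain B where B: "\<And>M. \<bar>x M - L\<bar> \<le> B"
    using convergent_imp_bounded[OF x0] by (auto simp: bounded_iff)
  show ?thesis
  proof (rule neglI[of _ "K * B"])
    show "(\<lambda>M. c q * (x M - L)) \<longlonglongrightarrow> 0" for q
      using tendsto_mult_left[OF x0, of "c q"] by simp
    fix q M :: nat assume q: "q \<ge> 1"
    have "\<bar>c q * (x M - L)\<bar> \<le> (K * harm q ^ 2) * B"
      unfolding abs_mult using c[OF q] B[of M] by (intro mult_mono) auto
    then show "\<bar>c q * (x M - L)\<bar> \<le> K * B * harm q ^ 2" by (simp add: mult_ac)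
  qed
qed

lemma tannery_negl:
  assumes f: "negl f" and s: "s = 1 \<or> s = -1" and u: "u \<ge> 2"
  shows "(\<lambda>M. \<Sum>q=1..M. s ^ q / real q ^ u * f q M) \<longlonglongrightarrow> 0"
proof -
  obtain C where C: "\<And>q M. q \<ge> 1 \<Longrightarrow> q \<le> M \<Longrightarrow> \<bar>f q M\<bar> \<le> C * harm q ^ 2"
    using negl_bound[OF f] by blast
  \<comment> \<open>Extension by 0 outside 1 <= q <= M turns the finite sums into series over a
    fixed index set.\<close>
  define a where "a = (\<lambda>q M. if 1 \<le> q \<and> q \<le> M then s ^ q / real q ^ u * f q M else 0)"
  define B where "B = (\<lambda>q. \<bar>C\<bar> * (harm q ^ 2 / real q ^ 2))"
  have "(\<lambda>q. harm q ^ 2 / real q ^ 2 :: real) \<in> O(\<lambda>q. real q powr (1/4) / real q ^ 2)"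
    by (intro landau_o.big.divide_right harm_power_bigo eventually_mono[OF eventually_gt_at_top[of 0]]) auto
  also have "(\<lambda>q::nat. real q powr (1/4) / real q ^ 2) \<in> O(\<lambda>q. real q powr (-3/2))" by real_asymp
  finally have O: "(\<lambda>q. harm q ^ 2 / real q ^ 2 :: real) \<in> O(\<lambda>q. real q powr (-3/2))" .
  have "summable (\<lambda>q. norm (real q powr (-3/2)))"
    using summable_real_powr_iff[of "-3/2"] by simp
  from summable_comparison_test_bigo[OF this O] have B: "summable B"
    unfolding B_def by (rule summable_mult)
  have "(\<lambda>M. suminf (\<lambda>q. a q M)) \<longlonglongrightarrow> suminf (\<lambda>_. 0)"
  proof (rule tannerys_theorem[THEN conjunct2, THEN conjunct2, OF _ _ B])
    show "(\<lambda>M. a q M) \<longlonglongrightarrow> 0" for q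
    proof (cases "q \<ge> 1")
      case True
      have "f q \<longlonglongrightarrow> 0" using negl_tendsto[OF f True] .
      from tendsto_mult_left[OF this, of "s ^ q / real q ^ u"]
      have "(\<lambda>M. s ^ q / real q ^ u * f q M) \<longlonglongrightarrow> 0" by simp
      moreover have "eventually (\<lambda>M. s ^ q / real q ^ u * f q M = a q M) at_top"
        using True by (auto simp: a_def intro: eventually_mono[OF eventually_ge_at_top[of q]])
      ultimately show ?thesis by (rule Lim_transform_eventually)
    qed (simp add: a_def)
    have "norm (a q M) \<le> B q" for q M
    proof (cases "1 \<le> q \<and> q \<le> M")
      case True
      have "norm (a q M) = 1 / real q ^ u * \<bar>f q M\<bar>"
        using True abs_sign_power[OF s] by (simp add: a_def abs_mult)
      also have "\<dots> \<le> 1 / real q ^ 2 * (\<bar>C\<bar> * harm q ^ 2)"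
      proof (intro mult_mono)
        show "1 / real q ^ u \<le> 1 / real q ^ 2"
          using True u by (intro divide_left_mono power_increasing) auto
        have "C * harm q ^ 2 \<le> \<bar>C\<bar> * harm q ^ 2" by (intro mult_right_mono) auto
        then show "\<bar>f q M\<bar> \<le> \<bar>C\<bar> * harm q ^ 2" using C[of q M] True by linarith
      qed auto
      finally show ?thesis by (simp add: B_def)
    next
      case False
      then show ?thesis unfolding a_def B_def by (subst if_not_P) auto
    qed
    then show "\<forall>\<^sub>F (q, M) in at_top \<times>\<^sub>F sequentially. norm (a q M) \<le> B q"
      by (intro always_eventually) auto
  qed simp
  moreover have "suminf (\<lambda>q. a q M) = (\<Sum>q=1..M. s ^ q / real q ^ u * f q M)" for M
  proof -
    have "suminf (\<lambda>q. a q M) = (\<Sum>q=1..M. a q M)"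
      by (rule suminf_finite) (auto simp: a_def)
    also have "\<dots> = (\<Sum>q=1..M. s ^ q / real q ^ u * f q M)"
      by (intro sum.cong refl) (auto simp: a_def)
    finally show ?thesis .
  qed
  ultimately show ?thesis by simp
qed

text \<open>Replaces the cutoff M - q by M. The discrepancy has at most q terms: bounded at the left
  end M - q they tend to 0, and bounded at the left end q they total at most H_q.\<close>

lemma negl_tail_shift:
  assumes d: "\<And>s. s \<ge> 1 \<Longrightarrow> \<bar>d s\<bar> \<le> harm s / real s"
    and c: "\<And>q. q \<ge> 1 \<Longrightarrow> \<bar>c q\<bar> \<le> K * harm q"
    and x: "\<And>n. x n = (\<Sum>s=1..n. d s)"
  shows "negl (\<lambda>q M. c q * ((x M - x q) - (\<Sum>s\<in>{q<..M-q}. d s)))"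
proof -
  define A where "A = (\<lambda>q M. {q<..M} - {q<..M-q::nat})"
  have eq: "(x M - x q) - (\<Sum>s\<in>{q<..M-q}. d s) = sum d (A q M)" if "q \<le> M" for q M
  proof -
    have "sum d {q<..M} = x M - x q" by (rule sum_tail[OF x that])
    moreover have "sum d {q<..M} = sum d (A q M) + sum d {q<..M-q}"
      unfolding A_def by (rule sum.subset_diff) auto
    ultimately show ?thesis by simp
  qed
  have bd: "\<bar>sum d (A q M)\<bar> \<le> real q * (harm N / real N)"
    if "N \<ge> 1" "\<And>s. s \<in> A q M \<Longrightarrow> N \<le> s" for q M N
  proof -
    have "card (A q M) \<le> card {M-q<..M}" by (rule card_mono) (auto simp: A_def)
    then have card: "real (card (A q M)) \<le> real q" by simp
    have "\<bar>sum d (A q M)\<bar> \<le> (\<Sum>s\<in>A q M. \<bar>d s\<bar>)" by (rule sum_abs)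
    also have "\<dots> \<le> (\<Sum>s\<in>A q M. harm N / real N)"
    proof (rule sum_mono)
      fix s assume "s \<in> A q M"
      then have "N \<le> s" by (rule that(2))
      then show "\<bar>d s\<bar> \<le> harm N / real N"
        using d[of s] harm_div_mono[OF that(1)] that(1) by force
    qed
    also have "\<dots> = real (card (A q M)) * (harm N / real N)" by simp
    also have "\<dots> \<le> real q * (harm N / real N)"
      using card harm_nonneg[of N, where 'a = real] by (intro mult_right_mono) auto
    finally show ?thesis .
  qed
  show ?thesis
  proof (rule neglI[of _ K])
    fix q :: nat assume q: "q \<ge> 1"
    have "(\<lambda>M. real q * (harm (M - q) / real (M - q))) \<longlonglongrightarrow> real q * 0"
      by (intro tendsto_mult_left filterlim_compose[OF harm_div_tendsto filterlim_minus_const_nat_at_top])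
    then have lim: "(\<lambda>M. real q * (harm (M - q) / real (M - q))) \<longlonglongrightarrow> 0" by simp
    have ev: "eventually (\<lambda>M. norm ((x M - x q) - (\<Sum>s\<in>{q<..M-q}. d s)) \<le> real q * (harm (M - q) / real (M - q))) at_top"
      using eventually_ge_at_top[of "2 * q"]
    proof eventually_elim
      case (elim M)
      have "\<bar>sum d (A q M)\<bar> \<le> real q * (harm (M - q) / real (M - q))"
        by (rule bd) (use elim q in \<open>auto simp: A_def\<close>)
      then show ?case using eq[of q M] elim by simp
    qed
    have "(\<lambda>M. (x M - x q) - (\<Sum>s\<in>{q<..M-q}. d s)) \<longlonglongrightarrow> 0"
      by (rule Lim_null_comparison[OF ev lim])
    from tendsto_mult_left[OF this, of "c q"]
    show "(\<lambda>M. c q * ((x M - x q) - (\<Sum>s\<in>{q<..M-q}. d s))) \<longlonglongrightarrow> 0" by simp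
    fix M assume qM: "q \<le> M"
    have "\<bar>sum d (A q M)\<bar> \<le> real q * (harm q / real q)"
      by (rule bd[OF q]) (auto simp: A_def)
    then have 1: "\<bar>sum d (A q M)\<bar> \<le> harm q" using q by simp
    have "\<bar>c q * sum d (A q M)\<bar> \<le> (K * harm q) * harm q"
      unfolding abs_mult using c[OF q] 1 by (intro mult_mono) auto
    then show "\<bar>c q * ((x M - x q) - (\<Sum>s\<in>{q<..M-q}. d s))\<bar> \<le> K * harm q ^ 2"
      using eq[OF qM] by (simp add: power2_eq_square mult_ac)
  qed
qed

text \<open>The two sums coincide once M >= 2 q, so only the uniform bound has content: a multiple
  of H_q times the sum of 1/s over s <= q.\<close>

lemma negl_cut:
  assumes g: "\<And>q s. q \<ge> 1 \<Longrightarrow> 1 \<le> s \<Longrightarrow> s \<le> q \<Longrightarrow> \<bar>g q s\<bar> \<le> K * (harm q / real s)"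
  shows "negl (\<lambda>q M. (\<Sum>s=1..min q (M - q). g q s) - (\<Sum>s=1..q. g q s))"
proof (rule neglI[of _ "\<bar>K\<bar>"])
  fix q :: nat assume q: "q \<ge> 1"
  have "eventually (\<lambda>M. 0 = (\<Sum>s=1..min q (M - q). g q s) - (\<Sum>s=1..q. g q s)) at_top"
    using eventually_ge_at_top[of "2 * q"] by eventually_elim (simp add: min_def)
  from Lim_transform_eventually[OF tendsto_const this]
  show "(\<lambda>M. (\<Sum>s=1..min q (M - q). g q s) - (\<Sum>s=1..q. g q s)) \<longlonglongrightarrow> 0" .
  fix M :: nat
  have "(\<Sum>s=1..q. g q s) = sum (g q) ({1..q} - {1..min q (M - q)}) + (\<Sum>s=1..min q (M - q). g q s)"
    by (rule sum.subset_diff) auto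
  then have "\<bar>(\<Sum>s=1..min q (M - q). g q s) - (\<Sum>s=1..q. g q s)\<bar> = \<bar>sum (g q) ({1..q} - {1..min q (M - q)})\<bar>"
    by simp
  also have "\<dots> \<le> (\<Sum>s\<in>{1..q} - {1..min q (M - q)}. \<bar>g q s\<bar>)" by (rule sum_abs)
  also have "\<dots> \<le> (\<Sum>s\<in>{1..q}. \<bar>g q s\<bar>)" by (rule sum_mono2) auto
  also have "\<dots> \<le> (\<Sum>s=1..q. \<bar>K\<bar> * harm q * inverse (real s))"
  proof (rule sum_mono)
    fix s assume s: "s \<in> {1..q}"
    have "K * (harm q / real s) \<le> \<bar>K\<bar> * (harm q / real s)"
      using harm_nonneg[of q, where 'a = real] by (intro mult_right_mono) auto
    then show "\<bar>g q s\<bar> \<le> \<bar>K\<bar> * harm q * inverse (real s)"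
      using order_trans[OF g[OF q, of s]] s by (simp add: divide_inverse mult.assoc)
  qed
  also have "\<dots> = \<bar>K\<bar> * harm q ^ 2"
    by (simp add: harm_def power2_eq_square sum_distrib_left mult_ac)
  finally show "\<bar>(\<Sum>s=1..min q (M - q). g q s) - (\<Sum>s=1..q. g q s)\<bar> \<le> \<bar>K\<bar> * harm q ^ 2" .
qed

section \<open>Limits of the pole contributions\<close>

text \<open>
  Suffix \<open>lim\<close>: the limit as \<open>M \<rightarrow> \<infinity>\<close> where it exists. The sums with leading sign \<open>1\<close>
  diverge and stay functions of \<open>M\<close>; in the identities they cancel.
\<close>

definition sharm_lim :: "real \<Rightarrow> nat \<Rightarrow> real" where
  "sharm_lim a M = (if a = 1 then harm M else zeta [br 1])"

definition dharm_lim :: "real \<Rightarrow> real \<Rightarrow> nat \<Rightarrow> real" where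
  "dharm_lim a b M = (if a = 1 then dharm 1 b M else if b = 1 then zeta [br 1] ^ 2 / 2
     else (zeta [br 1] ^ 2 - zeta [nb 2]) / 2)"

definition sharm2_lim :: "real \<Rightarrow> real" where
  "sharm2_lim a = (if a = 1 then zeta [nb 2] else - zeta [nb 2] / 2)"

lemma sharm_minus_limit: "sharm (-1) \<longlonglongrightarrow> zeta [br 1]"
proof -
  have "zeta_trunc [br 1] = sharm (-1)" by (simp add: fun_eq_iff sharm_def zsgn_def)
  then show ?thesis using zeta_limit[of "[br 1]"] by simp
qed

lemma sharm2_limit: "a = 1 \<or> a = -1 \<Longrightarrow> sharm2 a \<longlonglongrightarrow> sharm2_lim a"
proof -
  have "zeta_trunc [br 2] = sharm2 (-1)" "zeta_trunc [nb 2] = sharm2 1"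
    by (simp_all add: fun_eq_iff sharm2_def zsgn_def)
  then have "sharm2 (-1) \<longlonglongrightarrow> - zeta [nb 2] / 2" "sharm2 1 \<longlonglongrightarrow> zeta [nb 2]"
    using zeta_limit[of "[br 2]"] zeta_limit[of "[nb 2]"] zeta_bar_two by auto
  then show "a = 1 \<or> a = -1 \<Longrightarrow> sharm2 a \<longlonglongrightarrow> sharm2_lim a" by (auto simp: sharm2_lim_def)
qed

lemma dharm_minus_limit:
  "dharm (-1) 1 \<longlonglongrightarrow> zeta [br 1] ^ 2 / 2"
  "dharm (-1) (-1) \<longlonglongrightarrow> (zeta [br 1] ^ 2 - zeta [nb 2]) / 2"
proof -
  have "zeta_trunc [br 1, nb 1] = dharm (-1) 1"
    by (simp add: fun_eq_iff dharm_def sharm_def zsgn_def)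
  then show "dharm (-1) 1 \<longlonglongrightarrow> zeta [br 1] ^ 2 / 2"
    using zeta_limit[of "[br 1, nb 1]"] unfolding zeta_bar_one_one by simp
  have "dharm (-1) (-1) = (\<lambda>n. (sharm (-1) n ^ 2 - sharm2 1 n) / 2)"
  proof
    fix n show "dharm (-1) (-1) n = (sharm (-1) n ^ 2 - sharm2 1 n) / 2"
      using stuffle[of "-1" n "-1"] by (simp add: power2_eq_square)
  qed
  moreover have "(\<lambda>n. (sharm (-1) n ^ 2 - sharm2 1 n) / 2) \<longlonglongrightarrow> (zeta [br 1] ^ 2 - zeta [nb 2]) / 2"
    using sharm2_limit[of 1] by (intro tendsto_intros sharm_minus_limit) (auto simp: sharm2_lim_def)
  ultimately show "dharm (-1) (-1) \<longlonglongrightarrow> (zeta [br 1] ^ 2 - zeta [nb 2]) / 2" by simp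
qed

lemma negl_0: "negl (\<lambda>_ _. 0)"
  by (rule neglI[of _ 0]) auto

lemma negl_sharm:
  assumes "a = 1 \<or> a = -1" "\<And>q. q \<ge> 1 \<Longrightarrow> \<bar>c q\<bar> \<le> K * harm q ^ 2"
  shows "negl (\<lambda>q M. c q * (sharm a M - sharm_lim a M))"
proof (cases "a = 1")
  case True
  then show ?thesis using negl_0 by (simp add: sharm_lim_def sharm_1)
next
  case False
  then have "a = -1" using assms(1) by simp
  then show ?thesis using negl_limit[OF sharm_minus_limit assms(2)] by (simp add: sharm_lim_def)
qed

lemma negl_dharm:
  assumes "a = 1 \<or> a = -1" "b = 1 \<or> b = -1" "\<And>q. q \<ge> 1 \<Longrightarrow> \<bar>c q\<bar> \<le> K * harm q ^ 2"
  shows "negl (\<lambda>q M. c q * (dharm a b M - dharm_lim a b M))"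
proof (cases "a = 1")
  case True
  then show ?thesis using negl_0 by (simp add: dharm_lim_def)
next
  case False
  then have "a = -1" using assms(1) by simp
  then show ?thesis using negl_limit[OF dharm_minus_limit(1) assms(3)] negl_limit[OF dharm_minus_limit(2) assms(3)] assms(2)
    by (auto simp: dharm_lim_def)
qed

lemma negl_sharm2:
  assumes "a = 1 \<or> a = -1" "\<And>q. q \<ge> 1 \<Longrightarrow> \<bar>c q\<bar> \<le> K * harm q ^ 2"
  shows "negl (\<lambda>q M. c q * (sharm2 a M - sharm2_lim a))"
  using negl_limit[OF sharm2_limit[OF assms(1)] assms(2)] .

lemma abs_le_sq_1: "q \<ge> 1 \<Longrightarrow> \<bar>1::real\<bar> \<le> 1 * harm q ^ 2"
  using harm_ge_1[of q] harm_le_sq[of q] by simp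

text \<open>The inner sum of 1/(j - q) ends at s - 1. For s <= q it stays to the left of the pole;
  for s > q it contains the entire left part and reaches the distance s - 1 - q to the right. The
  sign b^(q + j) depends only on the distance of j from q.\<close>

lemma pole_sum_split:
  assumes q: "q \<ge> 1" and b: "b = 1 \<or> b = -1"
  shows "pole_sum a b q S
    = - (\<Sum>s=1..min q S. a ^ s / real s * (sharm b (q - 1) - sharm b (q - s)))
      + (\<Sum>s\<in>{q<..S}. a ^ s / real s * (sharm b (s - 1 - q) - sharm b (q - 1)))"
proof -
  define g where "g = (\<lambda>s. \<Sum>j\<in>{1..<s} - {q}. b ^ (q + j) / (real j - real q))"
  have low: "(\<Sum>j\<in>{1..<s}. b ^ (q + j) / (real j - real q)) = - (sharm b (q - 1) - sharm b (q - s))"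
    if "1 \<le> s" "s \<le> q" for s
  proof -
    have "(\<Sum>j\<in>{1..<s}. b ^ (q + j) / (real j - real q)) = (\<Sum>i\<in>{q-s<..q-1}. - (b ^ i / real i))"
    proof (rule sum.reindex_bij_witness[of _ "\<lambda>i. q - i" "\<lambda>j. q - j"])
      fix j assume j: "j \<in> {1..<s}"
      then have "b ^ (q + j) = b ^ (q - j)"
        using sign_power(3)[OF b, of j q] that by (simp add: power_add)
      moreover have "real j - real q = - real (q - j)" using j that by (simp add: of_nat_diff)
      ultimately show "- (b ^ (q - j) / real (q - j)) = b ^ (q + j) / (real j - real q)"
        by (simp only: divide_minus_right)
    qed (use that in auto)
    also have "\<dots> = - (\<Sum>i\<in>{q-s<..q-1}. b ^ i / real i)" by (simp add: sum_negf)
    also have "(\<Sum>i\<in>{q-s<..q-1}. b ^ i / real i) = sharm b (q - 1) - sharm b (q - s)"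
      by (rule sum_tail[OF sharm_def]) (use that in simp)
    finally show ?thesis .
  qed
  have g_low: "g s = - (sharm b (q - 1) - sharm b (q - s))" if "1 \<le> s" "s \<le> q" for s
  proof -
    have "{1..<s} - {q} = {1..<s}" using that by auto
    then show ?thesis using low[OF that] by (simp add: g_def)
  qed
  have g_high: "g s = sharm b (s - 1 - q) - sharm b (q - 1)" if "q < s" for s
  proof -
    have un: "{1..<s} - {q} = {1..<q} \<union> {q<..<s}" using that q by (intro set_eqI) (simp, arith)
    have "g s = (\<Sum>j\<in>{1..<q}. b ^ (q + j) / (real j - real q)) + (\<Sum>j\<in>{q<..<s}. b ^ (q + j) / (real j - real q))"
      unfolding g_def un by (rule sum.union_disjoint) auto
    also have "(\<Sum>j\<in>{1..<q}. b ^ (q + j) / (real j - real q)) = - sharm b (q - 1)"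
      using low[of q] q by simp
    also have "(\<Sum>j\<in>{q<..<s}. b ^ (q + j) / (real j - real q)) = sharm b (s - 1 - q)"
      unfolding sharm_def
    proof (rule sum.reindex_bij_witness[of _ "\<lambda>i. q + i" "\<lambda>j. j - q"])
      fix j assume j: "j \<in> {q<..<s}"
      then have "b ^ (q + j) = b ^ (j - q)"
        using sign_power(3)[OF b, of q j] by (simp add: power_add mult.commute)
      moreover have "real j - real q = real (j - q)" using j by (simp add: of_nat_diff)
      ultimately show "b ^ (j - q) / real (j - q) = b ^ (q + j) / (real j - real q)" by (simp only:)
    qed (use that in auto)
    finally show ?thesis by simp
  qed
  have "pole_sum a b q S = (\<Sum>s=1..S. a ^ s / real s * g s)"
    unfolding pole_sum_def g_def sum_distrib_left by (intro sum.cong refl) simp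
  also have "{1..S} = {1..min q S} \<union> {q<..S}" by auto
  also have "(\<Sum>s\<in>\<dots>. a ^ s / real s * g s)
      = (\<Sum>s=1..min q S. a ^ s / real s * g s) + (\<Sum>s\<in>{q<..S}. a ^ s / real s * g s)"
    by (rule sum.union_disjoint) auto
  also have "(\<Sum>s=1..min q S. a ^ s / real s * g s)
      = - (\<Sum>s=1..min q S. a ^ s / real s * (sharm b (q - 1) - sharm b (q - s)))"
    unfolding sum_negf[symmetric] by (intro sum.cong refl) (simp only: g_low atLeastAtMost_iff min.bounded_iff mult_minus_right)
  also have "(\<Sum>s\<in>{q<..S}. a ^ s / real s * g s)
      = (\<Sum>s\<in>{q<..S}. a ^ s / real s * (sharm b (s - 1 - q) - sharm b (q - 1)))"
    by (intro sum.cong refl) (auto simp: g_high)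
  finally show ?thesis .
qed

text \<open>The price of replacing the shifted argument s - 1 - q by s - 1, after which the sum over
  \<open>s\<close> is a tail of \<open>dharm\<close>. In general it does not vanish in the
  limit.\<close>

definition gap_sum :: "real \<Rightarrow> real \<Rightarrow> nat \<Rightarrow> nat \<Rightarrow> real" where
  "gap_sum a b q S = (\<Sum>s\<in>{q<..S}. a ^ s / real s * (sharm b (s - 1) - sharm b (s - 1 - q)))"

definition gap_lim :: "real \<Rightarrow> real \<Rightarrow> nat \<Rightarrow> real" where
  "gap_lim a b q = zeta [br 1] * (sharm a q - sharm b q) - shsum a (a * b) q + sharm b q * sharm (a * b) q"

lemma sharm_diff_window: "q < s \<Longrightarrow> sharm b (s - 1) - sharm b (s - 1 - q) = (\<Sum>j=1..q. b ^ (s - j) / real (s - j))"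
proof -
  assume qs: "q < s"
  have "(\<Sum>i\<in>{s-1-q<..s-1}. b ^ i / real i) = sharm b (s - 1) - sharm b (s - 1 - q)"
    by (rule sum_tail[OF sharm_def]) (use qs in simp)
  moreover have "(\<Sum>i\<in>{s-1-q<..s-1}. b ^ i / real i) = (\<Sum>j=1..q. b ^ (s - j) / real (s - j))"
    by (rule sum.reindex_bij_witness[of _ "\<lambda>j. s - j" "\<lambda>i. s - i"]) (use qs in auto)
  ultimately show ?thesis by simp
qed

text \<open>After interchanging the summations, 1/(s (s - j)) = (1/(s - j) - 1/s) / j turns the sum
  over \<open>s\<close> into differences of harmonic sums with sign a b.\<close>

lemma gap_sum_eq:
  assumes a: "a = 1 \<or> a = -1" and b: "b = 1 \<or> b = -1" and qS: "q \<le> S"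
  shows "gap_sum a b q S = (\<Sum>j=1..q. b ^ j / real j
    * ((a * b) ^ j * (sharm (a * b) (S - j) - sharm (a * b) (q - j)) - (sharm (a * b) S - sharm (a * b) q)))"
proof -
  define c where "c = a * b"
  have c: "c = 1 \<or> c = -1" using a b by (auto simp: c_def)
  have sharm_diff: "(\<Sum>i\<in>{m<..n}. c ^ i / real i) = sharm c n - sharm c m" if "m \<le> n" for m n
    by (rule sum_tail[OF sharm_def that])
  have "gap_sum a b q S = (\<Sum>s\<in>{q<..S}. \<Sum>j=1..q. a ^ s / real s * (b ^ (s - j) / real (s - j)))"
    unfolding gap_sum_def by (intro sum.cong refl) (simp only: sharm_diff_window greaterThanAtMost_iff sum_distrib_left)
  also have "\<dots> = (\<Sum>j=1..q. \<Sum>s\<in>{q<..S}. a ^ s / real s * (b ^ (s - j) / real (s - j)))"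
    by (rule sum.swap)
  also have "\<dots> = (\<Sum>j=1..q. b ^ j / real j
    * (c ^ j * (sharm c (S - j) - sharm c (q - j)) - (sharm c S - sharm c q)))"
  proof (intro sum.cong refl)
    fix j assume j: "j \<in> {1..q}"
    have "(\<Sum>s\<in>{q<..S}. a ^ s / real s * (b ^ (s - j) / real (s - j)))
        = (\<Sum>s\<in>{q<..S}. b ^ j / real j * (c ^ j * (c ^ (s - j) / real (s - j)) - c ^ s / real s))"
    proof (intro sum.cong refl)
      fix s assume s: "s \<in> {q<..S}"
      have 1: "a ^ s * b ^ (s - j) = b ^ j * c ^ s"
        using sign_power(3)[OF b, of j s] s j by (simp add: c_def power_mult_distrib mult_ac)
      have 2: "c ^ j * c ^ (s - j) = c ^ s"
        using s j by (simp flip: power_add)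
      have "real s \<noteq> 0" "real j \<noteq> 0" "real s - real j \<noteq> 0" "real (s - j) = real s - real j"
        using s j by (auto simp: of_nat_diff)
      then have 3: "1 / (real s * real (s - j)) = 1 / real j * (1 / real (s - j) - 1 / real s)"
        by (simp add: divide_simps)
      have "a ^ s / real s * (b ^ (s - j) / real (s - j)) = (a ^ s * b ^ (s - j)) * (1 / (real s * real (s - j)))"
        by simp
      also have "\<dots> = b ^ j / real j * ((c ^ j * c ^ (s - j)) / real (s - j) - c ^ s / real s)"
        unfolding 1 2 3 by (simp add: right_diff_distrib)
      finally show "a ^ s / real s * (b ^ (s - j) / real (s - j))
        = b ^ j / real j * (c ^ j * (c ^ (s - j) / real (s - j)) - c ^ s / real s)" by simp
    qed
    also have "\<dots> = b ^ j / real j * (c ^ j * (\<Sum>s\<in>{q<..S}. c ^ (s - j) / real (s - j)) - (\<Sum>s\<in>{q<..S}. c ^ s / real s))"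
      by (simp only: sum_distrib_left[symmetric] sum_subtractf)
    also have "(\<Sum>s\<in>{q<..S}. c ^ (s - j) / real (s - j)) = (\<Sum>i\<in>{q-j<..S-j}. c ^ i / real i)"
      by (rule sum.reindex_bij_witness[of _ "\<lambda>i. i + j" "\<lambda>s. s - j"]) (use j in auto)
    also have "\<dots> = sharm c (S - j) - sharm c (q - j)" using qS by (intro sharm_diff) auto
    also have "(\<Sum>s\<in>{q<..S}. c ^ s / real s) = sharm c S - sharm c q" using qS by (rule sharm_diff)
    finally show "(\<Sum>s\<in>{q<..S}. a ^ s / real s * (b ^ (s - j) / real (s - j)))
      = b ^ j / real j * (c ^ j * (sharm c (S - j) - sharm c (q - j)) - (sharm c S - sharm c q))" .
  qed
  finally show ?thesis by (simp add: c_def)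
qed

text \<open>One formula for both signs: for c = 1 both terms diverge, but their difference tends to
  0, and the factor c^j - 1 vanishes as well.\<close>

lemma sharm_shift_limit:
  assumes c: "c = 1 \<or> c = -1"
  shows "(\<lambda>S. c ^ j * sharm c (S - j) - sharm c S) \<longlonglongrightarrow> (c ^ j - 1) * zeta [br 1]"
proof (cases "c = 1")
  case True
  have "(\<lambda>S. harm (S - j) - harm S :: real) \<longlonglongrightarrow> 0"
  proof -
    have 1: "(\<lambda>S. (harm (S - j) - ln (real (S - j))) - (harm S - ln (real S)) :: real) \<longlonglongrightarrow> euler_mascheroni - euler_mascheroni"
      by (intro tendsto_diff euler_mascheroni_LIMSEQ
          filterlim_compose[OF euler_mascheroni_LIMSEQ filterlim_minus_const_nat_at_top])
    have "(\<lambda>S. ln (real S - real j) - ln (real S)) \<longlonglongrightarrow> 0" by real_asymp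
    moreover have "eventually (\<lambda>S. ln (real S - real j) - ln (real S) = ln (real (S - j)) - ln (real S)) at_top"
      using eventually_ge_at_top[of j] by eventually_elim (simp add: of_nat_diff)
    ultimately have "(\<lambda>S. ln (real (S - j)) - ln (real S)) \<longlonglongrightarrow> 0" by (rule Lim_transform_eventually)
    from tendsto_add[OF 1 this] show ?thesis by simp
  qed
  then show ?thesis using True by (simp add: sharm_1)
next
  case False
  then have "c = -1" using c by simp
  have "(\<lambda>S. c ^ j * sharm c (S - j) - sharm c S) \<longlonglongrightarrow> c ^ j * zeta [br 1] - zeta [br 1]"
    unfolding \<open>c = -1\<close>
    by (intro tendsto_diff tendsto_mult_left sharm_minus_limit
        filterlim_compose[OF sharm_minus_limit filterlim_minus_const_nat_at_top])
  then show ?thesis by (simp add: algebra_simps)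
qed

lemma gap_sum_limit:
  assumes a: "a = 1 \<or> a = -1" and b: "b = 1 \<or> b = -1"
  shows "gap_sum a b q \<longlonglongrightarrow> gap_lim a b q"
proof -
  define c where "c = a * b"
  have c: "c = 1 \<or> c = -1" using a b by (auto simp: c_def)
  have bc: "b ^ j * c ^ j = a ^ j" for j
    using sign_power(1)[OF b, of j] by (simp add: c_def power_mult_distrib mult_ac)
  have "(\<lambda>S. \<Sum>j=1..q. b ^ j / real j * ((c ^ j * sharm c (S - j) - sharm c S) - c ^ j * sharm c (q - j) + sharm c q))
      \<longlonglongrightarrow> (\<Sum>j=1..q. b ^ j / real j * ((c ^ j - 1) * zeta [br 1] - c ^ j * sharm c (q - j) + sharm c q))"
    by (intro tendsto_sum tendsto_mult_left tendsto_add tendsto_diff tendsto_const sharm_shift_limit[OF c])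
  moreover have "(\<Sum>j=1..q. b ^ j / real j * ((c ^ j - 1) * zeta [br 1] - c ^ j * sharm c (q - j) + sharm c q)) = gap_lim a b q"
  proof -
    have "(\<Sum>j=1..q. b ^ j / real j * ((c ^ j - 1) * zeta [br 1] - c ^ j * sharm c (q - j) + sharm c q))
        = (\<Sum>j=1..q. zeta [br 1] * (a ^ j / real j) - zeta [br 1] * (b ^ j / real j)
            - a ^ j / real j * sharm c (q - j) + b ^ j / real j * sharm c q)"
      by (intro sum.cong refl) (simp add: bc[symmetric] algebra_simps add_divide_distrib diff_divide_distrib)
    also have "\<dots> = gap_lim a b q"
      unfolding gap_lim_def sharm_def[of a] sharm_def[of b] shsum_def c_def[symmetric] sum.distrib sum_subtractf
      by (simp add: sum_distrib_left sum_distrib_right right_diff_distrib)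
    finally show ?thesis .
  qed
  ultimately have lim: "(\<lambda>S. \<Sum>j=1..q. b ^ j / real j * ((c ^ j * sharm c (S - j) - sharm c S) - c ^ j * sharm c (q - j) + sharm c q))
      \<longlonglongrightarrow> gap_lim a b q" by (simp only:)
  have "eventually (\<lambda>S. (\<Sum>j=1..q. b ^ j / real j * ((c ^ j * sharm c (S - j) - sharm c S) - c ^ j * sharm c (q - j) + sharm c q))
      = gap_sum a b q S) at_top"
    using eventually_ge_at_top[of q]
  proof eventually_elim
    case (elim S)
    show ?case unfolding gap_sum_eq[OF a b elim] c_def[symmetric]
      by (intro sum.cong refl) (simp add: algebra_simps)
  qed
  from Lim_transform_eventually[OF lim this] show ?thesis .
qed

text \<open>Setting all signs to 1 can only enlarge the absolute values. For positive signs the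
  closed form bounds each summand by H_q / j, because \<open>harm (S - j)\<close> is at most
  \<open>harm S\<close>.\<close>

lemma abs_gap_sum_le:
  assumes a: "a = 1 \<or> a = -1" and b: "b = 1 \<or> b = -1"
  shows "\<bar>gap_sum a b q S\<bar> \<le> harm q ^ 2"
proof (cases "q \<le> S")
  case True
  have "\<bar>gap_sum a b q S\<bar> \<le> (\<Sum>s\<in>{q<..S}. \<bar>a ^ s / real s * (sharm b (s - 1) - sharm b (s - 1 - q))\<bar>)"
    unfolding gap_sum_def by (rule sum_abs)
  also have "\<dots> \<le> (\<Sum>s\<in>{q<..S}. 1 ^ s / real s * (sharm 1 (s - 1) - sharm 1 (s - 1 - q)))"
  proof (rule sum_mono)
    fix s assume "s \<in> {q<..S}"
    then have s: "q < s" by simp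
    have "\<bar>\<Sum>j=1..q. b ^ (s - j) / real (s - j)\<bar> \<le> (\<Sum>j=1..q. \<bar>b ^ (s - j) / real (s - j)\<bar>)" by (rule sum_abs)
    also have "\<dots> = (\<Sum>j=1..q. 1 ^ (s - j) / real (s - j))"
      by (simp add: abs_sign_power[OF b])
    finally show "\<bar>a ^ s / real s * (sharm b (s - 1) - sharm b (s - 1 - q))\<bar>
        \<le> 1 ^ s / real s * (sharm 1 (s - 1) - sharm 1 (s - 1 - q))"
      unfolding abs_mult abs_divide abs_sign_power[OF a] sharm_diff_window[OF s]
      by (intro mult_mono) auto
  qed
  also have "\<dots> = gap_sum 1 1 q S" by (simp add: gap_sum_def)
  also have "\<dots> = (\<Sum>j=1..q. 1 / real j * ((harm (S - j) - harm S) + (harm q - harm (q - j))))"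
    using gap_sum_eq[of 1 1 q S] True by (simp add: sharm_1 algebra_simps)
  also have "\<dots> \<le> (\<Sum>j=1..q. 1 / real j * harm q)"
  proof (intro sum_mono mult_left_mono)
    fix j
    have "harm (S - j) \<le> (harm S :: real)" "(0::real) \<le> harm (q - j)"
      by (auto intro: harm_mono harm_nonneg)
    then show "(harm (S - j) - harm S) + (harm q - harm (q - j)) \<le> (harm q :: real)" by linarith
  qed auto
  also have "\<dots> = harm q ^ 2"
    by (simp add: harm_def power2_eq_square sum_distrib_right inverse_eq_divide)
  finally show ?thesis .
qed (simp add: gap_sum_def)

lemma negl_gap:
  assumes a: "a = 1 \<or> a = -1" and b: "b = 1 \<or> b = -1"
  shows "negl (\<lambda>q M. gap_sum a b q (M - q) - gap_lim a b q)"
proof (rule neglI[of _ 2])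
  fix q :: nat
  have "(\<lambda>M. gap_sum a b q (M - q)) \<longlonglongrightarrow> gap_lim a b q"
    by (rule filterlim_compose[OF gap_sum_limit[OF a b] filterlim_minus_const_nat_at_top])
  then show "(\<lambda>M. gap_sum a b q (M - q) - gap_lim a b q) \<longlonglongrightarrow> 0" by (simp add: LIM_zero_iff)
  have "\<bar>gap_lim a b q\<bar> \<le> harm q ^ 2"
    by (rule tendsto_upperbound[OF tendsto_rabs[OF gap_sum_limit[OF a b]]])
       (auto intro: always_eventually abs_gap_sum_le[OF a b])
  then show "\<bar>gap_sum a b q (M - q) - gap_lim a b q\<bar> \<le> 2 * harm q ^ 2" for M
    using abs_gap_sum_le[OF a b, of q "M - q"] by linarith
qed

text \<open>The two parts of \<open>pole_sum_split\<close> with all cuts at M - q removed: the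
  complete sum over s <= q, then the tails of \<open>dharm\<close> and \<open>sharm\<close>, and
  finally the gap.\<close>

definition pole_lim :: "real \<Rightarrow> real \<Rightarrow> nat \<Rightarrow> nat \<Rightarrow> real" where
  "pole_lim a b q M = - sharm b (q - 1) * sharm a q + shsum a b q + (dharm_lim a b M - dharm a b q)
     - sharm b (q - 1) * (sharm_lim a M - sharm a q) - gap_lim a b q"

lemma sharm_pred_bound: "a = 1 \<or> a = -1 \<Longrightarrow> \<bar>sharm a (q - 1)\<bar> \<le> 1 * harm q"
  using abs_sharm_le'[of a "q - 1" q] by simp

lemma negl_pole:
  assumes a: "a = 1 \<or> a = -1" and b: "b = 1 \<or> b = -1"
  shows "negl (\<lambda>q M. pole_sum a b q (M - q) - pole_lim a b q M)"
proof -
  define g where "g = (\<lambda>q s. a ^ s / real s * (sharm b (q - 1) - sharm b (q - s)))"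
  have N1: "negl (\<lambda>q M. (\<Sum>s=1..min q (M - q). g q s) - (\<Sum>s=1..q. g q s))"
  proof (rule negl_cut[of _ 2])
    fix q s :: nat
    have "\<bar>sharm b (q - 1) - sharm b (q - s)\<bar> \<le> 2 * harm q"
      using abs_sharm_le'[OF b, of "q - 1" q] abs_sharm_le'[OF b, of "q - s" q] by simp
    then have "1 / real s * \<bar>sharm b (q - 1) - sharm b (q - s)\<bar> \<le> 1 / real s * (2 * harm q)"
      by (intro mult_left_mono) auto
    then show "\<bar>g q s\<bar> \<le> 2 * (harm q / real s)"
      by (simp add: g_def abs_mult abs_sign_power[OF a])
  qed
  have N2: "negl (\<lambda>q M. 1 * ((dharm a b M - dharm a b q) - (\<Sum>s\<in>{q<..M-q}. a ^ s / real s * sharm b (s - 1))))"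
  proof (rule negl_tail_shift[of _ _ 1])
    fix s :: nat
    show "\<bar>a ^ s / real s * sharm b (s - 1)\<bar> \<le> harm s / real s"
      using abs_sharm_le'[OF b, of "s - 1" s] by (simp add: abs_mult abs_sign_power[OF a] divide_right_mono)
  qed (auto simp: dharm_def harm_ge_1)
  have N3: "negl (\<lambda>q M. sharm b (q - 1) * ((sharm a M - sharm a q) - (\<Sum>s\<in>{q<..M-q}. a ^ s / real s)))"
  proof (rule negl_tail_shift[of _ _ 1])
    fix s :: nat assume "s \<ge> 1"
    then show "\<bar>a ^ s / real s\<bar> \<le> harm s / real s"
      using harm_ge_1[of s] by (simp add: abs_sign_power[OF a] divide_right_mono)
  next
    show "\<bar>sharm b (q - 1)\<bar> \<le> 1 * harm q" for q by (rule sharm_pred_bound[OF b])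
    show "sharm a n = (\<Sum>s=1..n. a ^ s / real s)" for n by (rule sharm_def)
  qed
  have N4: "negl (\<lambda>q M. gap_sum a b q (M - q) - gap_lim a b q)" by (rule negl_gap[OF a b])
  have N5: "negl (\<lambda>q M. 1 * (dharm a b M - dharm_lim a b M))"
    by (rule negl_dharm[OF a b abs_le_sq_1])
  have N6: "negl (\<lambda>q M. sharm b (q - 1) * (sharm a M - sharm_lim a M))"
  proof (rule negl_sharm[OF a, of _ 1])
    show "\<bar>sharm b (q - 1)\<bar> \<le> 1 * harm q ^ 2" if "q \<ge> 1" for q
      using sharm_pred_bound[OF b, of q] harm_le_sq[OF that] by linarith
  qed
  \<comment> \<open>Exact bookkeeping of six replacements: the cut at \<open>min q (M - q)\<close>,
    the cutoff \<open>M - q\<close> in the tails of \<open>dharm\<close> and \<open>sharm\<close>,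
    the gap, and the limits of these two sums.\<close>
  have *: "pole_sum a b q (M - q) - pole_lim a b q M
     = - ((\<Sum>s=1..min q (M - q). g q s) - (\<Sum>s=1..q. g q s))
       - 1 * ((dharm a b M - dharm a b q) - (\<Sum>s\<in>{q<..M-q}. a ^ s / real s * sharm b (s - 1)))
       + sharm b (q - 1) * ((sharm a M - sharm a q) - (\<Sum>s\<in>{q<..M-q}. a ^ s / real s))
       - (gap_sum a b q (M - q) - gap_lim a b q)
       + 1 * (dharm a b M - dharm_lim a b M) - sharm b (q - 1) * (sharm a M - sharm_lim a M)"
    if "q \<ge> 1" for q M
  proof -
    have full: "(\<Sum>s=1..q. g q s) = sharm b (q - 1) * sharm a q - shsum a b q"
      unfolding g_def sharm_def[of a] shsum_def right_diff_distrib sum_subtractf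
      by (simp add: sum_distrib_left mult_ac)
    have "(\<Sum>s\<in>{q<..M-q}. a ^ s / real s * (sharm b (s - 1 - q) - sharm b (q - 1)))
      = (\<Sum>s\<in>{q<..M-q}. a ^ s / real s * sharm b (s - 1))
        - gap_sum a b q (M - q) - sharm b (q - 1) * (\<Sum>s\<in>{q<..M-q}. a ^ s / real s)"
      unfolding gap_sum_def right_diff_distrib sum_subtractf by (simp add: sum_distrib_left mult_ac)
    then show ?thesis
      unfolding pole_sum_split[OF that b] g_def[symmetric] full pole_lim_def
      by (simp add: g_def algebra_simps)
  qed
  show ?thesis
    by (rule negl_cong[OF negl_diff[OF negl_add[OF negl_diff[OF negl_add[OF negl_diff[OF negl_uminus[OF N1] N2] N3] N4] N5] N6]])
       (use * in simp)
qed

section \<open>Pole expansions\<close>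

definition lhs_lim :: "real \<Rightarrow> real \<Rightarrow> real \<Rightarrow> real \<Rightarrow> nat \<Rightarrow> nat \<Rightarrow> real" where
  "lhs_lim a b b' u q M = head_sum b b' q + pole_lim a b q M + pole_lim a b' q M
     + (u / real q * (sharm_lim a M - sharm a q) - (sharm2_lim a - sharm2 a q))"

lemma negl_double_pole:
  assumes a: "a = 1 \<or> a = -1" and u: "u \<ge> 0"
  shows "negl (\<lambda>q M. double_pole_sum a u q (M - q)
     - (u / real q * (sharm_lim a M - sharm a q) - (sharm2_lim a - sharm2 a q)))"
proof -
  have b: "\<bar>u / real q\<bar> \<le> u * harm q" if "q \<ge> 1" for q
  proof -
    have "u * 1 \<le> u * harm q" using harm_ge_1[OF that] u by (intro mult_left_mono) auto
    moreover have "u / real q \<le> u / 1" using that u by (intro divide_left_mono) auto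
    ultimately show ?thesis using u by simp
  qed
  have N1: "negl (\<lambda>q M. u / real q * ((sharm a M - sharm a q) - (\<Sum>s\<in>{q<..M-q}. a ^ s / real s)))"
  proof (rule negl_tail_shift[OF _ b])
    fix s :: nat assume "s \<ge> 1"
    then show "\<bar>a ^ s / real s\<bar> \<le> harm s / real s"
      using harm_ge_1[of s] by (simp add: abs_sign_power[OF a] divide_right_mono)
  qed (auto simp: sharm_def)
  have N2: "negl (\<lambda>q M. 1 * ((sharm2 a M - sharm2 a q) - (\<Sum>s\<in>{q<..M-q}. a ^ s / real s ^ 2)))"
  proof (rule negl_tail_shift[of _ _ 1])
    fix s :: nat assume s: "s \<ge> 1"
    have "1 / real s ^ 2 \<le> 1 / real s"
      using s by (intro divide_left_mono) (auto simp: power2_eq_square)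
    also have "\<dots> \<le> harm s / real s" using harm_ge_1[OF s] by (simp add: divide_right_mono)
    finally show "\<bar>a ^ s / real s ^ 2\<bar> \<le> harm s / real s"
      by (simp add: abs_sign_power[OF a])
  qed (auto simp: sharm2_def harm_ge_1)
  have N3: "negl (\<lambda>q M. u / real q * (sharm a M - sharm_lim a M))"
  proof (rule negl_sharm[OF a, of _ u])
    show "\<bar>u / real q\<bar> \<le> u * harm q ^ 2" if "q \<ge> 1" for q
      using b[OF that] mult_left_mono[OF harm_le_sq[OF that] u] by linarith
  qed
  have N4: "negl (\<lambda>q M. 1 * (sharm2 a M - sharm2_lim a))"
    by (rule negl_sharm2[OF a abs_le_sq_1])
  have "double_pole_sum a u q (M - q) - (u / real q * (sharm_lim a M - sharm a q) - (sharm2_lim a - sharm2 a q))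
     = 1 * ((sharm2 a M - sharm2 a q) - (\<Sum>s\<in>{q<..M-q}. a ^ s / real s ^ 2))
       - u / real q * ((sharm a M - sharm a q) - (\<Sum>s\<in>{q<..M-q}. a ^ s / real s))
       + u / real q * (sharm a M - sharm_lim a M) - 1 * (sharm2 a M - sharm2_lim a)" for q M
  proof -
    have "double_pole_sum a u q (M - q) = (\<Sum>s\<in>{q<..M-q}. u / real q * (a ^ s / real s) - a ^ s / real s ^ 2)"
      unfolding double_pole_sum_def by (intro sum.cong refl) (simp add: right_diff_distrib)
    also have "\<dots> = u / real q * (\<Sum>s\<in>{q<..M-q}. a ^ s / real s) - (\<Sum>s\<in>{q<..M-q}. a ^ s / real s ^ 2)"
      by (simp only: sum_subtractf sum_distrib_left)
    finally show ?thesis by (simp add: right_diff_distrib)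
  qed
  then show ?thesis by (intro negl_cong[OF negl_diff[OF negl_add[OF negl_diff[OF N2 N1] N3] N4]])
qed

section \<open>Expansions over single poles\<close>

text \<open>\<open>T\<close> may depend on \<open>M\<close> because the coefficients of divergent
  sums do. Fixing sign and exponent makes both sides of an identity comparable coefficient by
  coefficient.\<close>

definition polar :: "real \<Rightarrow> nat \<Rightarrow> (nat \<Rightarrow> real) \<Rightarrow> (nat \<Rightarrow> nat \<Rightarrow> real) \<Rightarrow> bool" where
  "polar s u A T \<longleftrightarrow> (\<lambda>M. A M - (\<Sum>q=1..M. s ^ q / real q ^ u * T q M)) \<longlonglongrightarrow> 0"

lemma polar_negl:
  assumes "s = 1 \<or> s = -1" "u \<ge> 2"
    and A: "\<And>M. A M = (\<Sum>q=1..M. s ^ q / real q ^ u * T q M)"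
    and N: "negl (\<lambda>q M. T q M - U q M)"
  shows "polar s u A U"
  using tannery_negl[OF N assms(1,2)] unfolding polar_def A
  by (simp only: right_diff_distrib sum_subtractf)

lemma polar_exact:
  assumes "\<And>M. A M = (\<Sum>q=1..M. s ^ q / real q ^ u * T q M)"
  shows "polar s u A T"
  unfolding polar_def assms by simp

lemma polar_add:
  "polar s u A T \<Longrightarrow> polar s u B U \<Longrightarrow> polar s u (\<lambda>M. A M + B M) (\<lambda>q M. T q M + U q M)"
  unfolding polar_def by (drule (1) tendsto_add) (simp only: distrib_left sum.distrib add_diff_add add_0)

lemma polar_cmult:
  assumes "polar s u A T"
  shows "polar s u (\<lambda>M. c * A M) (\<lambda>q M. c * T q M)"
proof -
  have "(\<lambda>M. c * (A M - (\<Sum>q=1..M. s ^ q / real q ^ u * T q M))) \<longlonglongrightarrow> c * 0"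
    using assms unfolding polar_def by (rule tendsto_mult_left)
  moreover have "c * (A M - (\<Sum>q=1..M. s ^ q / real q ^ u * T q M))
      = c * A M - (\<Sum>q=1..M. s ^ q / real q ^ u * (c * T q M))" for M
    unfolding right_diff_distrib sum_distrib_left by (simp add: mult.left_commute)
  ultimately show ?thesis unfolding polar_def by simp
qed

lemma polar_diff:
  assumes "polar s u A T" "polar s u B U"
  shows "polar s u (\<lambda>M. A M - B M) (\<lambda>q M. T q M - U q M)"
  using polar_add[OF assms(1) polar_cmult[OF assms(2), of "-1"]] by simp

text \<open>Brings expansions with the other sign into a common one: the factor (-1)^q moves into
  the coefficient.\<close>

lemma polar_twist:
  assumes "polar c u A T" and c: "c = 1 \<or> c = -1" and s: "s = 1 \<or> s = -1"
  shows "polar s u A (\<lambda>q M. (c * s) ^ q * T q M)"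
proof -
  have "s ^ q / real q ^ u * ((c * s) ^ q * T q M) = c ^ q / real q ^ u * T q M" for q M
    using sign_power(1)[OF s, of q] by (simp add: power_mult_distrib mult_ac)
  then show ?thesis using assms(1) unfolding polar_def by (simp only:)
qed

text \<open>Meant for the difference of two sides: if their coefficients differ by the same K at
  every pole, the sums differ by K times a depth-one value.\<close>

lemma polar_const:
  assumes "polar (zsgn z) u A T" and u: "u \<ge> 2" and T: "\<forall>q M. q \<ge> 1 \<longrightarrow> T q M = K"
  shows "A \<longlonglongrightarrow> K * zeta [(u, z)]"
proof -
  have "(\<Sum>q=1..M. zsgn z ^ q / real q ^ u * T q M) = K * zeta_trunc [(u, z)] M" for M
    by (simp add: T sum_distrib_left mult.commute)
  then have "(\<lambda>M. A M - K * zeta_trunc [(u, z)] M) \<longlonglongrightarrow> 0"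
    using assms(1) by (simp add: polar_def)
  moreover have "(\<lambda>M. K * zeta_trunc [(u, z)] M) \<longlonglongrightarrow> K * zeta [(u, z)]"
    using u by (intro tendsto_mult_left zeta_limit) auto
  ultimately show ?thesis using tendsto_add by fastforce
qed

lemma zsgn_cases: "zsgn z = 1 \<or> zsgn z = -1"
  by (simp add: zsgn_def)

lemma sum_triangle:
  "(\<Sum>k=1..M. \<Sum>q=1..k-1. F k q) = (\<Sum>q=1..M. \<Sum>k\<in>{q<..M}. F k (q::nat) :: real)"
proof -
  have "(\<Sum>k=1..M. \<Sum>q=1..k-1. F k q) = (\<Sum>(k,q)\<in>(SIGMA k:{1..M}. {1..k-1}). F k q)"
    by (rule sum.Sigma) auto
  also have "\<dots> = (\<Sum>(q,k)\<in>(SIGMA q:{1..M}. {q<..M}). F k q)"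
    by (rule sum.reindex_bij_witness[of _ "\<lambda>(q,k). (k,q)" "\<lambda>(k,q). (q,k)"]) auto
  also have "\<dots> = (\<Sum>q=1..M. \<Sum>k\<in>{q<..M}. F k q)"
    by (rule sum.Sigma[symmetric]) auto
  finally show ?thesis .
qed

lemma zeta_trunc_1_u:
  "zeta_trunc [(Suc 0, x), (u, z)] N
    = (\<Sum>q=1..N. zsgn z ^ q / real q ^ u * (sharm (zsgn x) N - sharm (zsgn x) q))"
proof -
  have "zeta_trunc [(Suc 0, x), (u, z)] N
      = (\<Sum>k=1..N. \<Sum>q=1..k-1. zsgn x ^ k / real k * (zsgn z ^ q / real q ^ u))"
    by (simp add: sum_distrib_left)
  also have "\<dots> = (\<Sum>q=1..N. \<Sum>k\<in>{q<..N}. zsgn x ^ k / real k * (zsgn z ^ q / real q ^ u))"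
    by (rule sum_triangle)
  also have "\<dots> = (\<Sum>q=1..N. zsgn z ^ q / real q ^ u * (sharm (zsgn x) N - sharm (zsgn x) q))"
  proof (intro sum.cong refl)
    fix q assume q: "q \<in> {1..N}"
    have "(\<Sum>k\<in>{q<..N}. zsgn x ^ k / real k) = sharm (zsgn x) N - sharm (zsgn x) q"
      by (rule sum_tail[OF sharm_def]) (use q in simp)
    then show "(\<Sum>k\<in>{q<..N}. zsgn x ^ k / real k * (zsgn z ^ q / real q ^ u))
        = zsgn z ^ q / real q ^ u * (sharm (zsgn x) N - sharm (zsgn x) q)"
      by (simp only: sum_distrib_right[symmetric]) (rule mult.commute)
  qed
  finally show ?thesis .
qed

text \<open>The innermost index becomes the pole q. The outer indices run over q < l < k, whence a
  tail of \<open>dharm\<close> less the part with l <= q; convergent sums are then replaced by their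
  limits.\<close>

lemma polar_1_1_u:
  assumes u: "u \<ge> 2"
  shows "polar (zsgn z) u (zeta_trunc [(Suc 0, x), (Suc 0, y), (u, z)])
    (\<lambda>q M. (dharm_lim (zsgn x) (zsgn y) M - dharm (zsgn x) (zsgn y) q)
       - sharm (zsgn y) q * (sharm_lim (zsgn x) M - sharm (zsgn x) q))"
proof (rule polar_negl[OF zsgn_cases u])
  define a b where "a = zsgn x" and "b = zsgn y"
  have ab: "a = 1 \<or> a = -1" "b = 1 \<or> b = -1" by (auto simp: a_def b_def zsgn_def)
  fix M
  have "zeta_trunc [(Suc 0, x), (Suc 0, y), (u, z)] M
      = (\<Sum>k=1..M. \<Sum>q=1..k-1. a ^ k / real k * (zsgn z ^ q / real q ^ u * (sharm b (k - 1) - sharm b q)))"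
    by (subst zeta_trunc.simps) (simp add: zeta_trunc_1_u sum_distrib_left a_def b_def del: zeta_trunc.simps)
  also have "\<dots> = (\<Sum>q=1..M. \<Sum>k\<in>{q<..M}. a ^ k / real k * (zsgn z ^ q / real q ^ u * (sharm b (k - 1) - sharm b q)))"
    by (rule sum_triangle)
  also have "\<dots> = (\<Sum>q=1..M. zsgn z ^ q / real q ^ u * ((dharm a b M - dharm a b q) - sharm b q * (sharm a M - sharm a q)))"
  proof (intro sum.cong refl)
    fix q assume q: "q \<in> {1..M}"
    have 1: "(\<Sum>k\<in>{q<..M}. a ^ k / real k) = sharm a M - sharm a q"
      by (rule sum_tail[OF sharm_def]) (use q in simp)
    have 2: "(\<Sum>k\<in>{q<..M}. a ^ k / real k * sharm b (k - 1)) = dharm a b M - dharm a b q"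
      by (rule sum_tail[OF dharm_def]) (use q in simp)
    have "(\<Sum>k\<in>{q<..M}. a ^ k / real k * (zsgn z ^ q / real q ^ u * (sharm b (k - 1) - sharm b q)))
        = (\<Sum>k\<in>{q<..M}. zsgn z ^ q / real q ^ u * (a ^ k / real k * sharm b (k - 1) - sharm b q * (a ^ k / real k)))"
      by (intro sum.cong refl) (simp add: algebra_simps)
    also have "\<dots> = zsgn z ^ q / real q ^ u * ((dharm a b M - dharm a b q) - sharm b q * (sharm a M - sharm a q))"
      unfolding 1[symmetric] 2[symmetric] by (simp only: sum_distrib_left[symmetric] sum_subtractf)
    finally show "(\<Sum>k\<in>{q<..M}. a ^ k / real k * (zsgn z ^ q / real q ^ u * (sharm b (k - 1) - sharm b q)))
        = zsgn z ^ q / real q ^ u * ((dharm a b M - dharm a b q) - sharm b q * (sharm a M - sharm a q))" .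
  qed
  finally show "zeta_trunc [(Suc 0, x), (Suc 0, y), (u, z)] M
      = (\<Sum>q=1..M. zsgn z ^ q / real q ^ u * ((dharm (zsgn x) (zsgn y) M - dharm (zsgn x) (zsgn y) q)
          - sharm (zsgn y) q * (sharm (zsgn x) M - sharm (zsgn x) q)))"
    unfolding a_def b_def .
next
  define a b where "a = zsgn x" and "b = zsgn y"
  have ab: "a = 1 \<or> a = -1" "b = 1 \<or> b = -1" by (auto simp: a_def b_def zsgn_def)
  have N1: "negl (\<lambda>q M. 1 * (dharm a b M - dharm_lim a b M))" by (rule negl_dharm[OF ab abs_le_sq_1])
  have N2: "negl (\<lambda>q M. sharm b q * (sharm a M - sharm_lim a M))"
  proof (rule negl_sharm[OF ab(1), of _ 1])
    show "\<bar>sharm b q\<bar> \<le> 1 * harm q ^ 2" if "q \<ge> 1" for q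
      using abs_sharm_le[OF ab(2), of q] harm_le_sq[OF that] by linarith
  qed
  have "negl (\<lambda>q M. ((dharm a b M - dharm a b q) - sharm b q * (sharm a M - sharm a q))
     - ((dharm_lim a b M - dharm a b q) - sharm b q * (sharm_lim a M - sharm a q)))"
    by (rule negl_cong[OF negl_diff[OF N1 N2]]) (simp add: algebra_simps)
  then show "negl (\<lambda>q M. ((dharm (zsgn x) (zsgn y) M - dharm (zsgn x) (zsgn y) q)
          - sharm (zsgn y) q * (sharm (zsgn x) M - sharm (zsgn x) q))
     - ((dharm_lim (zsgn x) (zsgn y) M - dharm (zsgn x) (zsgn y) q)
          - sharm (zsgn y) q * (sharm_lim (zsgn x) M - sharm (zsgn x) q)))"
    unfolding a_def b_def .
qed

lemma polar_1_v:
  assumes u: "u \<ge> 2"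
  shows "polar (zsgn z) u (zeta_trunc [(Suc 0, x), (Suc u, z)])
    (\<lambda>q M. 1 / real q * (sharm_lim (zsgn x) M - sharm (zsgn x) q))"
proof (rule polar_negl[OF zsgn_cases u])
  show "zeta_trunc [(Suc 0, x), (Suc u, z)] M
      = (\<Sum>q=1..M. zsgn z ^ q / real q ^ u * (1 / real q * (sharm (zsgn x) M - sharm (zsgn x) q)))" for M
    unfolding zeta_trunc_1_u by (intro sum.cong refl) simp
  have N: "negl (\<lambda>q M. 1 / real q * (sharm (zsgn x) M - sharm_lim (zsgn x) M))"
  proof (rule negl_sharm[OF zsgn_cases, of _ 1])
    show "\<bar>1 / real q\<bar> \<le> 1 * harm q ^ 2" if "q \<ge> 1" for q
    proof -
      have "1 / real q \<le> 1" using that by simp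
      then show ?thesis using abs_le_sq_1[OF that] by simp
    qed
  qed
  show "negl (\<lambda>q M. 1 / real q * (sharm (zsgn x) M - sharm (zsgn x) q) - 1 / real q * (sharm_lim (zsgn x) M - sharm (zsgn x) q))"
    by (rule negl_cong[OF N]) (simp flip: right_diff_distrib diff_divide_distrib)
qed

lemma polar_2_u:
  assumes u: "u \<ge> 2"
  shows "polar (zsgn z) u (zeta_trunc [(2, x), (u, z)]) (\<lambda>q M. sharm2_lim (zsgn x) - sharm2 (zsgn x) q)"
proof (rule polar_negl[OF zsgn_cases u])
  fix N
  have "zeta_trunc [(2, x), (u, z)] N
      = (\<Sum>k=1..N. \<Sum>q=1..k-1. zsgn x ^ k / real k ^ 2 * (zsgn z ^ q / real q ^ u))"
    by (simp add: sum_distrib_left)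
  also have "\<dots> = (\<Sum>q=1..N. \<Sum>k\<in>{q<..N}. zsgn x ^ k / real k ^ 2 * (zsgn z ^ q / real q ^ u))"
    by (rule sum_triangle)
  also have "\<dots> = (\<Sum>q=1..N. zsgn z ^ q / real q ^ u * (sharm2 (zsgn x) N - sharm2 (zsgn x) q))"
  proof (intro sum.cong refl)
    fix q assume q: "q \<in> {1..N}"
    have "(\<Sum>k\<in>{q<..N}. zsgn x ^ k / real k ^ 2) = sharm2 (zsgn x) N - sharm2 (zsgn x) q"
      by (rule sum_tail[OF sharm2_def]) (use q in simp)
    then show "(\<Sum>k\<in>{q<..N}. zsgn x ^ k / real k ^ 2 * (zsgn z ^ q / real q ^ u))
        = zsgn z ^ q / real q ^ u * (sharm2 (zsgn x) N - sharm2 (zsgn x) q)"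
      by (simp only: sum_distrib_right[symmetric]) (rule mult.commute)
  qed
  finally show "zeta_trunc [(2, x), (u, z)] N
      = (\<Sum>q=1..N. zsgn z ^ q / real q ^ u * (sharm2 (zsgn x) N - sharm2 (zsgn x) q))" .
next
  have N: "negl (\<lambda>q M. 1 * (sharm2 (zsgn x) M - sharm2_lim (zsgn x)))"
    by (rule negl_sharm2[OF zsgn_cases abs_le_sq_1])
  show "negl (\<lambda>q M. sharm2 (zsgn x) M - sharm2 (zsgn x) q - (sharm2_lim (zsgn x) - sharm2 (zsgn x) q))"
    by (rule negl_cong[OF N]) simp
qed

text \<open>Here the pole is the outermost index, so the inner sums end at q - 1 and the expansions
  are exact at every \<open>M\<close>.\<close>

lemma polar_u_first:
  "polar (zsgn z) u (zeta_trunc [(u, z), (Suc 0, x), (Suc 0, y)]) (\<lambda>q M. dharm (zsgn x) (zsgn y) (q - 1))"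
  "polar (zsgn z) u (zeta_trunc [(u, z), (2, x)]) (\<lambda>q M. sharm2 (zsgn x) (q - 1))"
  "polar (zsgn z) u (zeta_trunc [(Suc u, z), (Suc 0, x)]) (\<lambda>q M. 1 / real q * sharm (zsgn x) (q - 1))"
  "polar (zsgn z) u (zeta_trunc [(Suc (Suc u), z)]) (\<lambda>q M. 1 / real q ^ 2)"
  "polar (zsgn z) u (zeta_trunc [(u, z)]) (\<lambda>q M. 1)"
  by (rule polar_exact, simp add: dharm_def sharm_def sharm2_def power2_eq_square mult_ac)+

lemma polar_wsum:
  assumes a: "a = 1 \<or> a = -1" and b: "b = 1 \<or> b = -1" "b' = 1 \<or> b' = -1" and d: "d \<ge> 1"
  shows "polar (a * b * b') (Suc d) (\<lambda>M. wsum d a b b' M + wsum d a b' b M)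
     (lhs_lim a b b' (real (Suc d)))"
proof (rule polar_negl)
  show "a * b * b' = 1 \<or> a * b * b' = -1" "2 \<le> Suc d" using assms by auto
  show "wsum d a b b' M + wsum d a b' b M
    = (\<Sum>q=1..M. (a * b * b') ^ q / real q ^ Suc d * lhs_term a b b' (real (Suc d)) q M)" for M
    by (rule wsum_decomposition[OF b])
  have u: "0 \<le> real (Suc d)" by simp
  show "negl (\<lambda>q M. lhs_term a b b' (real (Suc d)) q M - lhs_lim a b b' (real (Suc d)) q M)"
    by (rule negl_cong[OF negl_add[OF negl_add[OF negl_pole[OF a b(1)] negl_pole[OF a b(2)]] negl_double_pole[OF a u]]])
       (simp add: lhs_term_def lhs_lim_def)
qed

section \<open>The six identities\<close>

text \<open>Carries an expansion and its shuffle correction together. The correction is linear, so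
  weighted sums over compositions can be formed before any polynomial is known explicitly.\<close>

definition sh_expansion :: "(nat \<Rightarrow> real) \<Rightarrow> real poly \<Rightarrow> bool" where
  "sh_expansion A Q \<longleftrightarrow> (\<exists>P. harm_expansion A P \<and> Q = P + [:zeta [nb 2] * coeff P 2:])"

lemma sh_expansion_zeta_sh: "reg_index idx \<Longrightarrow> sh_expansion (zeta_trunc idx) (zeta_sh idx)"
  unfolding sh_expansion_def using zeta_sh_eq zeta_star_reg(1) by blast

lemma sh_expansion_add:
  assumes "sh_expansion A P" "sh_expansion B Q"
  shows "sh_expansion (\<lambda>M. A M + B M) (P + Q)"
proof -
  obtain P' Q' where 1: "harm_expansion A P'" "P = P' + [:zeta [nb 2] * coeff P' 2:]"
    "harm_expansion B Q'" "Q = Q' + [:zeta [nb 2] * coeff Q' 2:]"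
    using assms unfolding sh_expansion_def by blast
  have "P + Q = (P' + Q') + [:zeta [nb 2] * coeff (P' + Q') 2:]"
    using 1(2,4) by (simp add: distrib_left)
  with harm_expansion_add[OF 1(1,3)] show ?thesis unfolding sh_expansion_def by blast
qed

lemma sh_expansion_cmult:
  assumes "sh_expansion A P"
  shows "sh_expansion (\<lambda>M. c * A M) (smult c P)"
proof -
  obtain P' where 1: "harm_expansion A P'" "P = P' + [:zeta [nb 2] * coeff P' 2:]"
    using assms unfolding sh_expansion_def by blast
  have "smult c P = smult c P' + [:zeta [nb 2] * coeff (smult c P') 2:]"
    using 1(2) by (simp add: smult_add_right mult_ac)
  with harm_expansion_cmult[OF 1(1)] show ?thesis unfolding sh_expansion_def by blast
qed

lemma sh_expansion_sum:
  "(\<And>i. i \<in> I \<Longrightarrow> sh_expansion (A i) (P i)) \<Longrightarrow> sh_expansion (\<lambda>M. \<Sum>i\<in>I. A i M) (\<Sum>i\<in>I. P i)"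
proof (induction I rule: infinite_finite_induct)
  case (insert i I)
  then show ?case by (simp add: sh_expansion_add)
qed (auto simp: sh_expansion_def harm_expansion_0 intro!: exI[of _ 0])

text \<open>By the limit, the expansions of the two sides differ by the constant K only and share
  their T^2 coefficient. The last assumption identifies K with the correction that leads from the
  expansion of \<open>L\<close> to \<open>Q\<close>.\<close>

lemma sh_expansion_eqI:
  assumes L: "sh_expansion L Q" and R: "harm_expansion R P"
    and lim: "(\<lambda>M. R M - L M) \<longlonglongrightarrow> K" and K: "K = zeta [nb 2] * coeff P 2"
  shows "Q = P"
proof -
  obtain P' where P': "harm_expansion L P'" "Q = P' + [:zeta [nb 2] * coeff P' 2:]"
    using L unfolding sh_expansion_def by blast
  have "harm_expansion (\<lambda>M. R M - L M) [:K:]"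
    using lim by (simp add: harm_expansion_const_iff)
  from harm_expansion_add[OF this P'(1)] have "harm_expansion R ([:K:] + P')" by simp
  then have P: "P = [:K:] + P'" by (rule harm_expansion_unique[OF R])
  have "coeff P 2 = coeff P' 2" by (subst P) (simp add: numeral_2_eq_2)
  then have "Q = P' + [:K:]" using P'(2) by (simp only: K)
  also have "\<dots> = P" using P by (simp only: add.commute)
  finally show ?thesis .
qed

lemma sh_expansion_wsum:
  assumes w: "4 \<le> w"
  shows "sh_expansion (wsum (w - 3) (zsgn x) (zsgn y * zsgn z) (zsgn y))
    (\<Sum>(a,b,c)\<in>comp3 w. smult (2 ^ (b - 1)) (zeta_sh [(a, x), (b, y), (c, z)]))"
proof -
  have "sh_expansion (\<lambda>M. \<Sum>t\<in>comp3 w. case t of (a,b,c) \<Rightarrow> 2 ^ (b - 1) * zeta_trunc [(a, x), (b, y), (c, z)] M)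
    (\<Sum>t\<in>comp3 w. case t of (a,b,c) \<Rightarrow> smult (2 ^ (b - 1)) (zeta_sh [(a, x), (b, y), (c, z)]))"
  proof (rule sh_expansion_sum)
    fix t assume "t \<in> comp3 w"
    then obtain a b c where t: "t = (a, b, c)" "0 < a" "0 < b" "0 < c" "a + b + c = w"
      by (auto simp: comp3_def)
    \<comment> \<open>The weight excludes the exponents (1, 1, 1), so two leading unbarred ones are
      followed by an exponent of at least 2.\<close>
    have "reg_index [(a, x), (b, y), (c, z)]" using t w by auto
    from sh_expansion_cmult[OF sh_expansion_zeta_sh[OF this]]
    show "sh_expansion (\<lambda>M. case t of (a,b,c) \<Rightarrow> 2 ^ (b - 1) * zeta_trunc [(a, x), (b, y), (c, z)] M)
      (case t of (a,b,c) \<Rightarrow> smult (2 ^ (b - 1)) (zeta_sh [(a, x), (b, y), (c, z)]))"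
      unfolding t(1) prod.case .
  qed
  moreover have "(\<lambda>M. \<Sum>t\<in>comp3 w. case t of (a,b,c) \<Rightarrow> 2 ^ (b - 1) * zeta_trunc [(a, x), (b, y), (c, z)] M)
      = wsum (w - 3) (zsgn x) (zsgn y * zsgn z) (zsgn y)"
    using wsum_eq[of w x y z] w by (intro ext) simp
  ultimately show ?thesis by simp
qed

lemma wsum_zeta_limit:
  assumes w: "4 \<le> w"
  shows "wsum (w - 3) (-1) (zsgn y * zsgn z) (zsgn y)
    \<longlonglongrightarrow> (\<Sum>(a,b,c)\<in>comp3 w. 2 ^ (b - 1) * zeta [br a, (b, y), (c, z)])"
proof -
  have "(\<lambda>M. \<Sum>t\<in>comp3 w. case t of (a,b,c) \<Rightarrow> 2 ^ (b - 1) * zeta_trunc [br a, (b, y), (c, z)] M)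
    \<longlonglongrightarrow> (\<Sum>t\<in>comp3 w. case t of (a,b,c) \<Rightarrow> 2 ^ (b - 1) * zeta [br a, (b, y), (c, z)])"
  proof (rule tendsto_sum)
    fix t assume "t \<in> comp3 w"
    then obtain a b c where t: "t = (a, b, c)" "0 < a" "0 < b" "0 < c"
      by (auto simp: comp3_def)
    then have "conv_index [br a, (b, y), (c, z)]" by auto
    from tendsto_mult_left[OF zeta_limit[OF this]]
    show "(\<lambda>M. case t of (a,b,c) \<Rightarrow> 2 ^ (b - 1) * zeta_trunc [br a, (b, y), (c, z)] M)
      \<longlonglongrightarrow> (case t of (a,b,c) \<Rightarrow> 2 ^ (b - 1) * zeta [br a, (b, y), (c, z)])"
      unfolding t(1) prod.case .
  qed
  moreover have "(\<lambda>M. \<Sum>t\<in>comp3 w. case t of (a,b,c) \<Rightarrow> 2 ^ (b - 1) * zeta_trunc [br a, (b, y), (c, z)] M)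
      = wsum (w - 3) (zsgn True) (zsgn y * zsgn z) (zsgn y)"
    using wsum_eq[of w True y z] w by (intro ext) simp
  ultimately show ?thesis by (simp add: zsgn_def)
qed

section \<open>Normal forms at a single pole and the six termwise identities\<close>

lemma shsum_values:
  "shsum 1 1 n = 2 * dharm 1 1 n" "shsum 1 (-1) n = dharm (-1) (-1) n + dharm 1 (-1) n"
  "shsum (-1) 1 n = dharm 1 (-1) n + dharm (-1) (-1) n" "shsum (-1) (-1) n = 2 * dharm (-1) 1 n"
  using shsum_eq[of 1 1 n] shsum_eq[of 1 "-1" n] shsum_eq[of "-1" 1 n] shsum_eq[of "-1" "-1" n] by simp_all

lemma zsgn_simps [simp]: "zsgn False = 1" "zsgn True = -1"
  by (simp_all add: zsgn_def)

definition polar11 :: "real \<Rightarrow> real \<Rightarrow> nat \<Rightarrow> nat \<Rightarrow> real" where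
  "polar11 a b q M = (dharm_lim a b M - dharm a b q) - sharm b q * (sharm_lim a M - sharm a q)"

definition polar1 :: "real \<Rightarrow> nat \<Rightarrow> nat \<Rightarrow> real" where
  "polar1 a q M = 1 / real q * (sharm_lim a M - sharm a q)"

lemma polar_zeta_trunc:
  assumes "u \<ge> 2"
  shows "polar (zsgn z) u (zeta_trunc [(1, x), (1, y), (u, z)]) (polar11 (zsgn x) (zsgn y))"
    "polar (zsgn z) u (zeta_trunc [(1, x), (Suc u, z)]) (polar1 (zsgn x))"
    "polar (zsgn z) u (zeta_trunc [(2, x), (u, z)]) (\<lambda>q M. sharm2_lim (zsgn x) - sharm2 (zsgn x) q)"
    "polar (zsgn z) u (zeta_trunc [(u, z), (1, x), (1, y)]) (\<lambda>q M. dharm (zsgn x) (zsgn y) (q - 1))"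
    "polar (zsgn z) u (zeta_trunc [(u, z), (2, x)]) (\<lambda>q M. sharm2 (zsgn x) (q - 1))"
    "polar (zsgn z) u (zeta_trunc [(Suc u, z), (1, x)]) (\<lambda>q M. 1 / real q * sharm (zsgn x) (q - 1))"
    "polar (zsgn z) u (zeta_trunc [(Suc (Suc u), z)]) (\<lambda>q M. 1 / real q ^ 2)"
    "polar (zsgn z) u (zeta_trunc [(u, z)]) (\<lambda>q M. 1)"
  using polar_1_1_u[OF assms, of z x y] polar_1_v[OF assms, of z x] polar_2_u[OF assms, of z x]
    polar_u_first[of z u] unfolding polar11_def polar1_def One_nat_def by blast+

lemmas polar_cases =
  polar_zeta_trunc(1,4)[where x = False and y = False] polar_zeta_trunc(1,4)[where x = False and y = True]
  polar_zeta_trunc(1,4)[where x = True and y = False] polar_zeta_trunc(1,4)[where x = True and y = True]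
  polar_zeta_trunc(2,3,5,6)[where x = False] polar_zeta_trunc(2,3,5,6)[where x = True]
  polar_zeta_trunc(7,8)

lemmas polar_bar = polar_cases[where z = True, unfolded zsgn_simps]
lemmas polar_nobar = polar_cases[where z = False, unfolded zsgn_simps]

lemma polar_flip:
  "polar (-1) u A T \<Longrightarrow> polar 1 u A (\<lambda>q M. (-1) ^ q * T q M)"
  "polar 1 u A T \<Longrightarrow> polar (-1) u A (\<lambda>q M. (-1) ^ q * T q M)"
  using polar_twist[of "-1" u A T 1] polar_twist[of 1 u A T "-1"] by simp_all

lemma sign_power_cases: "(-1) ^ q = (1::real) \<or> (-1) ^ q = (-1::real)"
  by (cases "even q") auto

text \<open>As rewrite rules these eliminate every product of two harmonic sums at the same
  \<open>q\<close>; ring normalization can do the rest.\<close>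

lemma stuffle_products:
  "sharm 1 q * sharm 1 q = 2 * dharm 1 1 q + sharm2 1 q"
  "sharm (-1) q * sharm (-1) q = 2 * dharm (-1) (-1) q + sharm2 1 q"
  "sharm 1 q * sharm (-1) q = dharm 1 (-1) q + dharm (-1) 1 q + sharm2 (-1) q"
  "sharm (-1) q * sharm 1 q = dharm 1 (-1) q + dharm (-1) 1 q + sharm2 (-1) q"
  using stuffle[of 1 q 1] stuffle[of "-1" q "-1"] stuffle[of 1 q "-1"] stuffle[of "-1" q 1] by simp_all

text \<open>Everything is expressed through t = 1/q, e = (-1)^q, the sums at q and the limits, in
  which the termwise identities are polynomial.\<close>

lemma lhs_lim_values:
  assumes q: "q \<ge> 1" and t: "t = 1 / real q" and e: "e = (-1) ^ q"
  shows "polar11 1 1 q M = dharm 1 1 M - dharm 1 1 q - sharm 1 q * (harm M - sharm 1 q)"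
  "polar11 1 (-1) q M = dharm 1 (-1) M - dharm 1 (-1) q - sharm (-1) q * (harm M - sharm 1 q)"
  "polar11 (-1) 1 q M = zeta [br 1] ^ 2 / 2 - dharm (-1) 1 q - sharm 1 q * (zeta [br 1] - sharm (-1) q)"
  "polar11 (-1) (-1) q M = (zeta [br 1] ^ 2 - zeta [nb 2]) / 2 - dharm (-1) (-1) q - sharm (-1) q * (zeta [br 1] - sharm (-1) q)"
  "polar1 1 q M = t * (harm M - sharm 1 q)"
  "polar1 (-1) q M = t * (zeta [br 1] - sharm (-1) q)"
  "sharm2_lim 1 - sharm2 1 q = zeta [nb 2] - sharm2 1 q"
  "sharm2_lim (-1) - sharm2 (-1) q = - zeta [nb 2] / 2 - sharm2 (-1) q"
  "sharm 1 (q - 1) = sharm 1 q - t" "sharm (-1) (q - 1) = sharm (-1) q - e * t"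
  "sharm2 1 (q - 1) = sharm2 1 q - t * t" "sharm2 (-1) (q - 1) = sharm2 (-1) q - e * (t * t)"
  "dharm 1 1 (q - 1) = dharm 1 1 q - t * (sharm 1 q - t)"
  "dharm 1 (-1) (q - 1) = dharm 1 (-1) q - t * (sharm (-1) q - e * t)"
  "dharm (-1) 1 (q - 1) = dharm (-1) 1 q - e * t * (sharm 1 q - t)"
  "dharm (-1) (-1) (q - 1) = dharm (-1) (-1) q - e * t * (sharm (-1) q - e * t)"
  "1 / real q ^ 2 = t * t"
  using q by (simp_all add: polar11_def polar1_def sharm_lim_def dharm_lim_def sharm2_lim_def sharm_pred[OF q, unfolded One_nat_def]
      sharm2_pred[OF q, unfolded One_nat_def] dharm_pred[OF q, unfolded One_nat_def] t e power2_eq_square)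

lemma pole_lim_values:
  assumes q: "q \<ge> 1" and t: "t = 1 / real q" and e: "e = (-1) ^ q"
  shows "pole_lim 1 1 q M = - (sharm 1 q - t) * sharm 1 q + 2 * dharm 1 1 q + (dharm 1 1 M - dharm 1 1 q)
      - (sharm 1 q - t) * (harm M - sharm 1 q) + 2 * dharm 1 1 q - sharm 1 q * sharm 1 q"
    "pole_lim 1 (-1) q M = - (sharm (-1) q - e * t) * sharm 1 q + (dharm (-1) (-1) q + dharm 1 (-1) q)
      + (dharm 1 (-1) M - dharm 1 (-1) q) - (sharm (-1) q - e * t) * (harm M - sharm 1 q)
      - zeta [br 1] * (sharm 1 q - sharm (-1) q) + (dharm (-1) (-1) q + dharm 1 (-1) q) - sharm (-1) q * sharm (-1) q"
    "pole_lim (-1) 1 q M = - (sharm 1 q - t) * sharm (-1) q + (dharm 1 (-1) q + dharm (-1) (-1) q)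
      + (zeta [br 1] ^ 2 / 2 - dharm (-1) 1 q) - (sharm 1 q - t) * (zeta [br 1] - sharm (-1) q)
      - zeta [br 1] * (sharm (-1) q - sharm 1 q) + 2 * dharm (-1) 1 q - sharm 1 q * sharm (-1) q"
    "pole_lim (-1) (-1) q M = - (sharm (-1) q - e * t) * sharm (-1) q + 2 * dharm (-1) 1 q
      + ((zeta [br 1] ^ 2 - zeta [nb 2]) / 2 - dharm (-1) (-1) q) - (sharm (-1) q - e * t) * (zeta [br 1] - sharm (-1) q)
      + (dharm 1 (-1) q + dharm (-1) (-1) q) - sharm (-1) q * sharm 1 q"
  unfolding pole_lim_def gap_lim_def lhs_lim_values[OF assms]
  by (simp_all add: shsum_values sharm_lim_def dharm_lim_def)

lemma lhs_lim_eq: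
  assumes t: "t = 1 / real q"
  shows "lhs_lim a b b' u q M = sharm b (q - 1) * sharm b' (q - 1) - shsum b b' q + pole_lim a b q M + pole_lim a b' q M
     + (u * t * (sharm_lim a M - sharm a q) - (sharm2_lim a - sharm2 a q))"
  unfolding lhs_lim_def head_sum_eq t by simp

lemma termwiseI:
  assumes "\<And>q M t e. q \<ge> 1 \<Longrightarrow> t = 1 / real q \<Longrightarrow> e = (-1 :: real) ^ q \<Longrightarrow> e = 1 \<or> e = -1 \<Longrightarrow> P q M"
  shows "\<forall>q M. q \<ge> 1 \<longrightarrow> P q M"
  using assms sign_power_cases by blast

lemmas termwise_simps = algebra_simps stuffle_products power2_eq_square zeta_bar_two diff_divide_distrib

lemma polar_identity:
  assumes "zsgn z = a * b * b'" "a = 1 \<or> a = -1" "b = 1 \<or> b = -1" "b' = 1 \<or> b' = -1"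
    and d: "d \<ge> 1" and ud: "u = Suc d" and R: "polar (zsgn z) u R T"
    and T: "\<forall>q M. q \<ge> 1 \<longrightarrow> T q M - lhs_lim a b b' (real u) q M = K"
  shows "(\<lambda>M. R M - (wsum d a b b' M + wsum d a b' b M)) \<longlonglongrightarrow> K * zeta [(u, z)]"
proof -
  have "polar (zsgn z) u (\<lambda>M. wsum d a b b' M + wsum d a b' b M) (lhs_lim a b b' (real u))"
    using polar_wsum[of a b b' d] assms by simp
  from polar_const[OF polar_diff[OF R this] _ T] show ?thesis using d ud by simp
qed

text \<open>The surplus zeta(2) is the limit of \<open>sharm2\<close> at the double pole, which
  nothing on the other side matches. It is the expected one, as the T^2 coefficient of twice
  \<open>zeta_star\<close> at (1, 1, u) is zeta(u).\<close>

lemma termwise_1: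
  "\<forall>q M. q \<ge> 1 \<longrightarrow> (2 * polar11 1 1 q M + real (Suc (Suc u)) * polar1 1 q M
      - 2 * sharm2 1 (q - 1) - 1 / real q ^ 2)
    - lhs_lim 1 1 1 (real u) q M = zeta [nb 2]"
  (is "\<forall>q M. _ \<longrightarrow> ?P q M")
proof (rule termwiseI)
  fix q M :: nat and t e :: real assume v: "q \<ge> 1" "t = 1 / real q" "e = (-1) ^ q" and e: "e = 1 \<or> e = -1"
  show "?P q M"
    unfolding lhs_lim_eq[OF v(2)] pole_lim_values[OF v] shsum_values v(3)[symmetric] sharm_lim_def
      lhs_lim_values[OF v] v(2)[symmetric]
    using e by (elim disjE; simp add: termwise_simps)
qed

lemma identity_1:
  assumes d: "d \<ge> 1" and ud: "u = Suc d"
  shows "(\<lambda>M. (2 * zeta_trunc [nb 1, nb 1, nb u] M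
      + real (Suc (Suc u)) * zeta_trunc [nb 1, nb (Suc u)] M - 2 * zeta_trunc [nb u, nb 2] M
      - zeta_trunc [nb (Suc (Suc u))] M)
      - (wsum d 1 1 1 M + wsum d 1 1 1 M)) \<longlonglongrightarrow> zeta [nb 2] * zeta [nb u]"
proof -
  have u: "u \<ge> 2" using assms by simp
  show ?thesis
    by (rule polar_identity[of False "1" "1" "1", unfolded zsgn_simps, OF _ _ _ _ assms _ termwise_1], simp, simp, simp, simp)
       (intro polar_diff polar_add polar_cmult polar_nobar[OF u] polar_bar[OF u, THEN polar_flip(1)])
qed

text \<open>The zeta(2) of the double pole and the one from -2 zeta(bar 1, bar 1, u) are offset by 4
  zeta(bar 2, u).\<close>

lemma termwise_2:
  "\<forall>q M. q \<ge> 1 \<longrightarrow> (4 * dharm (-1) (-1) (q - 1) - 4 * dharm (-1) 1 (q - 1)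
      - 2 * polar11 (-1) (-1) q M + 2 * polar11 (-1) 1 q M + 2 * polar11 1 (-1) q M
      + 2 * ((-1) ^ q * (1 / real q * sharm (-1) (q - 1)))
      - 2 * ((-1) ^ q * (1 / real q * sharm 1 (q - 1))) + real u * polar1 1 q M
      + 2 * ((-1) ^ q * polar1 1 q M) + 4 * (sharm2_lim (-1) - sharm2 (-1) q) + 2 * sharm2 1 (q - 1)
      + 1 / real q ^ 2 + 2 * ((-1) ^ q * (1 / real q ^ 2)))
    - lhs_lim 1 (-1) (-1) (real u) q M = 0"
  (is "\<forall>q M. _ \<longrightarrow> ?P q M")
proof (rule termwiseI)
  fix q M :: nat and t e :: real assume v: "q \<ge> 1" "t = 1 / real q" "e = (-1) ^ q" and e: "e = 1 \<or> e = -1"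
  show "?P q M"
    unfolding lhs_lim_eq[OF v(2)] pole_lim_values[OF v] shsum_values v(3)[symmetric] sharm_lim_def
      lhs_lim_values[OF v] v(2)[symmetric]
    using e by (elim disjE; simp add: termwise_simps)
qed

lemma identity_2:
  assumes d: "d \<ge> 1" and ud: "u = Suc d"
  shows "(\<lambda>M. (4 * zeta_trunc [nb u, br 1, br 1] M - 4 * zeta_trunc [nb u, br 1, nb 1] M
      - 2 * zeta_trunc [br 1, br 1, nb u] M + 2 * zeta_trunc [br 1, nb 1, nb u] M
      + 2 * zeta_trunc [nb 1, br 1, nb u] M + 2 * zeta_trunc [br (Suc u), br 1] M
      - 2 * zeta_trunc [br (Suc u), nb 1] M + real u * zeta_trunc [nb 1, nb (Suc u)] M
      + 2 * zeta_trunc [nb 1, br (Suc u)] M + 4 * zeta_trunc [br 2, nb u] M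
      + 2 * zeta_trunc [nb u, nb 2] M + zeta_trunc [nb (Suc (Suc u))] M
      + 2 * zeta_trunc [br (Suc (Suc u))] M)
      - (wsum d 1 (-1) (-1) M + wsum d 1 (-1) (-1) M)) \<longlonglongrightarrow> 0 * zeta [nb u]"
proof -
  have u: "u \<ge> 2" using assms by simp
  show ?thesis
    by (rule polar_identity[of False "1" "-1" "-1", unfolded zsgn_simps, OF _ _ _ _ assms _ termwise_2], simp, simp, simp, simp)
       (intro polar_diff polar_add polar_cmult polar_nobar[OF u] polar_bar[OF u, THEN polar_flip(1)])
qed

text \<open>The product zeta(2) zeta(bar u) enters as the constant coefficient zeta(2) at every
  pole.\<close>

lemma termwise_3:
  "\<forall>q M. q \<ge> 1 \<longrightarrow> (2 * polar11 (-1) (-1) q M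
      + real (Suc (Suc u)) * polar1 (-1) q M + 2 * (1 / real q * sharm (-1) (q - 1))
      - 2 * (1 / real q * sharm 1 (q - 1)) + (sharm2_lim (-1) - sharm2 (-1) q) + (sharm2_lim 1
      - sharm2 1 q) + 2 * ((-1) ^ q * (1 / real q ^ 2)) - 1 / real q ^ 2 + zeta [nb 2] * 1)
    - lhs_lim (-1) 1 1 (real u) q M = 0"
  (is "\<forall>q M. _ \<longrightarrow> ?P q M")
proof (rule termwiseI)
  fix q M :: nat and t e :: real assume v: "q \<ge> 1" "t = 1 / real q" "e = (-1) ^ q" and e: "e = 1 \<or> e = -1"
  show "?P q M"
    unfolding lhs_lim_eq[OF v(2)] pole_lim_values[OF v] shsum_values v(3)[symmetric] sharm_lim_def
      lhs_lim_values[OF v] v(2)[symmetric]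
    using e by (elim disjE; simp add: termwise_simps)
qed

lemma identity_3:
  assumes d: "d \<ge> 1" and ud: "u = Suc d"
  shows "(\<lambda>M. (2 * zeta_trunc [br 1, br 1, br u] M
      + real (Suc (Suc u)) * zeta_trunc [br 1, br (Suc u)] M + 2 * zeta_trunc [br (Suc u), br 1] M
      - 2 * zeta_trunc [br (Suc u), nb 1] M + zeta_trunc [br 2, br u] M + zeta_trunc [nb 2, br u] M
      + 2 * zeta_trunc [nb (Suc (Suc u))] M - zeta_trunc [br (Suc (Suc u))] M
      + zeta [nb 2] * zeta_trunc [br u] M)
      - (wsum d (-1) 1 1 M + wsum d (-1) 1 1 M)) \<longlonglongrightarrow> 0 * zeta [br u]"
proof -
  have u: "u \<ge> 2" using assms by simp
  show ?thesis
    by (rule polar_identity[of True "-1" "1" "1", unfolded zsgn_simps, OF _ _ _ _ assms _ termwise_3], simp, simp, simp, simp)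
       (intro polar_diff polar_add polar_cmult polar_bar[OF u] polar_nobar[OF u, THEN polar_flip(2)])
qed

lemma termwise_4:
  "\<forall>q M. q \<ge> 1 \<longrightarrow> (2 * polar11 (-1) (-1) q M + real u * polar1 (-1) q M
      + 2 * ((-1) ^ q * polar1 (-1) q M) + (sharm2_lim (-1) - sharm2 (-1) q) + (sharm2_lim 1
      - sharm2 1 q) + 1 / real q ^ 2)
    - lhs_lim (-1) (-1) (-1) (real u) q M = 0"
  (is "\<forall>q M. _ \<longrightarrow> ?P q M")
proof (rule termwiseI)
  fix q M :: nat and t e :: real assume v: "q \<ge> 1" "t = 1 / real q" "e = (-1) ^ q" and e: "e = 1 \<or> e = -1"
  show "?P q M"
    unfolding lhs_lim_eq[OF v(2)] pole_lim_values[OF v] shsum_values v(3)[symmetric] sharm_lim_def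
      lhs_lim_values[OF v] v(2)[symmetric]
    using e by (elim disjE; simp add: termwise_simps)
qed

lemma identity_4:
  assumes d: "d \<ge> 1" and ud: "u = Suc d"
  shows "(\<lambda>M. (2 * zeta_trunc [br 1, br 1, br u] M + real u * zeta_trunc [br 1, br (Suc u)] M
      + 2 * zeta_trunc [br 1, nb (Suc u)] M + zeta_trunc [br 2, br u] M + zeta_trunc [nb 2, br u] M
      + zeta_trunc [br (Suc (Suc u))] M)
      - (wsum d (-1) (-1) (-1) M + wsum d (-1) (-1) (-1) M)) \<longlonglongrightarrow> 0 * zeta [br u]"
proof -
  have u: "u \<ge> 2" using assms by simp
  show ?thesis
    by (rule polar_identity[of True "-1" "-1" "-1", unfolded zsgn_simps, OF _ _ _ _ assms _ termwise_4], simp, simp, simp, simp)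
       (intro polar_diff polar_add polar_cmult polar_bar[OF u] polar_nobar[OF u, THEN polar_flip(2)])
qed

lemma termwise_5:
  "\<forall>q M. q \<ge> 1 \<longrightarrow> (2 * dharm (-1) 1 (q - 1) + 2 * polar11 (-1) (-1) q M
      - 2 * dharm (-1) (-1) (q - 1) + real (Suc u) * polar1 (-1) q M
      + ((-1) ^ q * (1 / real q * sharm 1 (q - 1))) + ((-1) ^ q * polar1 (-1) q M)
      - ((-1) ^ q * (1 / real q * sharm (-1) (q - 1))) + (sharm2_lim 1 - sharm2 1 q) - sharm2 1 (q - 1))
    - lhs_lim (-1) 1 (-1) (real u) q M = 0"
  (is "\<forall>q M. _ \<longrightarrow> ?P q M")
proof (rule termwiseI)
  fix q M :: nat and t e :: real assume v: "q \<ge> 1" "t = 1 / real q" "e = (-1) ^ q" and e: "e = 1 \<or> e = -1"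
  show "?P q M"
    unfolding lhs_lim_eq[OF v(2)] pole_lim_values[OF v] shsum_values v(3)[symmetric] sharm_lim_def
      lhs_lim_values[OF v] v(2)[symmetric]
    using e by (elim disjE; simp add: termwise_simps)
qed

lemma identity_5:
  assumes d: "d \<ge> 1" and ud: "u = Suc d"
  shows "(\<lambda>M. (2 * zeta_trunc [nb u, br 1, nb 1] M + 2 * zeta_trunc [br 1, br 1, nb u] M
      - 2 * zeta_trunc [nb u, br 1, br 1] M + real (Suc u) * zeta_trunc [br 1, nb (Suc u)] M
      + zeta_trunc [br (Suc u), nb 1] M + zeta_trunc [br 1, br (Suc u)] M
      - zeta_trunc [br (Suc u), br 1] M + zeta_trunc [nb 2, nb u] M - zeta_trunc [nb u, nb 2] M)
      - (wsum d (-1) 1 (-1) M + wsum d (-1) (-1) 1 M)) \<longlonglongrightarrow> 0 * zeta [nb u]"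
proof -
  have u: "u \<ge> 2" using assms by simp
  show ?thesis
    by (rule polar_identity[of False "-1" "1" "-1", unfolded zsgn_simps, OF _ _ _ _ assms _ termwise_5], simp, simp, simp, simp)
       (intro polar_diff polar_add polar_cmult polar_nobar[OF u] polar_bar[OF u, THEN polar_flip(1)])
qed

text \<open>The term 3 zeta(bar 2) zeta(bar u) brings the surplus to zeta(2)/2, as required: the T^2
  coefficient of \<open>zeta_star\<close> at (1, 1, bar u) is zeta(bar u)/2.\<close>

lemma termwise_6:
  "\<forall>q M. q \<ge> 1 \<longrightarrow> (polar11 1 (-1) q M + polar11 (-1) 1 q M
      - polar11 (-1) (-1) q M + polar11 1 1 q M - (1 / real q * sharm (-1) (q - 1))
      + (1 / real q * sharm 1 (q - 1)) + ((-1) ^ q * polar1 1 q M) + real (Suc u) * polar1 1 q M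
      + (sharm2_lim (-1) - sharm2 (-1) q) + (sharm2_lim 1 - sharm2 1 q) + 1 / real q ^ 2
      + (3 * zeta [br 2]) * 1)
    - lhs_lim 1 (-1) 1 (real u) q M = zeta [nb 2] / 2"
  (is "\<forall>q M. _ \<longrightarrow> ?P q M")
proof (rule termwiseI)
  fix q M :: nat and t e :: real assume v: "q \<ge> 1" "t = 1 / real q" "e = (-1) ^ q" and e: "e = 1 \<or> e = -1"
  show "?P q M"
    unfolding lhs_lim_eq[OF v(2)] pole_lim_values[OF v] shsum_values v(3)[symmetric] sharm_lim_def
      lhs_lim_values[OF v] v(2)[symmetric]
    using e by (elim disjE; simp add: termwise_simps)
qed

lemma identity_6:
  assumes d: "d \<ge> 1" and ud: "u = Suc d"
  shows "(\<lambda>M. (zeta_trunc [nb 1, br 1, br u] M + zeta_trunc [br 1, nb 1, br u] M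
      - zeta_trunc [br 1, br 1, br u] M + zeta_trunc [nb 1, nb 1, br u] M
      - zeta_trunc [br (Suc u), br 1] M + zeta_trunc [br (Suc u), nb 1] M
      + zeta_trunc [nb 1, nb (Suc u)] M + real (Suc u) * zeta_trunc [nb 1, br (Suc u)] M
      + zeta_trunc [br 2, br u] M + zeta_trunc [nb 2, br u] M + zeta_trunc [br (Suc (Suc u))] M
      + (3 * zeta [br 2]) * zeta_trunc [br u] M)
      - (wsum d 1 (-1) 1 M + wsum d 1 1 (-1) M)) \<longlonglongrightarrow> (zeta [nb 2] / 2) * zeta [br u]"
proof -
  have u: "u \<ge> 2" using assms by simp
  show ?thesis
    by (rule polar_identity[of True "1" "-1" "1", unfolded zsgn_simps, OF _ _ _ _ assms _ termwise_6], simp, simp, simp, simp)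
       (intro polar_diff polar_add polar_cmult polar_bar[OF u] polar_nobar[OF u, THEN polar_flip(2)])
qed


section \<open>Passage to the regularized sums\<close>

text \<open>Applied when the third argument has no bar: the signs of \<open>p\<close> and
  \<open>q\<close> agree, and the symmetrized sum is twice a single one.\<close>

lemma sh_expansion_double:
  assumes "4 \<le> w"
  shows "sh_expansion (\<lambda>M. wsum (w - 3) (zsgn x) (zsgn y * zsgn z) (zsgn y) M + wsum (w - 3) (zsgn x) (zsgn y * zsgn z) (zsgn y) M)
    (\<Sum>(a,b,c)\<in>comp3 w. smult (2 * 2 ^ (b - 1)) (zeta_sh [(a, x), (b, y), (c, z)]))"
proof -
  have "(\<Sum>(a,b,c)\<in>comp3 w. smult (2 * 2 ^ (b - 1)) (zeta_sh [(a, x), (b, y), (c, z)]))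
      = (\<Sum>(a,b,c)\<in>comp3 w. smult (2 ^ (b - 1)) (zeta_sh [(a, x), (b, y), (c, z)]))
      + (\<Sum>(a,b,c)\<in>comp3 w. smult (2 ^ (b - 1)) (zeta_sh [(a, x), (b, y), (c, z)]))"
    unfolding sum.distrib[symmetric] case_prod_unfold mult_2 smult_add_left ..
  then show ?thesis
    using sh_expansion_add[OF sh_expansion_wsum[OF assms, of x y z] sh_expansion_wsum[OF assms, of x y z]]
    by (simp only:)
qed

text \<open>Applied with a barred third argument and opposite \<open>y\<close>, \<open>y'\<close>:
  toggling the bar on the second argument exchanges the signs of \<open>p\<close> and
  \<open>q\<close>, so the summands are symmetric partners.\<close>

lemma sh_expansion_pair:
  assumes "4 \<le> w"
  shows "sh_expansion (\<lambda>M. wsum (w - 3) (zsgn x) (zsgn y * zsgn z) (zsgn y) M + wsum (w - 3) (zsgn x) (zsgn y' * zsgn z) (zsgn y') M)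
    (\<Sum>(a,b,c)\<in>comp3 w. smult (2 ^ (b - 1)) (zeta_sh [(a, x), (b, y), (c, z)] + zeta_sh [(a, x), (b, y'), (c, z)]))"
proof -
  have "(\<Sum>(a,b,c)\<in>comp3 w. smult (2 ^ (b - 1)) (zeta_sh [(a, x), (b, y), (c, z)] + zeta_sh [(a, x), (b, y'), (c, z)]))
      = (\<Sum>(a,b,c)\<in>comp3 w. smult (2 ^ (b - 1)) (zeta_sh [(a, x), (b, y), (c, z)]))
      + (\<Sum>(a,b,c)\<in>comp3 w. smult (2 ^ (b - 1)) (zeta_sh [(a, x), (b, y'), (c, z)]))"
    unfolding sum.distrib[symmetric] case_prod_unfold smult_add_right ..
  then show ?thesis
    using sh_expansion_add[OF sh_expansion_wsum[OF assms, of x y z] sh_expansion_wsum[OF assms, of x y' z]]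
    by (simp only:)
qed

lemma wsum_double_limit:
  assumes "4 \<le> w"
  shows "(\<lambda>M. wsum (w - 3) (-1) (zsgn y * zsgn z) (zsgn y) M + wsum (w - 3) (-1) (zsgn y * zsgn z) (zsgn y) M)
    \<longlonglongrightarrow> (\<Sum>(a,b,c)\<in>comp3 w. 2 * 2 ^ (b - 1) * zeta [br a, (b, y), (c, z)])"
proof -
  have "(\<Sum>(a,b,c)\<in>comp3 w. 2 * 2 ^ (b - 1) * zeta [br a, (b, y), (c, z)])
      = (\<Sum>(a,b,c)\<in>comp3 w. 2 ^ (b - 1) * zeta [br a, (b, y), (c, z)])
      + (\<Sum>(a,b,c)\<in>comp3 w. 2 ^ (b - 1) * zeta [br a, (b, y), (c, z)])"
    unfolding sum.distrib[symmetric] case_prod_unfold mult_2 distrib_right ..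
  then show ?thesis using tendsto_add[OF wsum_zeta_limit[OF assms, of y z] wsum_zeta_limit[OF assms, of y z]]
    by (simp only:)
qed

lemma harm_expansion_conv_cmult: "conv_index idx \<Longrightarrow> harm_expansion (\<lambda>M. c * zeta_trunc idx M) [:c * zeta idx:]"
  using harm_expansion_cmult[OF harm_expansion_conv, of idx c] by simp

lemma zeta_cmult_limit: "conv_index idx \<Longrightarrow> (\<lambda>M. c * zeta_trunc idx M) \<longlonglongrightarrow> c * zeta idx"
  by (intro tendsto_mult_left zeta_limit)

lemma limits_eqI:
  fixes l r :: real
  assumes "L \<longlonglongrightarrow> l" "R \<longlonglongrightarrow> r" "(\<lambda>M. R M - L M) \<longlonglongrightarrow> 0"
  shows "l = r"
  using LIMSEQ_unique[OF tendsto_diff[OF assms(2,1)] assms(3)] by simp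

lemma coeff_const_2: "coeff [:c:] 2 = 0"
  by (simp add: numeral_2_eq_2)

theorem theorem5p8:
  fixes w u v :: nat
  assumes "4 \<le> w" and "u = w - 2" and "v = w - 1"
  shows
   "(\<Sum>(a,b,c)\<in>comp3 w. smult (2 * 2 ^ (b - 1)) (zeta_sh [nb a, nb b, nb c]))
      = smult 2 (zeta_star [nb 1, nb 1, nb u]) + smult (real w) (zeta_star [nb 1, nb v])
        - [: 2 * zeta [nb u, nb 2] :] - [: zeta [nb w] :]
    \<and> (\<Sum>(a,b,c)\<in>comp3 w. smult (2 * 2 ^ (b - 1)) (zeta_sh [nb a, br b, nb c]))
      = [: 4 * zeta [nb u, br 1, br 1] :] - [: 4 * zeta [nb u, br 1, nb 1] :]
        - [: 2 * zeta [br 1, br 1, nb u] :] + [: 2 * zeta [br 1, nb 1, nb u] :]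
        + smult 2 (zeta_star [nb 1, br 1, nb u])
        + [: 2 * zeta [br v, br 1] :] - [: 2 * zeta [br v, nb 1] :]
        + smult (real u) (zeta_star [nb 1, nb v]) + smult 2 (zeta_star [nb 1, br v])
        + [: 4 * zeta [br 2, nb u] :] + [: 2 * zeta [nb u, nb 2] :] + [: zeta [nb w] :]
        + [: 2 * zeta [br w] :]
    \<and> (\<Sum>(a,b,c)\<in>comp3 w. 2 * 2 ^ (b - 1) * zeta [br a, nb b, nb c])
      = 2 * zeta [br 1, br 1, br u] + real w * zeta [br 1, br v] + 2 * zeta [br v, br 1]
        - 2 * zeta [br v, nb 1] + zeta [br 2, br u] + zeta [nb 2, br u] + 2 * zeta [nb w]
        - zeta [br w] + zeta [nb 2] * zeta [br u]
    \<and> (\<Sum>(a,b,c)\<in>comp3 w. 2 * 2 ^ (b - 1) * zeta [br a, br b, nb c])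
      = 2 * zeta [br 1, br 1, br u] + real u * zeta [br 1, br v] + 2 * zeta [br 1, nb v]
        + zeta [br 2, br u] + zeta [nb 2, br u] + zeta [br w]
    \<and> (\<Sum>(a,b,c)\<in>comp3 w. smult (2 ^ (b - 1))
          (zeta_sh [br a, br b, br c] + zeta_sh [br a, nb b, br c]))
      = [: 2 * zeta [nb u, br 1, nb 1] :] + [: 2 * zeta [br 1, br 1, nb u] :]
        - [: 2 * zeta [nb u, br 1, br 1] :] + [: real v * zeta [br 1, nb v] :]
        + [: zeta [br v, nb 1] :] + [: zeta [br 1, br v] :] - [: zeta [br v, br 1] :]
        + [: zeta [nb 2, nb u] :] - [: zeta [nb u, nb 2] :]
    \<and> (\<Sum>(a,b,c)\<in>comp3 w. smult (2 ^ (b - 1))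
          (zeta_sh [nb a, nb b, br c] + zeta_sh [nb a, br b, br c]))
      = zeta_star [nb 1, br 1, br u] + [: zeta [br 1, nb 1, br u] :]
        - [: zeta [br 1, br 1, br u] :] + zeta_star [nb 1, nb 1, br u]
        - [: zeta [br v, br 1] :] + [: zeta [br v, nb 1] :]
        + zeta_star [nb 1, nb v] + smult (real v) (zeta_star [nb 1, br v])
        + [: zeta [br 2, br u] :] + [: zeta [nb 2, br u] :] + [: zeta [br w] :]
        + [: 3 * zeta [br 2] * zeta [br u] :]"
proof -
  define d where "d = w - 3"
  have d: "d \<ge> 1" "u = Suc d" and v: "v = Suc u" and w: "w = Suc (Suc u)" and u: "u \<ge> 2"
    using assms by (auto simp: d_def)
  note he = harm_expansion_add harm_expansion_diff harm_expansion_conv_cmult harm_expansion_cmult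
    harm_expansion_conv zeta_star_reg(1)
  note id = identity_1[OF d] identity_2[OF d] identity_3[OF d] identity_4[OF d] identity_5[OF d] identity_6[OF d]
  note id' = id[folded v, folded w[unfolded v[symmetric]]]
  \<comment> \<open>Of the indices that occur, only those with two leading unbarred ones have a T^2
    coefficient; it is half the value of the rest.\<close>
  note cf = coeff_const_2 zeta_star_nb1(2)[unfolded One_nat_def] zeta_star_nb1_nb1(2)[unfolded One_nat_def]
  show ?thesis
  proof (intro conjI)
    show "(\<Sum>(a,b,c)\<in>comp3 w. smult (2 * 2 ^ (b - 1)) (zeta_sh [nb a, nb b, nb c]))
      = smult 2 (zeta_star [nb 1, nb 1, nb u]) + smult (real w) (zeta_star [nb 1, nb v])
        - [: 2 * zeta [nb u, nb 2] :] - [: zeta [nb w] :]"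
    by (rule sh_expansion_eqI[OF sh_expansion_double[OF assms(1), of False False False, folded d_def, unfolded zsgn_simps mult_1] _ id'(1)],
          (intro he; use u v w in auto), use u v w in \<open>simp add: cf\<close>)
  next
    show "(\<Sum>(a,b,c)\<in>comp3 w. smult (2 * 2 ^ (b - 1)) (zeta_sh [nb a, br b, nb c]))
      = [: 4 * zeta [nb u, br 1, br 1] :] - [: 4 * zeta [nb u, br 1, nb 1] :]
        - [: 2 * zeta [br 1, br 1, nb u] :] + [: 2 * zeta [br 1, nb 1, nb u] :]
        + smult 2 (zeta_star [nb 1, br 1, nb u])
        + [: 2 * zeta [br v, br 1] :] - [: 2 * zeta [br v, nb 1] :]
        + smult (real u) (zeta_star [nb 1, nb v]) + smult 2 (zeta_star [nb 1, br v])
        + [: 4 * zeta [br 2, nb u] :] + [: 2 * zeta [nb u, nb 2] :] + [: zeta [nb w] :]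
        + [: 2 * zeta [br w] :]"
    by (rule sh_expansion_eqI[OF sh_expansion_double[OF assms(1), of False True False, folded d_def, unfolded zsgn_simps mult_1_right] _ id'(2)],
          (intro he; use u v w in auto), use u v w in \<open>simp add: cf\<close>)
  next
    show "(\<Sum>(a,b,c)\<in>comp3 w. 2 * 2 ^ (b - 1) * zeta [br a, nb b, nb c])
      = 2 * zeta [br 1, br 1, br u] + real w * zeta [br 1, br v] + 2 * zeta [br v, br 1]
        - 2 * zeta [br v, nb 1] + zeta [br 2, br u] + zeta [nb 2, br u] + 2 * zeta [nb w]
        - zeta [br w] + zeta [nb 2] * zeta [br u]"
      by (rule limits_eqI[OF wsum_double_limit[OF assms(1), of False False, folded d_def, unfolded zsgn_simps mult_1] _ id'(3)[unfolded mult_zero_left]],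
          intro tendsto_add tendsto_diff zeta_cmult_limit zeta_limit; use u v w in auto)
  next
    show "(\<Sum>(a,b,c)\<in>comp3 w. 2 * 2 ^ (b - 1) * zeta [br a, br b, nb c])
      = 2 * zeta [br 1, br 1, br u] + real u * zeta [br 1, br v] + 2 * zeta [br 1, nb v]
        + zeta [br 2, br u] + zeta [nb 2, br u] + zeta [br w]"
      by (rule limits_eqI[OF wsum_double_limit[OF assms(1), of True False, folded d_def, unfolded zsgn_simps mult_1_right] _ id'(4)[unfolded mult_zero_left]],
          intro tendsto_add tendsto_diff zeta_cmult_limit zeta_limit; use u v w in auto)
  next
    show "(\<Sum>(a,b,c)\<in>comp3 w. smult (2 ^ (b - 1))
          (zeta_sh [br a, br b, br c] + zeta_sh [br a, nb b, br c]))
      = [: 2 * zeta [nb u, br 1, nb 1] :] + [: 2 * zeta [br 1, br 1, nb u] :]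
        - [: 2 * zeta [nb u, br 1, br 1] :] + [: real v * zeta [br 1, nb v] :]
        + [: zeta [br v, nb 1] :] + [: zeta [br 1, br v] :] - [: zeta [br v, br 1] :]
        + [: zeta [nb 2, nb u] :] - [: zeta [nb u, nb 2] :]"
    by (rule sh_expansion_eqI[OF sh_expansion_pair[OF assms(1), of True True True False, folded d_def, unfolded zsgn_simps minus_mult_minus mult_1] _ id'(5)],
          (intro he; use u v w in auto), use u v w in \<open>simp add: cf\<close>)
  next
    show "(\<Sum>(a,b,c)\<in>comp3 w. smult (2 ^ (b - 1))
          (zeta_sh [nb a, nb b, br c] + zeta_sh [nb a, br b, br c]))
      = zeta_star [nb 1, br 1, br u] + [: zeta [br 1, nb 1, br u] :]
        - [: zeta [br 1, br 1, br u] :] + zeta_star [nb 1, nb 1, br u]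
        - [: zeta [br v, br 1] :] + [: zeta [br v, nb 1] :]
        + zeta_star [nb 1, nb v] + smult (real v) (zeta_star [nb 1, br v])
        + [: zeta [br 2, br u] :] + [: zeta [nb 2, br u] :] + [: zeta [br w] :]
        + [: 3 * zeta [br 2] * zeta [br u] :]"
    by (rule sh_expansion_eqI[OF sh_expansion_pair[OF assms(1), of False False True True, folded d_def, unfolded zsgn_simps minus_mult_minus mult_1] _ id'(6)],
          (intro he; use u v w in auto), use u v w in \<open>simp add: cf\<close>)
  qed
qed

end
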